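(* Let $\mathcal{C}$ be a 2-category having (small, conical) oplax bicolimits, let $I$ be a small 2-category, let $\Sigma$ be a class of 1-cells of $I$ containing identities and stable under composition, and let $F:I\to\mathcal{C}$ be a 2-functor. Then the objects $$\mathrm{oplaxbicolim}_{\Sigma^3}F\,\mathrm{dom}\,p_0,\qquad \mathrm{oplaxbicolim}_{\Sigma^2}F\,\mathrm{dom},\qquad \mathrm{oplaxbicolim}_{I}F,$$ at levels $2,1,0$, together with the 1-cells $d_0=\langle q_{\mathrm{dom}(d)}\rangle_{d\in\Sigma^2}$, $d_1=\langle q_{\mathrm{cod}(d)}F(d)\rangle_{d\in\Sigma^2}$, $i=\langle r_{\mathrm{id}_i}\rangle_{i\in I}$, $p_0=\langle r_{p_0\phi}\rangle_{\phi\in\Sigma^3}$, $p_1=\langle r_{p_1\phi}\rangle_{\phi\in\Sigma^3}$, $p_2=\langle r_{p_2\phi}F(p_0\phi)\rangle_{\phi\in\Sigma^3}$ induced by the indicated oplax cocones (see the context), define a codescent object $\mathscr{X}_{F,\Sigma}$ in $\mathcal{C}$; that is, there are (canonical) invertible 2-cells $d_0i\cong1$, $d_1i\cong1$, $d_0p_0\cong d_0p_1$, $d_1p_0\cong d_0p_2$, $d_1p_1\cong d_1p_2$.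
   Context: 2-categories and 2-functors are strict; juxtaposition of 1-cells and 2-cells denotes whiskering. **Oplax bicolimits.** For a 2-functor $F:I\to\mathcal{C}$, an oplax cocone with tip $B$ consists of 1-cells $q_i:F(i)\to B$ and, for each $d:i\to j$ in $I$, a 2-cell $q_d:q_jF(d)\Rightarrow q_i$, compatible with identities and composition and such that $q_{d'}\circ(q_jF(\sigma))=q_d$ for each 2-cell $\sigma:d\Rightarrow d'$; morphisms are modifications. The oplax bicolimit is an oplax cocone with tip $L$ such that composition gives equivalences, natural in $B$, between $\mathcal{C}[L,B]$ and the category of oplax cocones with tip $B$. The 1-cell induced by an oplax cocone $(k_i)$ is denoted $\langle k_i\rangle_{i\in I}$ (determined up to isomorphism). **Codescent object.** A codescent object in $\mathcal{C}$ consists of objects $\mathscr{X}(0),\mathscr{X}(1),\mathscr{X}(2)$, 1-cells $p_0,p_1,p_2:\mathscr{X}(2)\to\mathscr{X}(1)$, $d_0,d_1:\mathscr{X}(1)\to\mathscr{X}(0)$, $i:\mathscr{X}(0)\to\mathscr{X}(1)$, and invertible 2-cells $n_0:d_0i\Rightarrow 1$, $n_1:d_1i\Rightarrow 1$, $\theta_{01}:d_0p_0\Rightarrow d_0p_1$, $\theta_{02}:d_1p_0\Rightarrow d_0p_2$, $\theta_{12}:d_1p_1\Rightarrow d_1p_2$. **Indexing 2-categories.** $\Sigma^2$ has as objects the 1-cells $d$ of $I$ lying in $\Sigma$; 1-cells $d\to d'$ are pseudosquares: $\phi_0:\mathrm{dom}\,d\to\mathrm{dom}\,d'$, $\phi_1:\mathrm{cod}\,d\to\mathrm{cod}\,d'$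 arbitrary 1-cells of $I$, with an invertible 2-cell $\phi:d'\phi_0\Rightarrow\phi_1d$; 2-cells are pairs $\lambda_0:\phi_0\Rightarrow\psi_0$, $\lambda_1:\phi_1\Rightarrow\psi_1$ compatible with $\phi,\psi$. $\Sigma^3$ has as objects the invertible 2-cells $\phi:(p_2\phi)(p_0\phi)\Rightarrow p_1\phi$ of $I$ whose edges $p_0\phi,p_1\phi,p_2\phi$ lie in $\Sigma$; 1-cells and 2-cells are pseudonatural transformations and modifications between such triangles. There are evident 2-functors $\mathrm{dom},\mathrm{cod}:\Sigma^2\to I$ and $p_0,p_1,p_2:\Sigma^3\to\Sigma^2$, with $\mathrm{dom}\,p_0=\mathrm{dom}\,p_1$, $\mathrm{cod}\,p_0=\mathrm{dom}\,p_2$, $\mathrm{cod}\,p_1=\mathrm{cod}\,p_2$. **Cocones.** $(q_i:F(i)\to\mathrm{oplaxbicolim}_IF)$ with transition cells $q_d$, and $(r_d:F\mathrm{dom}(d)\to\mathrm{oplaxbicolim}_{\Sigma^2}F\mathrm{dom})_{d\in\Sigma^2}$, denote the oplax bicolimit cocones. The inducing oplax cocones are: - $(q_{\mathrm{dom}(d)})_{d\in\Sigma^2}$, with transition $q_{\phi_0}$ at $\phi:d\to d'$; - $(q_{\mathrm{cod}(d)}F(d))_{d\in\Sigma^2}$, with transition at $\phi:d\to d'$ the composite $q_{\mathrm{cod}\,d'}F(d')F(\phi_0)\cong q_{\mathrm{cod}\,d'}F(\phi_1)F(d)\Rightarrow q_{\mathrm{cod}\,d}F(d)$ of $F(\phi)$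 and $q_{\phi_1}$; - $(r_{\mathrm{id}_i})_{i\in I}$, with transition at $d:i\to j$ given by $r$ at the identity square $(d,d):\mathrm{id}_i\to\mathrm{id}_j$; - $(r_{p_0\phi})_{\phi\in\Sigma^3}$ and $(r_{p_1\phi})_{\phi\in\Sigma^3}$, restrictions of the cocone $r$ along $p_0$, $p_1$; - $(r_{p_2\phi}F(p_0\phi))_{\phi\in\Sigma^3}$, with transition at $u:\phi\to\psi$ (with vertex components $u_0,u_1,u_2$) the composite $r_{p_2\psi}F(p_0\psi)F(u_0)\cong r_{p_2\psi}F(u_1)F(p_0\phi)\Rightarrow r_{p_2\phi}F(p_0\phi)$. *)

theory Defs
  imports Main "HOL-Library.FuncSet"
begin

section \<open>Categories and equivalences\<close>

record ('o, 'm) cat =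
  cobj :: "'o set"
  carr :: "'m set"
  cdom :: "'m \<Rightarrow> 'o"
  ccod :: "'m \<Rightarrow> 'o"
  cid :: "'o \<Rightarrow> 'm"
  ccomp :: "'m \<Rightarrow> 'm \<Rightarrow> 'm"

definition chom :: "('o, 'm) cat \<Rightarrow> 'o \<Rightarrow> 'o \<Rightarrow> 'm set" where
  "chom A x y = {f \<in> carr A. cdom A f = x \<and> ccod A f = y}"

locale category =
  fixes A :: "('o, 'm) cat"
  assumes dom_in: "f \<in> carr A \<Longrightarrow> cdom A f \<in> cobj A"
    and cod_in: "f \<in> carr A \<Longrightarrow> ccod A f \<in> cobj A"
    and id_in: "x \<in> cobj A \<Longrightarrow> cid A x \<in> chom A x x"
    and comp_in: "f \<in> chom A x y \<Longrightarrow> g \<in> chom A y z \<Longrightarrow> ccomp A g f \<in> chom A x z"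
    and id_left: "f \<in> chom A x y \<Longrightarrow> ccomp A (cid A y) f = f"
    and id_right: "f \<in> chom A x y \<Longrightarrow> ccomp A f (cid A x) = f"
    and assoc: "f \<in> chom A w x \<Longrightarrow> g \<in> chom A x y \<Longrightarrow> h \<in> chom A y z \<Longrightarrow>
      ccomp A h (ccomp A g f) = ccomp A (ccomp A h g) f"

definition ciso :: "('o, 'm) cat \<Rightarrow> 'm \<Rightarrow> bool" where
  "ciso A f \<longleftrightarrow> f \<in> carr A \<and>
    (\<exists>g \<in> chom A (ccod A f) (cdom A f).
      ccomp A g f = cid A (cdom A f) \<and> ccomp A f g = cid A (ccod A f))"

record ('o, 'm, 'p, 'n) funct =
  fo :: "'o \<Rightarrow> 'p"
  fa :: "'m \<Rightarrow> 'n"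

locale is_functor = A: category A + B: category B
  for A :: "('o, 'm) cat" and B :: "('p, 'n) cat" +
  fixes F :: "('o, 'm, 'p, 'n) funct"
  assumes obj: "x \<in> cobj A \<Longrightarrow> fo F x \<in> cobj B"
    and arr: "f \<in> chom A x y \<Longrightarrow> fa F f \<in> chom B (fo F x) (fo F y)"
    and id: "x \<in> cobj A \<Longrightarrow> fa F (cid A x) = cid B (fo F x)"
    and comp: "f \<in> chom A x y \<Longrightarrow> g \<in> chom A y z \<Longrightarrow>
      fa F (ccomp A g f) = ccomp B (fa F g) (fa F f)"

definition id_funct :: "('o, 'm, 'o, 'm) funct" where
  "id_funct = \<lparr>fo = (\<lambda>x. x), fa = (\<lambda>f. f)\<rparr>"

definition comp_funct ::
    "('p, 'n, 'q, 'l) funct \<Rightarrow> ('o, 'm, 'p, 'n) funct \<Rightarrow> ('o, 'm, 'q, 'l) funct" where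
  "comp_funct G F = \<lparr>fo = fo G \<circ> fo F, fa = fa G \<circ> fa F\<rparr>"

definition natural_iso :: "('o, 'm) cat \<Rightarrow> ('p, 'n) cat \<Rightarrow>
    ('o, 'm, 'p, 'n) funct \<Rightarrow> ('o, 'm, 'p, 'n) funct \<Rightarrow> ('o \<Rightarrow> 'n) \<Rightarrow> bool" where
  "natural_iso A B F G \<eta> \<longleftrightarrow>
    (\<forall>x \<in> cobj A. \<eta> x \<in> chom B (fo F x) (fo G x) \<and> ciso B (\<eta> x)) \<and>
    (\<forall>x y. \<forall>f \<in> chom A x y. ccomp B (fa G f) (\<eta> x) = ccomp B (\<eta> y) (fa F f))"

definition equivalence :: "('o, 'm) cat \<Rightarrow> ('p, 'n) cat \<Rightarrow> ('o, 'm, 'p, 'n) funct \<Rightarrow> bool" where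
  "equivalence A B F \<longleftrightarrow> is_functor A B F \<and>
    (\<exists>G \<eta> \<epsilon>. is_functor B A G \<and>
      natural_iso A A id_funct (comp_funct G F) \<eta> \<and>
      natural_iso B B (comp_funct F G) id_funct \<epsilon>)"

section \<open>Strict 2-categories and 2-functors\<close>

record ('o, 'a, 'c) twocat =
  Obj :: "'o set"
  Arr :: "'a set"
  Cell :: "'c set"
  src1 :: "'a \<Rightarrow> 'o"
  tgt1 :: "'a \<Rightarrow> 'o"
  src2 :: "'c \<Rightarrow> 'a"
  tgt2 :: "'c \<Rightarrow> 'a"
  id1 :: "'o \<Rightarrow> 'a"
  comp1 :: "'a \<Rightarrow> 'a \<Rightarrow> 'a"  (infixr \<open>\<odot>\<index>\<close> 75)
  id2 :: "'a \<Rightarrow> 'c"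
  vcomp :: "'c \<Rightarrow> 'c \<Rightarrow> 'c"  (infixr \<open>\<bullet>\<index>\<close> 65)
  hcomp :: "'c \<Rightarrow> 'c \<Rightarrow> 'c"  (infixr \<open>\<star>\<index>\<close> 75)

definition hom1 :: "('o, 'a, 'c) twocat \<Rightarrow> 'o \<Rightarrow> 'o \<Rightarrow> 'a set" where
  "hom1 C A B = {f \<in> Arr C. src1 C f = A \<and> tgt1 C f = B}"

definition hom2 :: "('o, 'a, 'c) twocat \<Rightarrow> 'a \<Rightarrow> 'a \<Rightarrow> 'c set" where
  "hom2 C f g = {\<alpha> \<in> Cell C. src2 C \<alpha> = f \<and> tgt2 C \<alpha> = g}"

definition lwhisk :: "('o, 'a, 'c) twocat \<Rightarrow> 'a \<Rightarrow> 'c \<Rightarrow> 'c"  (infixr \<open>\<lhd>\<index>\<close> 72) where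
  "f \<lhd>\<^bsub>C\<^esub> \<alpha> = id2 C f \<star>\<^bsub>C\<^esub> \<alpha>"

definition rwhisk :: "('o, 'a, 'c) twocat \<Rightarrow> 'c \<Rightarrow> 'a \<Rightarrow> 'c"  (infixl \<open>\<rhd>\<index>\<close> 72) where
  "\<alpha> \<rhd>\<^bsub>C\<^esub> f = \<alpha> \<star>\<^bsub>C\<^esub> id2 C f"

definition invertible2 :: "('o, 'a, 'c) twocat \<Rightarrow> 'c \<Rightarrow> bool" where
  "invertible2 C \<alpha> \<longleftrightarrow> \<alpha> \<in> Cell C \<and>
    (\<exists>\<beta> \<in> hom2 C (tgt2 C \<alpha>) (src2 C \<alpha>).
      \<beta> \<bullet>\<^bsub>C\<^esub> \<alpha> = id2 C (src2 C \<alpha>) \<and> \<alpha> \<bullet>\<^bsub>C\<^esub> \<beta> = id2 C (tgt2 C \<alpha>))"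

locale two_category =
  fixes C :: "('o, 'a, 'c) twocat" (structure)
  assumes src1_in: "f \<in> Arr C \<Longrightarrow> src1 C f \<in> Obj C"
    and tgt1_in: "f \<in> Arr C \<Longrightarrow> tgt1 C f \<in> Obj C"
    and src2_in: "\<alpha> \<in> Cell C \<Longrightarrow> src2 C \<alpha> \<in> Arr C"
    and tgt2_in: "\<alpha> \<in> Cell C \<Longrightarrow> tgt2 C \<alpha> \<in> Arr C"
    and parallel_src: "\<alpha> \<in> Cell C \<Longrightarrow> src1 C (src2 C \<alpha>) = src1 C (tgt2 C \<alpha>)"
    and parallel_tgt: "\<alpha> \<in> Cell C \<Longrightarrow> tgt1 C (src2 C \<alpha>) = tgt1 C (tgt2 C \<alpha>)"
    and id1_in: "x \<in> Obj C \<Longrightarrow> id1 C x \<in> hom1 C x x"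
    and comp1_in: "f \<in> hom1 C x y \<Longrightarrow> g \<in> hom1 C y z \<Longrightarrow> g \<odot> f \<in> hom1 C x z"
    and id1_left: "f \<in> hom1 C x y \<Longrightarrow> id1 C y \<odot> f = f"
    and id1_right: "f \<in> hom1 C x y \<Longrightarrow> f \<odot> id1 C x = f"
    and comp1_assoc: "f \<in> hom1 C w x \<Longrightarrow> g \<in> hom1 C x y \<Longrightarrow> h \<in> hom1 C y z \<Longrightarrow>
      h \<odot> (g \<odot> f) = (h \<odot> g) \<odot> f"
    and id2_in: "f \<in> Arr C \<Longrightarrow> id2 C f \<in> hom2 C f f"
    and vcomp_in: "\<alpha> \<in> hom2 C f g \<Longrightarrow> \<beta> \<in> hom2 C g h \<Longrightarrow> \<beta> \<bullet> \<alpha> \<in> hom2 C f h"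
    and id2_left: "\<alpha> \<in> hom2 C f g \<Longrightarrow> id2 C g \<bullet> \<alpha> = \<alpha>"
    and id2_right: "\<alpha> \<in> hom2 C f g \<Longrightarrow> \<alpha> \<bullet> id2 C f = \<alpha>"
    and vcomp_assoc: "\<alpha> \<in> hom2 C f g \<Longrightarrow> \<beta> \<in> hom2 C g h \<Longrightarrow> \<gamma> \<in> hom2 C h k \<Longrightarrow>
      \<gamma> \<bullet> (\<beta> \<bullet> \<alpha>) = (\<gamma> \<bullet> \<beta>) \<bullet> \<alpha>"
    and hcomp_in: "f \<in> hom1 C x y \<Longrightarrow> g \<in> hom1 C y z \<Longrightarrow> \<alpha> \<in> hom2 C f f' \<Longrightarrow>
      \<beta> \<in> hom2 C g g' \<Longrightarrow> \<beta> \<star> \<alpha> \<in> hom2 C (g \<odot> f) (g' \<odot> f')"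
    and hcomp_id_left: "f \<in> hom1 C x y \<Longrightarrow> \<alpha> \<in> hom2 C f g \<Longrightarrow> id2 C (id1 C y) \<star> \<alpha> = \<alpha>"
    and hcomp_id_right: "f \<in> hom1 C x y \<Longrightarrow> \<alpha> \<in> hom2 C f g \<Longrightarrow> \<alpha> \<star> id2 C (id1 C x) = \<alpha>"
    and hcomp_assoc: "f \<in> hom1 C w x \<Longrightarrow> g \<in> hom1 C x y \<Longrightarrow> h \<in> hom1 C y z \<Longrightarrow>
      \<alpha> \<in> hom2 C f f' \<Longrightarrow> \<beta> \<in> hom2 C g g' \<Longrightarrow> \<gamma> \<in> hom2 C h h' \<Longrightarrow>
      \<gamma> \<star> (\<beta> \<star> \<alpha>) = (\<gamma> \<star> \<beta>) \<star> \<alpha>"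
    and hcomp_id2: "f \<in> hom1 C x y \<Longrightarrow> g \<in> hom1 C y z \<Longrightarrow> id2 C g \<star> id2 C f = id2 C (g \<odot> f)"
    and interchange: "f \<in> hom1 C x y \<Longrightarrow> k \<in> hom1 C y z \<Longrightarrow>
      \<alpha> \<in> hom2 C f g \<Longrightarrow> \<beta> \<in> hom2 C g h \<Longrightarrow> \<gamma> \<in> hom2 C k l \<Longrightarrow> \<delta> \<in> hom2 C l m \<Longrightarrow>
      (\<delta> \<bullet> \<gamma>) \<star> (\<beta> \<bullet> \<alpha>) = (\<delta> \<star> \<beta>) \<bullet> (\<gamma> \<star> \<alpha>)"

definition Hom :: "('o, 'a, 'c) twocat \<Rightarrow> 'o \<Rightarrow> 'o \<Rightarrow> ('a, 'c) cat" where
  "Hom C A B = \<lparr>cobj = hom1 C A B, carr = {\<alpha> \<in> Cell C. src2 C \<alpha> \<in> hom1 C A B},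
    cdom = src2 C, ccod = tgt2 C, cid = id2 C, ccomp = vcomp C\<rparr>"

record ('i, 'j, 'k, 'o, 'a, 'c) twofun =
  F0 :: "'i \<Rightarrow> 'o"
  F1 :: "'j \<Rightarrow> 'a"
  F2 :: "'k \<Rightarrow> 'c"

locale two_functor = J: two_category J + C: two_category C
  for J :: "('i, 'j, 'k) twocat" and C :: "('o, 'a, 'c) twocat" +
  fixes D :: "('i, 'j, 'k, 'o, 'a, 'c) twofun"
  assumes F0_in: "x \<in> Obj J \<Longrightarrow> F0 D x \<in> Obj C"
    and F1_in: "f \<in> hom1 J x y \<Longrightarrow> F1 D f \<in> hom1 C (F0 D x) (F0 D y)"
    and F2_in: "\<alpha> \<in> hom2 J f g \<Longrightarrow> F2 D \<alpha> \<in> hom2 C (F1 D f) (F1 D g)"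
    and F1_id: "x \<in> Obj J \<Longrightarrow> F1 D (id1 J x) = id1 C (F0 D x)"
    and F1_comp: "f \<in> hom1 J x y \<Longrightarrow> g \<in> hom1 J y z \<Longrightarrow>
      F1 D (g \<odot>\<^bsub>J\<^esub> f) = F1 D g \<odot>\<^bsub>C\<^esub> F1 D f"
    and F2_id: "f \<in> Arr J \<Longrightarrow> F2 D (id2 J f) = id2 C (F1 D f)"
    and F2_vcomp: "\<alpha> \<in> hom2 J f g \<Longrightarrow> \<beta> \<in> hom2 J g h \<Longrightarrow>
      F2 D (\<beta> \<bullet>\<^bsub>J\<^esub> \<alpha>) = F2 D \<beta> \<bullet>\<^bsub>C\<^esub> F2 D \<alpha>"
    and F2_hcomp: "f \<in> hom1 J x y \<Longrightarrow> g \<in> hom1 J y z \<Longrightarrow>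
      \<alpha> \<in> hom2 J f f' \<Longrightarrow> \<beta> \<in> hom2 J g g' \<Longrightarrow>
      F2 D (\<beta> \<star>\<^bsub>J\<^esub> \<alpha>) = F2 D \<beta> \<star>\<^bsub>C\<^esub> F2 D \<alpha>"

definition comp_twofun :: "('p, 'q, 'r, 'o, 'a, 'c) twofun \<Rightarrow> ('i, 'j, 'k, 'p, 'q, 'r) twofun \<Rightarrow>
    ('i, 'j, 'k, 'o, 'a, 'c) twofun"  (infixl \<open>\<circ>\<^sub>2\<close> 55) where
  "G \<circ>\<^sub>2 D = \<lparr>F0 = F0 G \<circ> F0 D, F1 = F1 G \<circ> F1 D, F2 = F2 G \<circ> F2 D\<rparr>"

section \<open>Oplax cocones and oplax bicolimits\<close>

text \<open>Legs, transitions and components of modifications are required to be extensional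
  (\<^const>\<open>undefined\<close> outside the cells of the indexing 2-category), so that equality of HOL
  functions is equality of cocones and of modifications.\<close>

record ('i, 'j, 'a, 'c) cocone =
  leg :: "'i \<Rightarrow> 'a"
  trans :: "'j \<Rightarrow> 'c"

definition oplax_cocone :: "('i, 'j, 'k) twocat \<Rightarrow> ('o, 'a, 'c) twocat \<Rightarrow>
    ('i, 'j, 'k, 'o, 'a, 'c) twofun \<Rightarrow> 'o \<Rightarrow> ('i, 'j, 'a, 'c) cocone \<Rightarrow> bool" where
  "oplax_cocone J C D B q \<longleftrightarrow>
    leg q \<in> extensional (Obj J) \<and> trans q \<in> extensional (Arr J) \<and>
    (\<forall>x \<in> Obj J. leg q x \<in> hom1 C (F0 D x) B) \<and>
    (\<forall>x y. \<forall>d \<in> hom1 J x y. trans q d \<in> hom2 C (leg q y \<odot>\<^bsub>C\<^esub> F1 D d) (leg q x)) \<and>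
    (\<forall>x \<in> Obj J. trans q (id1 J x) = id2 C (leg q x)) \<and>
    (\<forall>x y z. \<forall>d \<in> hom1 J x y. \<forall>e \<in> hom1 J y z.
      trans q (e \<odot>\<^bsub>J\<^esub> d) = trans q d \<bullet>\<^bsub>C\<^esub> (trans q e \<rhd>\<^bsub>C\<^esub> F1 D d)) \<and>
    (\<forall>x y. \<forall>d \<in> hom1 J x y. \<forall>d'. \<forall>\<sigma> \<in> hom2 J d d'.
      trans q d' \<bullet>\<^bsub>C\<^esub> (leg q y \<lhd>\<^bsub>C\<^esub> F2 D \<sigma>) = trans q d)"

datatype ('i, 'j, 'a, 'c) modif =
  Modif (mod_src: "('i, 'j, 'a, 'c) cocone") (mod_tgt: "('i, 'j, 'a, 'c) cocone")
    (mod_comp: "'i \<Rightarrow> 'c")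

definition modifications :: "('i, 'j, 'k) twocat \<Rightarrow> ('o, 'a, 'c) twocat \<Rightarrow>
    ('i, 'j, 'k, 'o, 'a, 'c) twofun \<Rightarrow> 'o \<Rightarrow> ('i, 'j, 'a, 'c) modif set" where
  "modifications J C D B = {Modif k k' m | k k' m.
    oplax_cocone J C D B k \<and> oplax_cocone J C D B k' \<and> m \<in> extensional (Obj J) \<and>
    (\<forall>x \<in> Obj J. m x \<in> hom2 C (leg k x) (leg k' x)) \<and>
    (\<forall>x y. \<forall>d \<in> hom1 J x y.
      m x \<bullet>\<^bsub>C\<^esub> trans k d = trans k' d \<bullet>\<^bsub>C\<^esub> (m y \<rhd>\<^bsub>C\<^esub> F1 D d))}"

definition Cocones :: "('i, 'j, 'k) twocat \<Rightarrow> ('o, 'a, 'c) twocat \<Rightarrow>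
    ('i, 'j, 'k, 'o, 'a, 'c) twofun \<Rightarrow> 'o \<Rightarrow>
    (('i, 'j, 'a, 'c) cocone, ('i, 'j, 'a, 'c) modif) cat" where
  "Cocones J C D B = \<lparr>cobj = {q. oplax_cocone J C D B q}, carr = modifications J C D B,
    cdom = mod_src, ccod = mod_tgt,
    cid = (\<lambda>q. Modif q q (\<lambda>x\<in>Obj J. id2 C (leg q x))),
    ccomp = (\<lambda>n m. Modif (mod_src m) (mod_tgt n)
      (\<lambda>x\<in>Obj J. mod_comp n x \<bullet>\<^bsub>C\<^esub> mod_comp m x))\<rparr>"

definition postcomp :: "('i, 'j, 'k) twocat \<Rightarrow> ('o, 'a, 'c) twocat \<Rightarrow>
    ('i, 'j, 'a, 'c) cocone \<Rightarrow> 'a \<Rightarrow> ('i, 'j, 'a, 'c) cocone" where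
  "postcomp J C q h = \<lparr>leg = (\<lambda>x\<in>Obj J. h \<odot>\<^bsub>C\<^esub> leg q x),
    trans = (\<lambda>d\<in>Arr J. h \<lhd>\<^bsub>C\<^esub> trans q d)\<rparr>"

definition postcomp_funct :: "('i, 'j, 'k) twocat \<Rightarrow> ('o, 'a, 'c) twocat \<Rightarrow>
    ('i, 'j, 'a, 'c) cocone \<Rightarrow>
    ('a, 'c, ('i, 'j, 'a, 'c) cocone, ('i, 'j, 'a, 'c) modif) funct" where
  "postcomp_funct J C q = \<lparr>fo = postcomp J C q,
    fa = (\<lambda>\<alpha>. Modif (postcomp J C q (src2 C \<alpha>)) (postcomp J C q (tgt2 C \<alpha>))
      (\<lambda>x\<in>Obj J. \<alpha> \<rhd>\<^bsub>C\<^esub> leg q x))\<rparr>"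

text \<open>Naturality in the tip \<open>B\<close> is automatic, since these functors are given by
  composition with one fixed cocone.\<close>

definition oplax_bicolimit :: "('i, 'j, 'k) twocat \<Rightarrow> ('o, 'a, 'c) twocat \<Rightarrow>
    ('i, 'j, 'k, 'o, 'a, 'c) twofun \<Rightarrow> 'o \<Rightarrow> ('i, 'j, 'a, 'c) cocone \<Rightarrow> bool" where
  "oplax_bicolimit J C D L q \<longleftrightarrow> L \<in> Obj C \<and> oplax_cocone J C D L q \<and>
    (\<forall>B \<in> Obj C. equivalence (Hom C L B) (Cocones J C D B) (postcomp_funct J C q))"

text \<open>HOL cannot quantify over types inside a formula, so ``all small indexing 2-categories''
  becomes: all 2-categories whose cells live in the given types, for any choice of types.\<close>

definition has_oplax_bicolimits ::
    "('i \<times> 'j \<times> 'k) itself \<Rightarrow> ('o, 'a, 'c) twocat \<Rightarrow> bool" where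
  "has_oplax_bicolimits _ C \<longleftrightarrow>
    (\<forall>(J :: ('i, 'j, 'k) twocat) (D :: ('i, 'j, 'k, 'o, 'a, 'c) twofun).
      two_functor J C D \<longrightarrow> (\<exists>L q. oplax_bicolimit J C D L q))"

text \<open>\<open>h\<close> is a choice of \<open>\<langle>k\<^sub>x\<rangle>\<close>, witnessed by the invertible modification with components
  \<open>m x : h q\<^sub>x \<Rightarrow> k\<^sub>x\<close>. Since \<open>carr (Cocones J C D B)\<close> only relates cocones, this includes that
  \<open>k\<close> is an oplax cocone.\<close>

definition induced :: "('i, 'j, 'k) twocat \<Rightarrow> ('o, 'a, 'c) twocat \<Rightarrow>
    ('i, 'j, 'k, 'o, 'a, 'c) twofun \<Rightarrow> 'o \<Rightarrow> ('i, 'j, 'a, 'c) cocone \<Rightarrow>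
    'o \<Rightarrow> ('i, 'j, 'a, 'c) cocone \<Rightarrow> 'a \<Rightarrow> ('i \<Rightarrow> 'c) \<Rightarrow> bool" where
  "induced J C D L q B k h m \<longleftrightarrow> h \<in> hom1 C L B \<and>
    ciso (Cocones J C D B) (Modif (postcomp J C q h) k m)"

section \<open>Codescent objects\<close>

record ('o, 'a, 'c) codescent =
  cd_X0 :: 'o
  cd_X1 :: 'o
  cd_X2 :: 'o
  cd_p0 :: 'a
  cd_p1 :: 'a
  cd_p2 :: 'a
  cd_d0 :: 'a
  cd_d1 :: 'a
  cd_i :: 'a
  cd_n0 :: 'c
  cd_n1 :: 'c
  cd_\<theta>01 :: 'c
  cd_\<theta>02 :: 'c
  cd_\<theta>12 :: 'c

definition inv_hom2 :: "('o, 'a, 'c) twocat \<Rightarrow> 'a \<Rightarrow> 'a \<Rightarrow> 'c set" where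
  "inv_hom2 C f g = {\<alpha> \<in> hom2 C f g. invertible2 C \<alpha>}"

definition codescent_object :: "('o, 'a, 'c) twocat \<Rightarrow> ('o, 'a, 'c) codescent \<Rightarrow> bool" where
  "codescent_object C X \<longleftrightarrow>
    cd_X0 X \<in> Obj C \<and> cd_X1 X \<in> Obj C \<and> cd_X2 X \<in> Obj C \<and>
    cd_p0 X \<in> hom1 C (cd_X2 X) (cd_X1 X) \<and>
    cd_p1 X \<in> hom1 C (cd_X2 X) (cd_X1 X) \<and>
    cd_p2 X \<in> hom1 C (cd_X2 X) (cd_X1 X) \<and>
    cd_d0 X \<in> hom1 C (cd_X1 X) (cd_X0 X) \<and>
    cd_d1 X \<in> hom1 C (cd_X1 X) (cd_X0 X) \<and>
    cd_i X \<in> hom1 C (cd_X0 X) (cd_X1 X) \<and>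
    cd_n0 X \<in> inv_hom2 C (cd_d0 X \<odot>\<^bsub>C\<^esub> cd_i X) (id1 C (cd_X0 X)) \<and>
    cd_n1 X \<in> inv_hom2 C (cd_d1 X \<odot>\<^bsub>C\<^esub> cd_i X) (id1 C (cd_X0 X)) \<and>
    cd_\<theta>01 X \<in> inv_hom2 C (cd_d0 X \<odot>\<^bsub>C\<^esub> cd_p0 X) (cd_d0 X \<odot>\<^bsub>C\<^esub> cd_p1 X) \<and>
    cd_\<theta>02 X \<in> inv_hom2 C (cd_d1 X \<odot>\<^bsub>C\<^esub> cd_p0 X) (cd_d0 X \<odot>\<^bsub>C\<^esub> cd_p2 X) \<and>
    cd_\<theta>12 X \<in> inv_hom2 C (cd_d1 X \<odot>\<^bsub>C\<^esub> cd_p1 X) (cd_d1 X \<odot>\<^bsub>C\<^esub> cd_p2 X)"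

section \<open>The 2-category \<open>\<Sigma>\<^sup>2\<close> of pseudosquares\<close>

text \<open>\<open>Sq1 d d' \<phi>\<^sub>0 \<phi>\<^sub>1 \<phi>\<close> is the pseudosquare \<open>\<phi> : d' \<phi>\<^sub>0 \<Rightarrow> \<phi>\<^sub>1 d\<close> from \<open>d\<close> to \<open>d'\<close>.\<close>

datatype ('j, 'k) sq1 =
  Sq1 (sq_src: 'j) (sq_tgt: 'j) (sq_dom: 'j) (sq_cod: 'j) (sq_fill: 'k)

datatype ('j, 'k) sq2 =
  Sq2 (sqc_src: "('j, 'k) sq1") (sqc_tgt: "('j, 'k) sq1") (sqc_dom: 'k) (sqc_cod: 'k)

definition sq_arrs :: "('i, 'j, 'k) twocat \<Rightarrow> 'j set \<Rightarrow> ('j, 'k) sq1 set" where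
  "sq_arrs I \<Sigma> = {Sq1 d d' f0 f1 \<phi> | d d' f0 f1 \<phi>. d \<in> \<Sigma> \<and> d' \<in> \<Sigma> \<and>
    f0 \<in> hom1 I (src1 I d) (src1 I d') \<and> f1 \<in> hom1 I (tgt1 I d) (tgt1 I d') \<and>
    \<phi> \<in> inv_hom2 I (d' \<odot>\<^bsub>I\<^esub> f0) (f1 \<odot>\<^bsub>I\<^esub> d)}"

definition sq_cells :: "('i, 'j, 'k) twocat \<Rightarrow> 'j set \<Rightarrow> ('j, 'k) sq2 set" where
  "sq_cells I \<Sigma> = {Sq2 u v l0 l1 | u v l0 l1. u \<in> sq_arrs I \<Sigma> \<and> v \<in> sq_arrs I \<Sigma> \<and>
    sq_src u = sq_src v \<and> sq_tgt u = sq_tgt v \<and>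
    l0 \<in> hom2 I (sq_dom u) (sq_dom v) \<and> l1 \<in> hom2 I (sq_cod u) (sq_cod v) \<and>
    (l1 \<rhd>\<^bsub>I\<^esub> sq_src u) \<bullet>\<^bsub>I\<^esub> sq_fill u = sq_fill v \<bullet>\<^bsub>I\<^esub> (sq_tgt u \<lhd>\<^bsub>I\<^esub> l0)}"

definition sq_id :: "('i, 'j, 'k) twocat \<Rightarrow> 'j \<Rightarrow> ('j, 'k) sq1" where
  "sq_id I d = Sq1 d d (id1 I (src1 I d)) (id1 I (tgt1 I d)) (id2 I d)"

definition sq_comp :: "('i, 'j, 'k) twocat \<Rightarrow> ('j, 'k) sq1 \<Rightarrow> ('j, 'k) sq1 \<Rightarrow> ('j, 'k) sq1" where
  "sq_comp I v u = Sq1 (sq_src u) (sq_tgt v)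
    (sq_dom v \<odot>\<^bsub>I\<^esub> sq_dom u) (sq_cod v \<odot>\<^bsub>I\<^esub> sq_cod u)
    ((sq_cod v \<lhd>\<^bsub>I\<^esub> sq_fill u) \<bullet>\<^bsub>I\<^esub> (sq_fill v \<rhd>\<^bsub>I\<^esub> sq_dom u))"

definition Sigma2 :: "('i, 'j, 'k) twocat \<Rightarrow> 'j set \<Rightarrow> ('j, ('j, 'k) sq1, ('j, 'k) sq2) twocat" where
  "Sigma2 I \<Sigma> = \<lparr>Obj = \<Sigma>, Arr = sq_arrs I \<Sigma>, Cell = sq_cells I \<Sigma>,
    src1 = sq_src, tgt1 = sq_tgt, src2 = sqc_src, tgt2 = sqc_tgt,
    id1 = sq_id I, comp1 = sq_comp I,
    id2 = (\<lambda>u. Sq2 u u (id2 I (sq_dom u)) (id2 I (sq_cod u))),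
    vcomp = (\<lambda>m l. Sq2 (sqc_src l) (sqc_tgt m)
      (sqc_dom m \<bullet>\<^bsub>I\<^esub> sqc_dom l) (sqc_cod m \<bullet>\<^bsub>I\<^esub> sqc_cod l)),
    hcomp = (\<lambda>m l. Sq2 (sq_comp I (sqc_src m) (sqc_src l)) (sq_comp I (sqc_tgt m) (sqc_tgt l))
      (sqc_dom m \<star>\<^bsub>I\<^esub> sqc_dom l) (sqc_cod m \<star>\<^bsub>I\<^esub> sqc_cod l))\<rparr>"

definition Dom :: "('i, 'j, 'k) twocat \<Rightarrow> ('j, ('j, 'k) sq1, ('j, 'k) sq2, 'i, 'j, 'k) twofun" where
  "Dom I = \<lparr>F0 = src1 I, F1 = sq_dom, F2 = sqc_dom\<rparr>"

section \<open>The 2-category \<open>\<Sigma>\<^sup>3\<close> of triangles\<close>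

text \<open>\<open>Tri e0 e1 e2 \<phi>\<close> is the triangle \<open>\<phi> : e2 e0 \<Rightarrow> e1\<close>, with edges \<open>p\<^sub>0\<phi> = e0\<close>,
  \<open>p\<^sub>1\<phi> = e1\<close>, \<open>p\<^sub>2\<phi> = e2\<close>.\<close>

datatype ('j, 'k) tri =
  Tri (tri_p0: 'j) (tri_p1: 'j) (tri_p2: 'j) (tri_fill: 'k)

text \<open>A pseudonatural transformation has a component at each of the three vertices and an
  invertible structure cell at each of the three edges; each edge gives a pseudosquare.\<close>

datatype ('j, 'k) tri1 =
  Tri1 (tr_src: "('j, 'k) tri") (tr_tgt: "('j, 'k) tri")
    (tr_0: 'j) (tr_1: 'j) (tr_2: 'j) (tr_fill0: 'k) (tr_fill1: 'k) (tr_fill2: 'k)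

datatype ('j, 'k) tri2 =
  Tri2 (trc_src: "('j, 'k) tri1") (trc_tgt: "('j, 'k) tri1") (trc_0: 'k) (trc_1: 'k) (trc_2: 'k)

definition tr_edge0 :: "('j, 'k) tri1 \<Rightarrow> ('j, 'k) sq1" where
  "tr_edge0 u = Sq1 (tri_p0 (tr_src u)) (tri_p0 (tr_tgt u)) (tr_0 u) (tr_1 u) (tr_fill0 u)"

definition tr_edge1 :: "('j, 'k) tri1 \<Rightarrow> ('j, 'k) sq1" where
  "tr_edge1 u = Sq1 (tri_p1 (tr_src u)) (tri_p1 (tr_tgt u)) (tr_0 u) (tr_2 u) (tr_fill1 u)"

definition tr_edge2 :: "('j, 'k) tri1 \<Rightarrow> ('j, 'k) sq1" where
  "tr_edge2 u = Sq1 (tri_p2 (tr_src u)) (tri_p2 (tr_tgt u)) (tr_1 u) (tr_2 u) (tr_fill2 u)"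

definition trc_edge0 :: "('j, 'k) tri2 \<Rightarrow> ('j, 'k) sq2" where
  "trc_edge0 l = Sq2 (tr_edge0 (trc_src l)) (tr_edge0 (trc_tgt l)) (trc_0 l) (trc_1 l)"

definition trc_edge1 :: "('j, 'k) tri2 \<Rightarrow> ('j, 'k) sq2" where
  "trc_edge1 l = Sq2 (tr_edge1 (trc_src l)) (tr_edge1 (trc_tgt l)) (trc_0 l) (trc_2 l)"

definition trc_edge2 :: "('j, 'k) tri2 \<Rightarrow> ('j, 'k) sq2" where
  "trc_edge2 l = Sq2 (tr_edge2 (trc_src l)) (tr_edge2 (trc_tgt l)) (trc_1 l) (trc_2 l)"

definition tri_objs :: "('i, 'j, 'k) twocat \<Rightarrow> 'j set \<Rightarrow> ('j, 'k) tri set" where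
  "tri_objs I \<Sigma> = {Tri e0 e1 e2 \<phi> | e0 e1 e2 \<phi>. e0 \<in> \<Sigma> \<and> e1 \<in> \<Sigma> \<and> e2 \<in> \<Sigma> \<and>
    src1 I e0 = src1 I e1 \<and> tgt1 I e0 = src1 I e2 \<and> tgt1 I e1 = tgt1 I e2 \<and>
    \<phi> \<in> inv_hom2 I (e2 \<odot>\<^bsub>I\<^esub> e0) e1}"

definition tri_arrs :: "('i, 'j, 'k) twocat \<Rightarrow> 'j set \<Rightarrow> ('j, 'k) tri1 set" where
  "tri_arrs I \<Sigma> = {u. tr_src u \<in> tri_objs I \<Sigma> \<and> tr_tgt u \<in> tri_objs I \<Sigma> \<and>
    tr_edge0 u \<in> sq_arrs I \<Sigma> \<and> tr_edge1 u \<in> sq_arrs I \<Sigma> \<and> tr_edge2 u \<in> sq_arrs I \<Sigma> \<and>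
    tr_fill1 u \<bullet>\<^bsub>I\<^esub> (tri_fill (tr_tgt u) \<rhd>\<^bsub>I\<^esub> tr_0 u) =
      (tr_2 u \<lhd>\<^bsub>I\<^esub> tri_fill (tr_src u)) \<bullet>\<^bsub>I\<^esub> (tr_fill2 u \<rhd>\<^bsub>I\<^esub> tri_p0 (tr_src u)) \<bullet>\<^bsub>I\<^esub>
      (tri_p2 (tr_tgt u) \<lhd>\<^bsub>I\<^esub> tr_fill0 u)}"

definition tri_cells :: "('i, 'j, 'k) twocat \<Rightarrow> 'j set \<Rightarrow> ('j, 'k) tri2 set" where
  "tri_cells I \<Sigma> = {l. trc_src l \<in> tri_arrs I \<Sigma> \<and> trc_tgt l \<in> tri_arrs I \<Sigma> \<and>
    tr_src (trc_src l) = tr_src (trc_tgt l) \<and> tr_tgt (trc_src l) = tr_tgt (trc_tgt l) \<and>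
    trc_edge0 l \<in> sq_cells I \<Sigma> \<and> trc_edge1 l \<in> sq_cells I \<Sigma> \<and> trc_edge2 l \<in> sq_cells I \<Sigma>}"

definition tri_id :: "('i, 'j, 'k) twocat \<Rightarrow> ('j, 'k) tri \<Rightarrow> ('j, 'k) tri1" where
  "tri_id I t = Tri1 t t (id1 I (src1 I (tri_p0 t))) (id1 I (tgt1 I (tri_p0 t)))
    (id1 I (tgt1 I (tri_p1 t))) (id2 I (tri_p0 t)) (id2 I (tri_p1 t)) (id2 I (tri_p2 t))"

definition tri_comp :: "('i, 'j, 'k) twocat \<Rightarrow> ('j, 'k) tri1 \<Rightarrow> ('j, 'k) tri1 \<Rightarrow> ('j, 'k) tri1" where
  "tri_comp I v u = Tri1 (tr_src u) (tr_tgt v)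
    (tr_0 v \<odot>\<^bsub>I\<^esub> tr_0 u) (tr_1 v \<odot>\<^bsub>I\<^esub> tr_1 u) (tr_2 v \<odot>\<^bsub>I\<^esub> tr_2 u)
    (sq_fill (sq_comp I (tr_edge0 v) (tr_edge0 u)))
    (sq_fill (sq_comp I (tr_edge1 v) (tr_edge1 u)))
    (sq_fill (sq_comp I (tr_edge2 v) (tr_edge2 u)))"

definition Sigma3 :: "('i, 'j, 'k) twocat \<Rightarrow> 'j set \<Rightarrow>
    (('j, 'k) tri, ('j, 'k) tri1, ('j, 'k) tri2) twocat" where
  "Sigma3 I \<Sigma> = \<lparr>Obj = tri_objs I \<Sigma>, Arr = tri_arrs I \<Sigma>, Cell = tri_cells I \<Sigma>,
    src1 = tr_src, tgt1 = tr_tgt, src2 = trc_src, tgt2 = trc_tgt,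
    id1 = tri_id I, comp1 = tri_comp I,
    id2 = (\<lambda>u. Tri2 u u (id2 I (tr_0 u)) (id2 I (tr_1 u)) (id2 I (tr_2 u))),
    vcomp = (\<lambda>m l. Tri2 (trc_src l) (trc_tgt m) (trc_0 m \<bullet>\<^bsub>I\<^esub> trc_0 l)
      (trc_1 m \<bullet>\<^bsub>I\<^esub> trc_1 l) (trc_2 m \<bullet>\<^bsub>I\<^esub> trc_2 l)),
    hcomp = (\<lambda>m l. Tri2 (tri_comp I (trc_src m) (trc_src l)) (tri_comp I (trc_tgt m) (trc_tgt l))
      (trc_0 m \<star>\<^bsub>I\<^esub> trc_0 l) (trc_1 m \<star>\<^bsub>I\<^esub> trc_1 l) (trc_2 m \<star>\<^bsub>I\<^esub> trc_2 l))\<rparr>"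

definition P0 :: "(('j, 'k) tri, ('j, 'k) tri1, ('j, 'k) tri2,
    'j, ('j, 'k) sq1, ('j, 'k) sq2) twofun" where
  "P0 = \<lparr>F0 = tri_p0, F1 = tr_edge0, F2 = trc_edge0\<rparr>"

definition P1 :: "(('j, 'k) tri, ('j, 'k) tri1, ('j, 'k) tri2,
    'j, ('j, 'k) sq1, ('j, 'k) sq2) twofun" where
  "P1 = \<lparr>F0 = tri_p1, F1 = tr_edge1, F2 = trc_edge1\<rparr>"

section \<open>The inducing cocones\<close>

definition restrict_cocone :: "('i, 'j, 'k) twocat \<Rightarrow> ('i, 'j, 'k, 'p, 'q, 'r) twofun \<Rightarrow>
    ('p, 'q, 'a, 'c) cocone \<Rightarrow> ('i, 'j, 'a, 'c) cocone" where
  "restrict_cocone J G q = \<lparr>leg = (\<lambda>x\<in>Obj J. leg q (F0 G x)),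
    trans = (\<lambda>u\<in>Arr J. trans q (F1 G u))\<rparr>"

definition dom_cocone :: "('i, 'j, 'k) twocat \<Rightarrow> 'j set \<Rightarrow>
    ('i, 'j, 'a, 'c) cocone \<Rightarrow> ('j, ('j, 'k) sq1, 'a, 'c) cocone" where
  "dom_cocone I \<Sigma> q = restrict_cocone (Sigma2 I \<Sigma>) (Dom I) q"

definition cod_cocone :: "('o, 'a, 'c) twocat \<Rightarrow> ('i, 'j, 'k) twocat \<Rightarrow> 'j set \<Rightarrow>
    ('i, 'j, 'k, 'o, 'a, 'c) twofun \<Rightarrow>
    ('i, 'j, 'a, 'c) cocone \<Rightarrow> ('j, ('j, 'k) sq1, 'a, 'c) cocone" where
  "cod_cocone C I \<Sigma> F q = \<lparr>
    leg = (\<lambda>d\<in>Obj (Sigma2 I \<Sigma>). leg q (tgt1 I d) \<odot>\<^bsub>C\<^esub> F1 F d),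
    trans = (\<lambda>u\<in>Arr (Sigma2 I \<Sigma>).
      (trans q (sq_cod u) \<rhd>\<^bsub>C\<^esub> F1 F (sq_src u)) \<bullet>\<^bsub>C\<^esub>
      (leg q (tgt1 I (sq_tgt u)) \<lhd>\<^bsub>C\<^esub> F2 F (sq_fill u)))\<rparr>"

definition id_cocone :: "('i, 'j, 'k) twocat \<Rightarrow>
    ('j, ('j, 'k) sq1, 'a, 'c) cocone \<Rightarrow> ('i, 'j, 'a, 'c) cocone" where
  "id_cocone I r = \<lparr>leg = (\<lambda>x\<in>Obj I. leg r (id1 I x)),
    trans = (\<lambda>d\<in>Arr I. trans r (Sq1 (id1 I (src1 I d)) (id1 I (tgt1 I d)) d d (id2 I d)))\<rparr>"

definition p0_cocone :: "('i, 'j, 'k) twocat \<Rightarrow> 'j set \<Rightarrow>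
    ('j, ('j, 'k) sq1, 'a, 'c) cocone \<Rightarrow> (('j, 'k) tri, ('j, 'k) tri1, 'a, 'c) cocone" where
  "p0_cocone I \<Sigma> r = restrict_cocone (Sigma3 I \<Sigma>) P0 r"

definition p1_cocone :: "('i, 'j, 'k) twocat \<Rightarrow> 'j set \<Rightarrow>
    ('j, ('j, 'k) sq1, 'a, 'c) cocone \<Rightarrow> (('j, 'k) tri, ('j, 'k) tri1, 'a, 'c) cocone" where
  "p1_cocone I \<Sigma> r = restrict_cocone (Sigma3 I \<Sigma>) P1 r"

definition p2_cocone :: "('o, 'a, 'c) twocat \<Rightarrow> ('i, 'j, 'k) twocat \<Rightarrow> 'j set \<Rightarrow>
    ('i, 'j, 'k, 'o, 'a, 'c) twofun \<Rightarrow>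
    ('j, ('j, 'k) sq1, 'a, 'c) cocone \<Rightarrow> (('j, 'k) tri, ('j, 'k) tri1, 'a, 'c) cocone" where
  "p2_cocone C I \<Sigma> F r = \<lparr>
    leg = (\<lambda>t\<in>Obj (Sigma3 I \<Sigma>). leg r (tri_p2 t) \<odot>\<^bsub>C\<^esub> F1 F (tri_p0 t)),
    trans = (\<lambda>u\<in>Arr (Sigma3 I \<Sigma>).
      (trans r (tr_edge2 u) \<rhd>\<^bsub>C\<^esub> F1 F (tri_p0 (tr_src u))) \<bullet>\<^bsub>C\<^esub>
      (leg r (tri_p2 (tr_tgt u)) \<lhd>\<^bsub>C\<^esub> F2 F (tr_fill0 u)))\<rparr>"

end

theory Submission
  imports Defs
begin

text \<open>An oplax bicolimit \<open>L\<close> sees 2-cells: since \<open>\<C>[L, B]\<close> is equivalent to the category of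
  oplax cocones, an invertible modification between \<open>h q\<close> and \<open>k q\<close> is whiskered from a unique
  invertible 2-cell \<open>h \<cong> k\<close>. Each of the five 2-cells therefore amounts to identifying, up to
  invertible modification, the two oplax cocones that the two composite 1-cells induce. The inducing
  cocones arise from \<open>q\<close> and \<open>r\<close> by restriction along 2-functors
  (\<open>dom\<close>, \<open>cod\<close>, \<open>p\<^sub>0\<close>, \<open>p\<^sub>1\<close>, \<open>p\<^sub>2\<close>, \<open>i \<mapsto> id\<^sub>i\<close>) and by whiskering with the oplax transformation
  \<open>F dom \<Rightarrow> F cod\<close> with components \<open>F(d)\<close>; both operations commute with postcomposition, so the two
  cocones turn out to be equal, except for \<open>d\<^sub>1p\<^sub>1 \<cong> d\<^sub>1p\<^sub>2\<close>, where they differ by the invertible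
  modification \<open>q F(\<phi>)\<close>.\<close>

section \<open>Calculus of whiskered cells\<close>

text \<open>The induced 1-cells are fixed only up to isomorphism, so a comparison 2-cell is
  meaningful only relative to the chosen witnesses \<delta>, \<pi>, \<iota>. Each one is therefore
  constructed together with an equation that pins down its whiskering with the bicolimit legs: both
  composites are compared with one common cocone, and the equation says that the two comparisons
  agree through the new cell. Stated in this way, it names no inverses. The coincidences of cocones
  rest on strictness: F preserves identities and composites on the nose, and cod p_0 = dom p_2 and
  its companions are equalities. They hold only on the cells of the index, while HOL functions are
  total; this accounts for the congruence lemmas, which exchange one diagram for another that agrees
  with it on the index. The category of cocones is used only where an equivalence is applied.
  Elsewhere an invertible modification is handled as a family of invertible 2-cells.\<close>

context two_category
begin

lemma hom1_iff: "f \<in> hom1 C x y \<longleftrightarrow> f \<in> Arr C \<and> src1 C f = x \<and> tgt1 C f = y"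
  by (auto simp: hom1_def)

lemma hom2_iff: "\<alpha> \<in> hom2 C f g \<longleftrightarrow> \<alpha> \<in> Cell C \<and> src2 C \<alpha> = f \<and> tgt2 C \<alpha> = g"
  by (auto simp: hom2_def)

lemma id1_typing:
  assumes "x \<in> Obj C"
  shows "id1 C x \<in> Arr C" "src1 C (id1 C x) = x" "tgt1 C (id1 C x) = x"
  using id1_in[OF assms] by (auto simp: hom1_iff)

lemma comp1_typing:
  assumes "g \<in> Arr C" "f \<in> Arr C" "src1 C g = tgt1 C f"
  shows "g \<odot> f \<in> Arr C" "src1 C (g \<odot> f) = src1 C f" "tgt1 C (g \<odot> f) = tgt1 C g"
  using comp1_in[of f "src1 C f" "tgt1 C f" g "tgt1 C g"] assms by (auto simp: hom1_iff)

lemma comp1_unit: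
  assumes "f \<in> Arr C"
  shows "tgt1 C f = x \<Longrightarrow> id1 C x \<odot> f = f" "src1 C f = x \<Longrightarrow> f \<odot> id1 C x = f"
  using id1_left id1_right assms by (auto simp: hom1_iff)

lemma comp1_right_assoc:
  assumes "h \<in> Arr C" "g \<in> Arr C" "f \<in> Arr C" "src1 C h = tgt1 C g" "src1 C g = tgt1 C f"
  shows "(h \<odot> g) \<odot> f = h \<odot> (g \<odot> f)"
  using comp1_assoc[of f "src1 C f" "tgt1 C f" g "tgt1 C g" h "tgt1 C h"] assms
  by (auto simp: hom1_iff)

lemma id2_typing:
  assumes "f \<in> Arr C"
  shows "id2 C f \<in> Cell C" "src2 C (id2 C f) = f" "tgt2 C (id2 C f) = f"
  using id2_in[OF assms] by (auto simp: hom2_iff)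

lemma vcomp_typing:
  assumes "\<beta> \<in> Cell C" "\<alpha> \<in> Cell C" "src2 C \<beta> = tgt2 C \<alpha>"
  shows "\<beta> \<bullet> \<alpha> \<in> Cell C" "src2 C (\<beta> \<bullet> \<alpha>) = src2 C \<alpha>" "tgt2 C (\<beta> \<bullet> \<alpha>) = tgt2 C \<beta>"
  using vcomp_in[of \<alpha> "src2 C \<alpha>" "tgt2 C \<alpha>" \<beta> "tgt2 C \<beta>"] assms by (auto simp: hom2_iff)

lemma vcomp_unit:
  assumes "\<alpha> \<in> Cell C"
  shows "tgt2 C \<alpha> = f \<Longrightarrow> id2 C f \<bullet> \<alpha> = \<alpha>" "src2 C \<alpha> = f \<Longrightarrow> \<alpha> \<bullet> id2 C f = \<alpha>"
  using id2_left id2_right assms by (auto simp: hom2_iff)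

lemma vcomp_right_assoc:
  assumes "\<gamma> \<in> Cell C" "\<beta> \<in> Cell C" "\<alpha> \<in> Cell C" "src2 C \<gamma> = tgt2 C \<beta>" "src2 C \<beta> = tgt2 C \<alpha>"
  shows "(\<gamma> \<bullet> \<beta>) \<bullet> \<alpha> = \<gamma> \<bullet> (\<beta> \<bullet> \<alpha>)"
  using vcomp_assoc[of \<alpha> "src2 C \<alpha>" "tgt2 C \<alpha>" \<beta> "tgt2 C \<beta>" \<gamma> "tgt2 C \<gamma>"] assms
  by (auto simp: hom2_iff)

lemma cell_parallel:
  assumes "\<alpha> \<in> Cell C"
  shows "src2 C \<alpha> \<in> Arr C" "tgt2 C \<alpha> \<in> Arr C"
    "src1 C (tgt2 C \<alpha>) = src1 C (src2 C \<alpha>)" "tgt1 C (tgt2 C \<alpha>) = tgt1 C (src2 C \<alpha>)"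
  using assms src2_in tgt2_in parallel_src parallel_tgt by auto

lemma hcomp_typing:
  assumes "\<beta> \<in> Cell C" "\<alpha> \<in> Cell C" "src1 C (src2 C \<beta>) = tgt1 C (src2 C \<alpha>)"
  shows "\<beta> \<star> \<alpha> \<in> Cell C" "src2 C (\<beta> \<star> \<alpha>) = src2 C \<beta> \<odot> src2 C \<alpha>"
    "tgt2 C (\<beta> \<star> \<alpha>) = tgt2 C \<beta> \<odot> tgt2 C \<alpha>"
  using hcomp_in[of "src2 C \<alpha>" "src1 C (src2 C \<alpha>)" "tgt1 C (src2 C \<alpha>)" "src2 C \<beta>"
      "tgt1 C (src2 C \<beta>)" \<alpha> "tgt2 C \<alpha>" \<beta> "tgt2 C \<beta>"] assms cell_parallel
  by (auto simp: hom1_iff hom2_iff)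

lemma whisker_typing:
  assumes "f \<in> Arr C" "\<alpha> \<in> Cell C"
  shows "src1 C f = tgt1 C (src2 C \<alpha>) \<Longrightarrow> f \<lhd> \<alpha> \<in> Cell C"
    "src1 C f = tgt1 C (src2 C \<alpha>) \<Longrightarrow> src2 C (f \<lhd> \<alpha>) = f \<odot> src2 C \<alpha>"
    "src1 C f = tgt1 C (src2 C \<alpha>) \<Longrightarrow> tgt2 C (f \<lhd> \<alpha>) = f \<odot> tgt2 C \<alpha>"
    "src1 C (src2 C \<alpha>) = tgt1 C f \<Longrightarrow> \<alpha> \<rhd> f \<in> Cell C"
    "src1 C (src2 C \<alpha>) = tgt1 C f \<Longrightarrow> src2 C (\<alpha> \<rhd> f) = src2 C \<alpha> \<odot> f"
    "src1 C (src2 C \<alpha>) = tgt1 C f \<Longrightarrow> tgt2 C (\<alpha> \<rhd> f) = tgt2 C \<alpha> \<odot> f"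
  using assms by (auto simp: lwhisk_def rwhisk_def hcomp_typing id2_typing)

text \<open>Sources and targets as conditional equations, from which the simplifier discharges the
  composability premises of the later rules.\<close>

lemmas typing = id1_typing comp1_typing id2_typing vcomp_typing hcomp_typing whisker_typing
  cell_parallel src1_in tgt1_in

lemma hcomp_unit:
  assumes "\<alpha> \<in> Cell C"
  shows "tgt1 C (src2 C \<alpha>) = x \<Longrightarrow> id2 C (id1 C x) \<star> \<alpha> = \<alpha>"
    "src1 C (src2 C \<alpha>) = x \<Longrightarrow> \<alpha> \<star> id2 C (id1 C x) = \<alpha>"
  using assms hcomp_id_left[of "src2 C \<alpha>" _ _ \<alpha> "tgt2 C \<alpha>"] hcomp_id_right[of "src2 C \<alpha>" _ _ \<alpha> "tgt2 C \<alpha>"]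
  by (auto simp: hom1_iff hom2_iff cell_parallel)

lemma hcomp_right_assoc:
  assumes "\<gamma> \<in> Cell C" "\<beta> \<in> Cell C" "\<alpha> \<in> Cell C"
    "src1 C (src2 C \<gamma>) = tgt1 C (src2 C \<beta>)" "src1 C (src2 C \<beta>) = tgt1 C (src2 C \<alpha>)"
  shows "(\<gamma> \<star> \<beta>) \<star> \<alpha> = \<gamma> \<star> (\<beta> \<star> \<alpha>)"
  using hcomp_assoc[of "src2 C \<alpha>" "src1 C (src2 C \<alpha>)" "tgt1 C (src2 C \<alpha>)" "src2 C \<beta>"
      "tgt1 C (src2 C \<beta>)" "src2 C \<gamma>" "tgt1 C (src2 C \<gamma>)" \<alpha> "tgt2 C \<alpha>" \<beta> "tgt2 C \<beta>" \<gamma> "tgt2 C \<gamma>"]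
    assms by (auto simp: hom1_iff hom2_iff cell_parallel)

lemma middle_four:
  assumes "\<alpha> \<in> Cell C" "\<beta> \<in> Cell C" "\<gamma> \<in> Cell C" "\<delta> \<in> Cell C"
    "src2 C \<beta> = tgt2 C \<alpha>" "src2 C \<delta> = tgt2 C \<gamma>" "src1 C (src2 C \<gamma>) = tgt1 C (src2 C \<alpha>)"
  shows "(\<delta> \<bullet> \<gamma>) \<star> (\<beta> \<bullet> \<alpha>) = (\<delta> \<star> \<beta>) \<bullet> (\<gamma> \<star> \<alpha>)"
  using interchange[of "src2 C \<alpha>" "src1 C (src2 C \<alpha>)" "tgt1 C (src2 C \<alpha>)" "src2 C \<gamma>"
      "tgt1 C (src2 C \<gamma>)" \<alpha> "tgt2 C \<alpha>" \<beta> "tgt2 C \<beta>" \<gamma> "tgt2 C \<gamma>" \<delta> "tgt2 C \<delta>"]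
    assms by (auto simp: hom1_iff hom2_iff cell_parallel)

lemma hcomp_id2':
  assumes "g \<in> Arr C" "f \<in> Arr C" "src1 C g = tgt1 C f"
  shows "id2 C g \<star> id2 C f = id2 C (g \<odot> f)"
  using hcomp_id2[of f "src1 C f" "tgt1 C f" g "tgt1 C g"] assms by (auto simp: hom1_iff)

lemma whisker_vcomp:
  assumes "f \<in> Arr C" "\<alpha> \<in> Cell C" "\<beta> \<in> Cell C" "src2 C \<beta> = tgt2 C \<alpha>"
  shows "src1 C f = tgt1 C (src2 C \<alpha>) \<Longrightarrow> f \<lhd> (\<beta> \<bullet> \<alpha>) = (f \<lhd> \<beta>) \<bullet> (f \<lhd> \<alpha>)"
    "src1 C (src2 C \<alpha>) = tgt1 C f \<Longrightarrow> (\<beta> \<bullet> \<alpha>) \<rhd> f = (\<beta> \<rhd> f) \<bullet> (\<alpha> \<rhd> f)"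
  using assms middle_four[of \<alpha> \<beta> "id2 C f" "id2 C f"] middle_four[of "id2 C f" "id2 C f" \<alpha> \<beta>]
  by (auto simp: lwhisk_def rwhisk_def typing vcomp_unit)

lemma whisker_id:
  assumes "g \<in> Arr C" "f \<in> Arr C" "src1 C g = tgt1 C f"
  shows "g \<lhd> id2 C f = id2 C (g \<odot> f)" "id2 C g \<rhd> f = id2 C (g \<odot> f)"
  using assms by (auto simp: lwhisk_def rwhisk_def hcomp_id2')

lemma whisker_unit:
  assumes "\<alpha> \<in> Cell C"
  shows "tgt1 C (src2 C \<alpha>) = x \<Longrightarrow> id1 C x \<lhd> \<alpha> = \<alpha>"
    "src1 C (src2 C \<alpha>) = x \<Longrightarrow> \<alpha> \<rhd> id1 C x = \<alpha>"
  using assms by (auto simp: lwhisk_def rwhisk_def hcomp_unit)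

lemma whisker_whisker:
  assumes "g \<in> Arr C" "f \<in> Arr C" "\<alpha> \<in> Cell C"
  shows "src1 C g = tgt1 C f \<Longrightarrow> src1 C f = tgt1 C (src2 C \<alpha>) \<Longrightarrow> g \<lhd> (f \<lhd> \<alpha>) = (g \<odot> f) \<lhd> \<alpha>"
    "src1 C g = tgt1 C f \<Longrightarrow> src1 C (src2 C \<alpha>) = tgt1 C g \<Longrightarrow> (\<alpha> \<rhd> g) \<rhd> f = \<alpha> \<rhd> (g \<odot> f)"
    "src1 C g = tgt1 C (src2 C \<alpha>) \<Longrightarrow> src1 C (src2 C \<alpha>) = tgt1 C f \<Longrightarrow>
      (g \<lhd> \<alpha>) \<rhd> f = g \<lhd> (\<alpha> \<rhd> f)"
  using assms hcomp_right_assoc[of "id2 C g" "id2 C f" \<alpha>] hcomp_right_assoc[of \<alpha> "id2 C g" "id2 C f"]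
    hcomp_right_assoc[of "id2 C g" \<alpha> "id2 C f"]
  by (auto simp: lwhisk_def rwhisk_def hcomp_id2' typing)

text \<open>Normal form: composites bracketed to the right, each factor being one cell with at most
  one whiskering 1-cell on either side. Interchange is left out, since neither direction of it
  simplifies; it is applied by hand.\<close>

lemmas calc = typing comp1_unit comp1_right_assoc vcomp_unit vcomp_right_assoc
  whisker_vcomp whisker_id whisker_unit whisker_whisker

text \<open>Interchange after padding each factor with an identity 2-cell. The two ways of padding
  give the two orders in which the whiskered cells can act.\<close>

lemma hcomp_whisker:
  assumes "\<beta> \<in> Cell C" "\<alpha> \<in> Cell C" "src1 C (src2 C \<beta>) = tgt1 C (src2 C \<alpha>)"
  shows "\<beta> \<star> \<alpha> = (\<beta> \<rhd> tgt2 C \<alpha>) \<bullet> (src2 C \<beta> \<lhd> \<alpha>)"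
    "\<beta> \<star> \<alpha> = (tgt2 C \<beta> \<lhd> \<alpha>) \<bullet> (\<beta> \<rhd> src2 C \<alpha>)"
  using middle_four[of \<alpha> "id2 C (tgt2 C \<alpha>)" "id2 C (src2 C \<beta>)" \<beta>]
    middle_four[of "id2 C (src2 C \<alpha>)" \<alpha> \<beta> "id2 C (tgt2 C \<beta>)"] assms
  by (auto simp: lwhisk_def rwhisk_def typing vcomp_unit)

text \<open>The ends are variables with equations attached, so that the law also matches where they
  appear as composites or under another name.\<close>

lemma exchange:
  assumes "\<beta> \<in> Cell C" "\<alpha> \<in> Cell C" "src1 C (src2 C \<beta>) = tgt1 C (src2 C \<alpha>)"
    "src2 C \<beta> = g" "tgt2 C \<beta> = g'" "src2 C \<alpha> = f" "tgt2 C \<alpha> = f'"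
  shows "(\<beta> \<rhd> f') \<bullet> (g \<lhd> \<alpha>) = (g' \<lhd> \<alpha>) \<bullet> (\<beta> \<rhd> f)"
  using hcomp_whisker[OF assms(1-3)] assms by simp

text \<open>In a right-associated composite, a two-factor identity only becomes applicable together
  with the cell that follows it.\<close>

lemma vcomp_subst:
  assumes "\<beta> \<bullet> \<alpha> = \<delta> \<bullet> \<gamma>" "\<alpha> \<in> Cell C" "\<beta> \<in> Cell C" "\<gamma> \<in> Cell C" "\<delta> \<in> Cell C" "\<xi> \<in> Cell C"
    "src2 C \<beta> = tgt2 C \<alpha>" "src2 C \<delta> = tgt2 C \<gamma>" "src2 C \<alpha> = tgt2 C \<xi>" "src2 C \<gamma> = tgt2 C \<xi>"
  shows "\<beta> \<bullet> \<alpha> \<bullet> \<xi> = \<delta> \<bullet> \<gamma> \<bullet> \<xi>"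
  using assms by (metis vcomp_right_assoc)

section \<open>Invertible 2-cells\<close>

lemma inv_hom2_iff:
  "\<alpha> \<in> inv_hom2 C f g \<longleftrightarrow> \<alpha> \<in> hom2 C f g \<and>
    (\<exists>\<beta> \<in> hom2 C g f. \<beta> \<bullet> \<alpha> = id2 C f \<and> \<alpha> \<bullet> \<beta> = id2 C g)"
  by (auto simp: inv_hom2_def invertible2_def hom2_iff)

lemma inv_hom2_typing:
  assumes "\<alpha> \<in> inv_hom2 C f g"
  shows "\<alpha> \<in> Cell C" "src2 C \<alpha> = f" "tgt2 C \<alpha> = g"
  using assms by (auto simp: inv_hom2_iff hom2_iff)

lemma inv_hom2_id: "f \<in> Arr C \<Longrightarrow> id2 C f \<in> inv_hom2 C f f"
  by (auto simp: inv_hom2_iff hom2_iff calc intro!: bexI[of _ "id2 C f"])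

lemma inv_hom2_vcomp:
  assumes "\<alpha> \<in> inv_hom2 C f g" "\<beta> \<in> inv_hom2 C g h"
  shows "\<beta> \<bullet> \<alpha> \<in> inv_hom2 C f h"
proof -
  obtain \<alpha>' \<beta>' where inv: "\<alpha>' \<in> hom2 C g f" "\<alpha>' \<bullet> \<alpha> = id2 C f" "\<alpha> \<bullet> \<alpha>' = id2 C g"
    "\<beta>' \<in> hom2 C h g" "\<beta>' \<bullet> \<beta> = id2 C g" "\<beta> \<bullet> \<beta>' = id2 C h"
    using assms by (auto simp: inv_hom2_iff)
  note t = inv_hom2_typing[OF assms(1)] inv_hom2_typing[OF assms(2)] inv(1,4)[unfolded hom2_iff]
  \<comment> \<open>This bracketing puts the inner cell next to its inverse; in the right-associated
    form the pair is hidden by the factor that follows it.\<close>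
  have "(\<alpha>' \<bullet> \<beta>') \<bullet> (\<beta> \<bullet> \<alpha>) = \<alpha>' \<bullet> (\<beta>' \<bullet> \<beta>) \<bullet> \<alpha>"
    "(\<beta> \<bullet> \<alpha>) \<bullet> (\<alpha>' \<bullet> \<beta>') = \<beta> \<bullet> (\<alpha> \<bullet> \<alpha>') \<bullet> \<beta>'"
    using t by (simp_all add: calc)
  with t inv show ?thesis
    by (auto simp: inv_hom2_iff hom2_iff calc intro!: bexI[of _ "\<alpha>' \<bullet> \<beta>'"])
qed

lemma inv_hom2_whisker:
  assumes "\<alpha> \<in> inv_hom2 C f g" "h \<in> Arr C"
  shows "src1 C h = tgt1 C f \<Longrightarrow> h \<lhd> \<alpha> \<in> inv_hom2 C (h \<odot> f) (h \<odot> g)"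
    "src1 C f = tgt1 C h \<Longrightarrow> \<alpha> \<rhd> h \<in> inv_hom2 C (f \<odot> h) (g \<odot> h)"
proof -
  obtain \<alpha>' where inv: "\<alpha>' \<in> hom2 C g f" "\<alpha>' \<bullet> \<alpha> = id2 C f" "\<alpha> \<bullet> \<alpha>' = id2 C g"
    using assms by (auto simp: inv_hom2_iff)
  note t = inv_hom2_typing[OF assms(1)] assms(2) inv(1)[unfolded hom2_iff]
  have p: "src1 C g = src1 C f" "tgt1 C g = tgt1 C f" "f \<in> Arr C" "g \<in> Arr C"
    using t cell_parallel[of \<alpha>] by auto
  show "h \<lhd> \<alpha> \<in> inv_hom2 C (h \<odot> f) (h \<odot> g)" if "src1 C h = tgt1 C f"
  proof -
    \<comment> \<open>Whiskers are fused here, against the direction of \<open>calc\<close>, so that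
      the inverse pair meets under a single whisker.\<close>
    have "(h \<lhd> \<alpha>') \<bullet> (h \<lhd> \<alpha>) = id2 C (h \<odot> f)" "(h \<lhd> \<alpha>) \<bullet> (h \<lhd> \<alpha>') = id2 C (h \<odot> g)"
      using t inv p that by (simp_all flip: whisker_vcomp add: whisker_id)
    then show ?thesis using t p that
      by (auto simp: inv_hom2_iff hom2_iff calc intro!: bexI[of _ "h \<lhd> \<alpha>'"])
  qed
  show "\<alpha> \<rhd> h \<in> inv_hom2 C (f \<odot> h) (g \<odot> h)" if "src1 C f = tgt1 C h"
  proof -
    have "(\<alpha>' \<rhd> h) \<bullet> (\<alpha> \<rhd> h) = id2 C (f \<odot> h)" "(\<alpha> \<rhd> h) \<bullet> (\<alpha>' \<rhd> h) = id2 C (g \<odot> h)"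
      using t inv p that by (simp_all flip: whisker_vcomp add: whisker_id)
    then show ?thesis using t p that
      by (auto simp: inv_hom2_iff hom2_iff calc intro!: bexI[of _ "\<alpha>' \<rhd> h"])
  qed
qed

end

section \<open>Pseudosquares and triangles form 2-categories\<close>

lemma Sigma2_simps [simp]:
  "Obj (Sigma2 I \<Sigma>) = \<Sigma>" "Arr (Sigma2 I \<Sigma>) = sq_arrs I \<Sigma>" "Cell (Sigma2 I \<Sigma>) = sq_cells I \<Sigma>"
  "src1 (Sigma2 I \<Sigma>) = sq_src" "tgt1 (Sigma2 I \<Sigma>) = sq_tgt"
  "src2 (Sigma2 I \<Sigma>) = sqc_src" "tgt2 (Sigma2 I \<Sigma>) = sqc_tgt"
  "id1 (Sigma2 I \<Sigma>) = sq_id I" "comp1 (Sigma2 I \<Sigma>) = sq_comp I"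
  "id2 (Sigma2 I \<Sigma>) u = Sq2 u u (id2 I (sq_dom u)) (id2 I (sq_cod u))"
  "vcomp (Sigma2 I \<Sigma>) m l = Sq2 (sqc_src l) (sqc_tgt m)
      (sqc_dom m \<bullet>\<^bsub>I\<^esub> sqc_dom l) (sqc_cod m \<bullet>\<^bsub>I\<^esub> sqc_cod l)"
  "hcomp (Sigma2 I \<Sigma>) m l =
      Sq2 (sq_comp I (sqc_src m) (sqc_src l)) (sq_comp I (sqc_tgt m) (sqc_tgt l))
      (sqc_dom m \<star>\<^bsub>I\<^esub> sqc_dom l) (sqc_cod m \<star>\<^bsub>I\<^esub> sqc_cod l)"
  by (simp_all add: Sigma2_def)

lemma sq_comp_simps [simp]:
  "sq_src (sq_comp I v u) = sq_src u" "sq_tgt (sq_comp I v u) = sq_tgt v"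
  "sq_dom (sq_comp I v u) = sq_dom v \<odot>\<^bsub>I\<^esub> sq_dom u" "sq_cod (sq_comp I v u) = sq_cod v \<odot>\<^bsub>I\<^esub> sq_cod u"
  by (simp_all add: sq_comp_def)

lemma sq_id_simps [simp]:
  "sq_src (sq_id I d) = d" "sq_tgt (sq_id I d) = d"
  "sq_dom (sq_id I d) = id1 I (src1 I d)" "sq_cod (sq_id I d) = id1 I (tgt1 I d)"
  "sq_fill (sq_id I d) = id2 I d"
  by (simp_all add: sq_id_def)

context two_category
begin

text \<open>Use \<open>l\<close> under \<open>k\<close>, slide \<open>l0\<close> past \<psi> and
  \<open>m1\<close> past \<phi>', then use \<open>m\<close> before \<open>f'\<close>. This is the
  closure of pseudosquare 2-cells under horizontal composition, phrased with bare 1-cells and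
  2-cells so that only one 2-category is involved.\<close>

lemma pseudosquare_hcomp:
  assumes squares: "\<phi> \<in> hom2 C (d' \<odot> f) (g \<odot> d)" "\<phi>' \<in> hom2 C (d' \<odot> f') (g' \<odot> d)"
      "\<psi> \<in> hom2 C (d'' \<odot> h) (k \<odot> d')" "\<psi>' \<in> hom2 C (d'' \<odot> h') (k' \<odot> d')"
    and arrows: "d \<in> Arr C" "d' \<in> Arr C" "d'' \<in> Arr C"
      "src1 C f = src1 C d" "tgt1 C f = src1 C d'" "src1 C g = tgt1 C d" "tgt1 C g = tgt1 C d'"
      "src1 C h = src1 C d'" "tgt1 C h = src1 C d''" "src1 C k = tgt1 C d'" "tgt1 C k = tgt1 C d''"
    and cells: "l0 \<in> hom2 C f f'" "l1 \<in> hom2 C g g'" "m0 \<in> hom2 C h h'" "m1 \<in> hom2 C k k'"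
    and l: "(l1 \<rhd> d) \<bullet> \<phi> = \<phi>' \<bullet> (d' \<lhd> l0)"
    and m: "(m1 \<rhd> d') \<bullet> \<psi> = \<psi>' \<bullet> (d'' \<lhd> m0)"
  shows "((m1 \<star> l1) \<rhd> d) \<bullet> (k \<lhd> \<phi>) \<bullet> (\<psi> \<rhd> f) = (k' \<lhd> \<phi>') \<bullet> (\<psi>' \<rhd> f') \<bullet> (d'' \<lhd> (m0 \<star> l0))"
proof -
  note c = squares[unfolded hom2_iff] cells[unfolded hom2_iff]
  have p: "f \<in> Arr C" "f' \<in> Arr C" "g \<in> Arr C" "g' \<in> Arr C" "h \<in> Arr C" "h' \<in> Arr C"
    "k \<in> Arr C" "k' \<in> Arr C" "src1 C f' = src1 C f" "tgt1 C f' = tgt1 C f"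
    "src1 C g' = src1 C g" "tgt1 C g' = tgt1 C g" "src1 C h' = src1 C h" "tgt1 C h' = tgt1 C h"
    "src1 C k' = src1 C k" "tgt1 C k' = tgt1 C k"
    using c cell_parallel[of l0] cell_parallel[of l1] cell_parallel[of m0] cell_parallel[of m1]
    by auto
  note [simp] = c p arrows calc
  have "((m1 \<star> l1) \<rhd> d) \<bullet> (k \<lhd> \<phi>) \<bullet> (\<psi> \<rhd> f) =
      (m1 \<rhd> g' \<odot> d) \<bullet> (k \<lhd> ((l1 \<rhd> d) \<bullet> \<phi>)) \<bullet> (\<psi> \<rhd> f)"
    by (simp add: hcomp_whisker(1)[of m1 l1])
  also have "\<dots> = (m1 \<rhd> g' \<odot> d) \<bullet> (k \<lhd> \<phi>') \<bullet> ((k \<odot> d') \<lhd> l0) \<bullet> (\<psi> \<rhd> f)"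
    by (simp add: l)
  also have "\<dots> = (m1 \<rhd> g' \<odot> d) \<bullet> (k \<lhd> \<phi>') \<bullet> (\<psi> \<rhd> f') \<bullet> ((d'' \<odot> h) \<lhd> l0)"
    by (simp add: exchange[of \<psi> l0, symmetric])
  also have "\<dots> = (k' \<lhd> \<phi>') \<bullet> (m1 \<rhd> d' \<odot> f') \<bullet> (\<psi> \<rhd> f') \<bullet> ((d'' \<odot> h) \<lhd> l0)"
    by (rule vcomp_subst) (simp_all add: exchange[of m1 \<phi>'])
  also have "\<dots> = (k' \<lhd> \<phi>') \<bullet> (((m1 \<rhd> d') \<bullet> \<psi>) \<rhd> f') \<bullet> ((d'' \<odot> h) \<lhd> l0)"
    by simp
  also have "\<dots> = (k' \<lhd> \<phi>') \<bullet> (\<psi>' \<rhd> f') \<bullet> (d'' \<lhd> (m0 \<star> l0))"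
    by (simp add: m hcomp_whisker(1)[of m0 l0])
  finally show ?thesis .
qed

text \<open>Use \<open>v\<close> whiskered by \<open>u0\<close>, then \<open>u\<close> whiskered by
  \<open>v2\<close>; it remains to interchange \<psi>2 with \<phi>0, which act on different edges.
  This is the coherence of a composite of pseudonatural transformations at the filler of a
  triangle.\<close>

lemma triangle_comp:
  assumes squares: "\<phi>0 \<in> hom2 C (e0' \<odot> u0) (u1 \<odot> e0)" "\<phi>1 \<in> hom2 C (e1' \<odot> u0) (u2 \<odot> e1)"
      "\<phi>2 \<in> hom2 C (e2' \<odot> u1) (u2 \<odot> e2)"
      "\<psi>0 \<in> hom2 C (e0'' \<odot> v0) (v1 \<odot> e0')" "\<psi>1 \<in> hom2 C (e1'' \<odot> v0) (v2 \<odot> e1')"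
      "\<psi>2 \<in> hom2 C (e2'' \<odot> v1) (v2 \<odot> e2')"
    and triangles: "\<tau> \<in> hom2 C (e2 \<odot> e0) e1" "\<tau>' \<in> hom2 C (e2' \<odot> e0') e1'"
      "\<tau>'' \<in> hom2 C (e2'' \<odot> e0'') e1''"
    and arrows: "e0 \<in> Arr C" "e1 \<in> Arr C" "e2 \<in> Arr C" "src1 C e1 = src1 C e0"
      "src1 C e2 = tgt1 C e0" "tgt1 C e2 = tgt1 C e1"
      "e0' \<in> Arr C" "e1' \<in> Arr C" "e2' \<in> Arr C" "src1 C e1' = src1 C e0'"
      "src1 C e2' = tgt1 C e0'" "tgt1 C e2' = tgt1 C e1'"
      "e0'' \<in> Arr C" "e1'' \<in> Arr C" "e2'' \<in> Arr C" "src1 C e1'' = src1 C e0''"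
      "src1 C e2'' = tgt1 C e0''" "tgt1 C e2'' = tgt1 C e1''"
      "u0 \<in> Arr C" "u1 \<in> Arr C" "u2 \<in> Arr C" "v0 \<in> Arr C" "v1 \<in> Arr C" "v2 \<in> Arr C"
      "src1 C u0 = src1 C e0" "src1 C u1 = tgt1 C e0" "src1 C u2 = tgt1 C e1"
      "tgt1 C u0 = src1 C e0'" "tgt1 C u1 = tgt1 C e0'" "tgt1 C u2 = tgt1 C e1'"
      "src1 C v0 = src1 C e0'" "src1 C v1 = tgt1 C e0'" "src1 C v2 = tgt1 C e1'"
      "tgt1 C v0 = src1 C e0''" "tgt1 C v1 = tgt1 C e0''" "tgt1 C v2 = tgt1 C e1''"
    and u: "\<phi>1 \<bullet> (\<tau>' \<rhd> u0) = (u2 \<lhd> \<tau>) \<bullet> (\<phi>2 \<rhd> e0) \<bullet> (e2' \<lhd> \<phi>0)"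
    and v: "\<psi>1 \<bullet> (\<tau>'' \<rhd> v0) = (v2 \<lhd> \<tau>') \<bullet> (\<psi>2 \<rhd> e0') \<bullet> (e2'' \<lhd> \<psi>0)"
  shows "((v2 \<lhd> \<phi>1) \<bullet> (\<psi>1 \<rhd> u0)) \<bullet> (\<tau>'' \<rhd> (v0 \<odot> u0)) =
    ((v2 \<odot> u2) \<lhd> \<tau>) \<bullet> (((v2 \<lhd> \<phi>2) \<bullet> (\<psi>2 \<rhd> u1)) \<rhd> e0) \<bullet> (e2'' \<lhd> ((v1 \<lhd> \<phi>0) \<bullet> (\<psi>0 \<rhd> u0)))"
proof -
  note [simp] = squares[unfolded hom2_iff] triangles[unfolded hom2_iff] arrows calc
  have "((v2 \<lhd> \<phi>1) \<bullet> (\<psi>1 \<rhd> u0)) \<bullet> (\<tau>'' \<rhd> (v0 \<odot> u0)) = (v2 \<lhd> \<phi>1) \<bullet> ((\<psi>1 \<bullet> (\<tau>'' \<rhd> v0)) \<rhd> u0)"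
    by simp
  also have "\<dots> = (v2 \<lhd> (\<phi>1 \<bullet> (\<tau>' \<rhd> u0))) \<bullet> (\<psi>2 \<rhd> e0' \<odot> u0) \<bullet> (e2'' \<lhd> (\<psi>0 \<rhd> u0))"
    unfolding v by simp
  also have "\<dots> = ((v2 \<odot> u2) \<lhd> \<tau>) \<bullet> (v2 \<lhd> (\<phi>2 \<rhd> e0)) \<bullet>
      ((v2 \<odot> e2') \<lhd> \<phi>0) \<bullet> (\<psi>2 \<rhd> e0' \<odot> u0) \<bullet> (e2'' \<lhd> (\<psi>0 \<rhd> u0))"
    unfolding u by simp
  also have "((v2 \<odot> e2') \<lhd> \<phi>0) \<bullet> (\<psi>2 \<rhd> e0' \<odot> u0) \<bullet> (e2'' \<lhd> (\<psi>0 \<rhd> u0)) =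
      (\<psi>2 \<rhd> u1 \<odot> e0) \<bullet> ((e2'' \<odot> v1) \<lhd> \<phi>0) \<bullet> (e2'' \<lhd> (\<psi>0 \<rhd> u0))"
    by (rule vcomp_subst) (simp_all add: exchange[of \<psi>2 \<phi>0])
  finally show ?thesis
    by simp
qed

end

locale sigma_two_category = two_category I for I :: "('i, 'j, 'k) twocat" (structure) +
  fixes \<Sigma> :: "'j set"
  assumes sigma_arr: "\<Sigma> \<subseteq> Arr I"
begin

lemma sigma_arrD: "d \<in> \<Sigma> \<Longrightarrow> d \<in> Arr I"
  using sigma_arr by auto

text \<open>Membership through selectors, so that a square need not be split into constructor form
  before its data are used.\<close>

lemma sq_arrs_iff: "u \<in> sq_arrs I \<Sigma> \<longleftrightarrow> sq_src u \<in> \<Sigma> \<and> sq_tgt u \<in> \<Sigma> \<and>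
    sq_dom u \<in> Arr I \<and> src1 I (sq_dom u) = src1 I (sq_src u) \<and> tgt1 I (sq_dom u) = src1 I (sq_tgt u) \<and>
    sq_cod u \<in> Arr I \<and> src1 I (sq_cod u) = tgt1 I (sq_src u) \<and> tgt1 I (sq_cod u) = tgt1 I (sq_tgt u) \<and>
    sq_fill u \<in> inv_hom2 I (sq_tgt u \<odot> sq_dom u) (sq_cod u \<odot> sq_src u)"
  by (cases u) (auto simp: sq_arrs_def hom1_iff)

lemma sq_arrs_fill:
  assumes "u \<in> sq_arrs I \<Sigma>"
  shows "sq_fill u \<in> Cell I" "src2 I (sq_fill u) = sq_tgt u \<odot> sq_dom u"
    "tgt2 I (sq_fill u) = sq_cod u \<odot> sq_src u"
  using assms inv_hom2_typing by (auto simp: sq_arrs_iff)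

lemma sq_arrs_src_arr: "u \<in> sq_arrs I \<Sigma> \<Longrightarrow> sq_src u \<in> Arr I \<and> sq_tgt u \<in> Arr I"
  by (auto simp: sq_arrs_iff sigma_arrD)

lemma sq_cells_iff: "l \<in> sq_cells I \<Sigma> \<longleftrightarrow> sqc_src l \<in> sq_arrs I \<Sigma> \<and> sqc_tgt l \<in> sq_arrs I \<Sigma> \<and>
    sq_src (sqc_tgt l) = sq_src (sqc_src l) \<and> sq_tgt (sqc_tgt l) = sq_tgt (sqc_src l) \<and>
    sqc_dom l \<in> Cell I \<and> src2 I (sqc_dom l) = sq_dom (sqc_src l) \<and> tgt2 I (sqc_dom l) = sq_dom (sqc_tgt l) \<and>
    sqc_cod l \<in> Cell I \<and> src2 I (sqc_cod l) = sq_cod (sqc_src l) \<and> tgt2 I (sqc_cod l) = sq_cod (sqc_tgt l) \<and>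
    (sqc_cod l \<rhd> sq_src (sqc_src l)) \<bullet> sq_fill (sqc_src l) =
      sq_fill (sqc_tgt l) \<bullet> (sq_tgt (sqc_src l) \<lhd> sqc_dom l)"
  by (cases l) (auto simp: sq_cells_def hom2_iff)

lemma sq_id_in: "d \<in> \<Sigma> \<Longrightarrow> sq_id I d \<in> sq_arrs I \<Sigma>"
  by (auto simp: sq_arrs_iff calc sigma_arrD inv_hom2_id)

lemma sq_comp_in:
  assumes "u \<in> sq_arrs I \<Sigma>" "v \<in> sq_arrs I \<Sigma>" "sq_src v = sq_tgt u"
  shows "sq_comp I v u \<in> sq_arrs I \<Sigma>"
proof -
  note t = assms(1,2)[unfolded sq_arrs_iff] assms(1,2)[THEN sq_arrs_src_arr] assms(1,2)[THEN sq_arrs_fill(1)]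
    assms(1,2)[THEN sq_arrs_fill(2)] assms(1,2)[THEN sq_arrs_fill(3)]
  have "sq_cod v \<lhd> sq_fill u \<in> inv_hom2 I (sq_cod v \<odot> (sq_tgt u \<odot> sq_dom u)) (sq_cod v \<odot> (sq_cod u \<odot> sq_src u))"
    by (rule inv_hom2_whisker) (use assms t in \<open>simp_all add: calc\<close>)
  moreover have "sq_fill v \<rhd> sq_dom u \<in> inv_hom2 I ((sq_tgt v \<odot> sq_dom v) \<odot> sq_dom u) ((sq_cod v \<odot> sq_src v) \<odot> sq_dom u)"
    by (rule inv_hom2_whisker) (use assms t in \<open>simp_all add: calc\<close>)
  ultimately have "sq_fill (sq_comp I v u) \<in> inv_hom2 I ((sq_tgt v \<odot> sq_dom v) \<odot> sq_dom u)
      (sq_cod v \<odot> (sq_cod u \<odot> sq_src u))"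
    using t assms unfolding sq_comp_def by (auto intro: inv_hom2_vcomp simp: calc)
  then show ?thesis
    using t assms by (simp add: sq_arrs_iff calc)
qed

lemma sq_hcomp_in:
  assumes "l \<in> sq_cells I \<Sigma>" "m \<in> sq_cells I \<Sigma>" "sq_src (sqc_src m) = sq_tgt (sqc_src l)"
  shows "Sq2 (sq_comp I (sqc_src m) (sqc_src l)) (sq_comp I (sqc_tgt m) (sqc_tgt l))
    (sqc_dom m \<star> sqc_dom l) (sqc_cod m \<star> sqc_cod l) \<in> sq_cells I \<Sigma>"
proof -
  note t = assms[unfolded sq_cells_iff]
  have a: "sqc_src l \<in> sq_arrs I \<Sigma>" "sqc_src m \<in> sq_arrs I \<Sigma>"
    "sqc_tgt l \<in> sq_arrs I \<Sigma>" "sqc_tgt m \<in> sq_arrs I \<Sigma>" using t by auto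
  note t' = a[unfolded sq_arrs_iff] a[THEN sq_arrs_src_arr] a[THEN sq_arrs_fill(1)]
    a[THEN sq_arrs_fill(2)] a[THEN sq_arrs_fill(3)]
  have "((sqc_cod m \<star> sqc_cod l) \<rhd> sq_src (sqc_src l)) \<bullet>
      (sq_cod (sqc_src m) \<lhd> sq_fill (sqc_src l)) \<bullet> (sq_fill (sqc_src m) \<rhd> sq_dom (sqc_src l)) =
      (sq_cod (sqc_tgt m) \<lhd> sq_fill (sqc_tgt l)) \<bullet> (sq_fill (sqc_tgt m) \<rhd> sq_dom (sqc_tgt l)) \<bullet>
      (sq_tgt (sqc_src m) \<lhd> (sqc_dom m \<star> sqc_dom l))"
    \<comment> \<open>The edge shared by the two squares does not occur in the conclusion of the
      pasting law and is supplied here.\<close>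
    by (rule pseudosquare_hcomp[where d' = "sq_tgt (sqc_src l)"])
      (use assms(3) t t' in \<open>auto simp: hom2_iff\<close>)
  with t t' assms(3) show ?thesis
    by (simp add: sq_cells_iff sq_comp_in) (simp add: sq_comp_def calc)
qed

text \<open>The equations hold componentwise in I, and for 1-cells also between the fillers. The
  laws with content are closure of cells under the two compositions: compatible pairs of 2-cells
  paste.\<close>

lemma two_category_Sigma2: "two_category (Sigma2 I \<Sigma>)"
proof
  fix u assume "u \<in> Arr (Sigma2 I \<Sigma>)"
  then show "src1 (Sigma2 I \<Sigma>) u \<in> Obj (Sigma2 I \<Sigma>)" "tgt1 (Sigma2 I \<Sigma>) u \<in> Obj (Sigma2 I \<Sigma>)"
    "id2 (Sigma2 I \<Sigma>) u \<in> hom2 (Sigma2 I \<Sigma>) u u"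
    by (auto simp: sq_arrs_iff hom2_def sq_cells_iff calc sq_arrs_fill sigma_arrD)
next
  fix \<alpha> assume "\<alpha> \<in> Cell (Sigma2 I \<Sigma>)"
  then show "src2 (Sigma2 I \<Sigma>) \<alpha> \<in> Arr (Sigma2 I \<Sigma>)" "tgt2 (Sigma2 I \<Sigma>) \<alpha> \<in> Arr (Sigma2 I \<Sigma>)"
    "src1 (Sigma2 I \<Sigma>) (src2 (Sigma2 I \<Sigma>) \<alpha>) = src1 (Sigma2 I \<Sigma>) (tgt2 (Sigma2 I \<Sigma>) \<alpha>)"
    "tgt1 (Sigma2 I \<Sigma>) (src2 (Sigma2 I \<Sigma>) \<alpha>) = tgt1 (Sigma2 I \<Sigma>) (tgt2 (Sigma2 I \<Sigma>) \<alpha>)"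
    by (auto simp: sq_cells_iff)
next
  fix x assume "x \<in> Obj (Sigma2 I \<Sigma>)"
  then show "id1 (Sigma2 I \<Sigma>) x \<in> hom1 (Sigma2 I \<Sigma>) x x"
    by (simp add: hom1_def sq_id_in)
next
  fix f x y g z assume "f \<in> hom1 (Sigma2 I \<Sigma>) x y" "g \<in> hom1 (Sigma2 I \<Sigma>) y z"
  then have a: "f \<in> sq_arrs I \<Sigma>" "g \<in> sq_arrs I \<Sigma>" and e: "sq_src f = x" "sq_tgt f = y" "sq_src g = y" "sq_tgt g = z"
    by (auto simp: hom1_def)
  then show "comp1 (Sigma2 I \<Sigma>) g f \<in> hom1 (Sigma2 I \<Sigma>) x z"
    by (simp add: hom1_def sq_comp_in)
  show "hcomp (Sigma2 I \<Sigma>) (id2 (Sigma2 I \<Sigma>) g) (id2 (Sigma2 I \<Sigma>) f) = id2 (Sigma2 I \<Sigma>) (comp1 (Sigma2 I \<Sigma>) g f)"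
    using e a[unfolded sq_arrs_iff] by (simp add: hcomp_id2')
next
  fix f x y assume "f \<in> hom1 (Sigma2 I \<Sigma>) x y"
  then have f: "f \<in> sq_arrs I \<Sigma>" and "sq_src f = x" "sq_tgt f = y" by (auto simp: hom1_def)
  then show "comp1 (Sigma2 I \<Sigma>) (id1 (Sigma2 I \<Sigma>) y) f = f"
    "comp1 (Sigma2 I \<Sigma>) f (id1 (Sigma2 I \<Sigma>) x) = f"
    using f[unfolded sq_arrs_iff] f[THEN sq_arrs_src_arr] f[THEN sq_arrs_fill(1)]
      f[THEN sq_arrs_fill(2)] f[THEN sq_arrs_fill(3)]
    by (auto intro!: sq1.expand simp: sq_comp_def calc)
next
  fix f w x g y h z
  assume "f \<in> hom1 (Sigma2 I \<Sigma>) w x" "g \<in> hom1 (Sigma2 I \<Sigma>) x y" "h \<in> hom1 (Sigma2 I \<Sigma>) y z"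
  then have a: "f \<in> sq_arrs I \<Sigma>" "g \<in> sq_arrs I \<Sigma>" "h \<in> sq_arrs I \<Sigma>"
    and e: "sq_src g = sq_tgt f" "sq_src h = sq_tgt g" by (auto simp: hom1_def)
  show "comp1 (Sigma2 I \<Sigma>) h (comp1 (Sigma2 I \<Sigma>) g f) = comp1 (Sigma2 I \<Sigma>) (comp1 (Sigma2 I \<Sigma>) h g) f"
    using e a[unfolded sq_arrs_iff] a[THEN sq_arrs_src_arr] a[THEN sq_arrs_fill(1)]
      a[THEN sq_arrs_fill(2)] a[THEN sq_arrs_fill(3)]
    by (auto simp: sq_comp_def calc)
next
  fix \<alpha> f g assume "\<alpha> \<in> hom2 (Sigma2 I \<Sigma>) f g"
  then show "vcomp (Sigma2 I \<Sigma>) (id2 (Sigma2 I \<Sigma>) g) \<alpha> = \<alpha>" "vcomp (Sigma2 I \<Sigma>) \<alpha> (id2 (Sigma2 I \<Sigma>) f) = \<alpha>"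
    by (auto simp: hom2_def sq_cells_iff calc intro!: sq2.expand)
next
  fix \<alpha> f g \<beta> h assume "\<alpha> \<in> hom2 (Sigma2 I \<Sigma>) f g" "\<beta> \<in> hom2 (Sigma2 I \<Sigma>) g h"
  then have c: "\<alpha> \<in> sq_cells I \<Sigma>" "\<beta> \<in> sq_cells I \<Sigma>" and e: "sqc_src \<alpha> = f" "sqc_tgt \<alpha> = g" "sqc_src \<beta> = g" "sqc_tgt \<beta> = h"
    by (auto simp: hom2_def)
  note t = c[unfolded sq_cells_iff] e
  have a: "f \<in> sq_arrs I \<Sigma>" "g \<in> sq_arrs I \<Sigma>" "h \<in> sq_arrs I \<Sigma>" using t by auto
  note t = t a[unfolded sq_arrs_iff] a[THEN sq_arrs_src_arr] a[THEN sq_arrs_fill(1)]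
      a[THEN sq_arrs_fill(2)] a[THEN sq_arrs_fill(3)]
  have "(sqc_cod \<beta> \<rhd> sq_src f) \<bullet> (sqc_cod \<alpha> \<rhd> sq_src f) \<bullet> sq_fill f =
      (sqc_cod \<beta> \<rhd> sq_src g) \<bullet> sq_fill g \<bullet> (sq_tgt f \<lhd> sqc_dom \<alpha>)"
    using t by (simp add: calc)
  \<comment> \<open>The right-associated form hides the pair to which the compatibility of \<beta>
    applies, so the brackets are moved explicitly.\<close>
  also have "\<dots> = ((sqc_cod \<beta> \<rhd> sq_src g) \<bullet> sq_fill g) \<bullet> (sq_tgt f \<lhd> sqc_dom \<alpha>)"
    by (rule vcomp_right_assoc[symmetric]) (use t in \<open>simp_all add: calc\<close>)
  also have "(sqc_cod \<beta> \<rhd> sq_src g) \<bullet> sq_fill g = sq_fill h \<bullet> (sq_tgt g \<lhd> sqc_dom \<beta>)"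
    using t by simp
  also have "\<dots> \<bullet> (sq_tgt f \<lhd> sqc_dom \<alpha>) = sq_fill h \<bullet> (sq_tgt f \<lhd> sqc_dom \<beta>) \<bullet> (sq_tgt f \<lhd> sqc_dom \<alpha>)"
    using t by (simp add: calc)
  finally show "vcomp (Sigma2 I \<Sigma>) \<beta> \<alpha> \<in> hom2 (Sigma2 I \<Sigma>) f h"
    using t by (simp add: hom2_def sq_cells_iff calc)
next
  fix \<alpha> f g \<beta> h \<gamma> k
  assume "\<alpha> \<in> hom2 (Sigma2 I \<Sigma>) f g" "\<beta> \<in> hom2 (Sigma2 I \<Sigma>) g h" "\<gamma> \<in> hom2 (Sigma2 I \<Sigma>) h k"
  then show "vcomp (Sigma2 I \<Sigma>) \<gamma> (vcomp (Sigma2 I \<Sigma>) \<beta> \<alpha>) = vcomp (Sigma2 I \<Sigma>) (vcomp (Sigma2 I \<Sigma>) \<gamma> \<beta>) \<alpha>"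
    by (auto simp: hom2_def sq_cells_iff calc)
next
  fix f x y g z \<alpha> f' \<beta> g'
  assume "f \<in> hom1 (Sigma2 I \<Sigma>) x y" "g \<in> hom1 (Sigma2 I \<Sigma>) y z"
    "\<alpha> \<in> hom2 (Sigma2 I \<Sigma>) f f'" "\<beta> \<in> hom2 (Sigma2 I \<Sigma>) g g'"
  then show "hcomp (Sigma2 I \<Sigma>) \<beta> \<alpha> \<in> hom2 (Sigma2 I \<Sigma>) (comp1 (Sigma2 I \<Sigma>) g f) (comp1 (Sigma2 I \<Sigma>) g' f')"
    using sq_hcomp_in[of \<alpha> \<beta>] by (auto simp: hom1_def hom2_def)
next
  fix f x y \<alpha> g assume "f \<in> hom1 (Sigma2 I \<Sigma>) x y" "\<alpha> \<in> hom2 (Sigma2 I \<Sigma>) f g"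
  then have c: "\<alpha> \<in> sq_cells I \<Sigma>" and e: "sqc_src \<alpha> = f" "sqc_tgt \<alpha> = g" "sq_src f = x" "sq_tgt f = y"
    by (auto simp: hom1_def hom2_def)
  note t = c[unfolded sq_cells_iff] e
  have a: "f \<in> sq_arrs I \<Sigma>" "g \<in> sq_arrs I \<Sigma>" using t by auto
  note t = t a[unfolded sq_arrs_iff] a[THEN sq_arrs_src_arr] a[THEN sq_arrs_fill(1)]
      a[THEN sq_arrs_fill(2)] a[THEN sq_arrs_fill(3)]
  show "hcomp (Sigma2 I \<Sigma>) (id2 (Sigma2 I \<Sigma>) (id1 (Sigma2 I \<Sigma>) y)) \<alpha> = \<alpha>"
    "hcomp (Sigma2 I \<Sigma>) \<alpha> (id2 (Sigma2 I \<Sigma>) (id1 (Sigma2 I \<Sigma>) x)) = \<alpha>"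
    using t by (auto intro!: sq2.expand sq1.expand simp: sq_comp_def calc hcomp_unit)
next
  fix f w x g y h z \<alpha> f' \<beta> g' \<gamma> h'
  assume "f \<in> hom1 (Sigma2 I \<Sigma>) w x" "g \<in> hom1 (Sigma2 I \<Sigma>) x y" "h \<in> hom1 (Sigma2 I \<Sigma>) y z"
    "\<alpha> \<in> hom2 (Sigma2 I \<Sigma>) f f'" "\<beta> \<in> hom2 (Sigma2 I \<Sigma>) g g'" "\<gamma> \<in> hom2 (Sigma2 I \<Sigma>) h h'"
  then have c: "\<alpha> \<in> sq_cells I \<Sigma>" "\<beta> \<in> sq_cells I \<Sigma>" "\<gamma> \<in> sq_cells I \<Sigma>"
    and e: "sqc_src \<alpha> = f" "sqc_tgt \<alpha> = f'" "sqc_src \<beta> = g" "sqc_tgt \<beta> = g'" "sqc_src \<gamma> = h" "sqc_tgt \<gamma> = h'"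
      "sq_src g = sq_tgt f" "sq_src h = sq_tgt g"
    by (auto simp: hom1_def hom2_def)
  note t = c[unfolded sq_cells_iff] e
  have a: "f \<in> sq_arrs I \<Sigma>" "g \<in> sq_arrs I \<Sigma>" "h \<in> sq_arrs I \<Sigma>"
    "f' \<in> sq_arrs I \<Sigma>" "g' \<in> sq_arrs I \<Sigma>" "h' \<in> sq_arrs I \<Sigma>" using t by auto
  note t = t a[unfolded sq_arrs_iff] a[THEN sq_arrs_src_arr] a[THEN sq_arrs_fill(1)]
      a[THEN sq_arrs_fill(2)] a[THEN sq_arrs_fill(3)]
  show "hcomp (Sigma2 I \<Sigma>) \<gamma> (hcomp (Sigma2 I \<Sigma>) \<beta> \<alpha>) = hcomp (Sigma2 I \<Sigma>) (hcomp (Sigma2 I \<Sigma>) \<gamma> \<beta>) \<alpha>"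
    using t by (simp add: sq_comp_def calc hcomp_right_assoc)
next
  fix f x y k z \<alpha> g \<beta> h \<gamma> l \<delta> m
  assume "f \<in> hom1 (Sigma2 I \<Sigma>) x y" "k \<in> hom1 (Sigma2 I \<Sigma>) y z"
    "\<alpha> \<in> hom2 (Sigma2 I \<Sigma>) f g" "\<beta> \<in> hom2 (Sigma2 I \<Sigma>) g h"
    "\<gamma> \<in> hom2 (Sigma2 I \<Sigma>) k l" "\<delta> \<in> hom2 (Sigma2 I \<Sigma>) l m"
  then show "hcomp (Sigma2 I \<Sigma>) (vcomp (Sigma2 I \<Sigma>) \<delta> \<gamma>) (vcomp (Sigma2 I \<Sigma>) \<beta> \<alpha>) =
      vcomp (Sigma2 I \<Sigma>) (hcomp (Sigma2 I \<Sigma>) \<delta> \<beta>) (hcomp (Sigma2 I \<Sigma>) \<gamma> \<alpha>)"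
    by (auto simp: hom1_def hom2_def sq_cells_iff sq_arrs_iff middle_four)
qed

end

section \<open>Triangles and the pseudonatural transformations between them\<close>

lemma Sigma3_simps [simp]:
  "Obj (Sigma3 I \<Sigma>) = tri_objs I \<Sigma>" "Arr (Sigma3 I \<Sigma>) = tri_arrs I \<Sigma>" "Cell (Sigma3 I \<Sigma>) = tri_cells I \<Sigma>"
  "src1 (Sigma3 I \<Sigma>) = tr_src" "tgt1 (Sigma3 I \<Sigma>) = tr_tgt"
  "src2 (Sigma3 I \<Sigma>) = trc_src" "tgt2 (Sigma3 I \<Sigma>) = trc_tgt"
  "id1 (Sigma3 I \<Sigma>) = tri_id I" "comp1 (Sigma3 I \<Sigma>) = tri_comp I"
  "id2 (Sigma3 I \<Sigma>) u = Tri2 u u (id2 I (tr_0 u)) (id2 I (tr_1 u)) (id2 I (tr_2 u))"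
  "vcomp (Sigma3 I \<Sigma>) m l = Tri2 (trc_src l) (trc_tgt m) (trc_0 m \<bullet>\<^bsub>I\<^esub> trc_0 l)
      (trc_1 m \<bullet>\<^bsub>I\<^esub> trc_1 l) (trc_2 m \<bullet>\<^bsub>I\<^esub> trc_2 l)"
  "hcomp (Sigma3 I \<Sigma>) m l =
      Tri2 (tri_comp I (trc_src m) (trc_src l)) (tri_comp I (trc_tgt m) (trc_tgt l))
      (trc_0 m \<star>\<^bsub>I\<^esub> trc_0 l) (trc_1 m \<star>\<^bsub>I\<^esub> trc_1 l) (trc_2 m \<star>\<^bsub>I\<^esub> trc_2 l)"
  by (simp_all add: Sigma3_def)

lemma tr_edge_simps [simp]:
  "sq_src (tr_edge0 u) = tri_p0 (tr_src u)" "sq_tgt (tr_edge0 u) = tri_p0 (tr_tgt u)"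
  "sq_src (tr_edge1 u) = tri_p1 (tr_src u)" "sq_tgt (tr_edge1 u) = tri_p1 (tr_tgt u)"
  "sq_src (tr_edge2 u) = tri_p2 (tr_src u)" "sq_tgt (tr_edge2 u) = tri_p2 (tr_tgt u)"
  "sq_dom (tr_edge0 u) = tr_0 u" "sq_cod (tr_edge0 u) = tr_1 u" "sq_fill (tr_edge0 u) = tr_fill0 u"
  "sq_dom (tr_edge1 u) = tr_0 u" "sq_cod (tr_edge1 u) = tr_2 u" "sq_fill (tr_edge1 u) = tr_fill1 u"
  "sq_dom (tr_edge2 u) = tr_1 u" "sq_cod (tr_edge2 u) = tr_2 u" "sq_fill (tr_edge2 u) = tr_fill2 u"
  by (simp_all add: tr_edge0_def tr_edge1_def tr_edge2_def)

lemma trc_edge_simps [simp]: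
  "sqc_src (trc_edge0 l) = tr_edge0 (trc_src l)" "sqc_tgt (trc_edge0 l) = tr_edge0 (trc_tgt l)"
  "sqc_src (trc_edge1 l) = tr_edge1 (trc_src l)" "sqc_tgt (trc_edge1 l) = tr_edge1 (trc_tgt l)"
  "sqc_src (trc_edge2 l) = tr_edge2 (trc_src l)" "sqc_tgt (trc_edge2 l) = tr_edge2 (trc_tgt l)"
  "sqc_dom (trc_edge0 l) = trc_0 l" "sqc_cod (trc_edge0 l) = trc_1 l"
  "sqc_dom (trc_edge1 l) = trc_0 l" "sqc_cod (trc_edge1 l) = trc_2 l"
  "sqc_dom (trc_edge2 l) = trc_1 l" "sqc_cod (trc_edge2 l) = trc_2 l"
  by (simp_all add: trc_edge0_def trc_edge1_def trc_edge2_def)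

text \<open>The three edge squares contain all components and structure cells of a 1-cell, so unit
  and associativity laws for triangles reduce to those of \<open>sq_comp\<close>.\<close>

lemma tri1_eqI:
  assumes "tr_src u = tr_src v" "tr_tgt u = tr_tgt v"
    "tr_edge0 u = tr_edge0 v" "tr_edge1 u = tr_edge1 v" "tr_edge2 u = tr_edge2 v"
  shows "u = v"
  using assms by (cases u; cases v) (simp add: tr_edge0_def tr_edge1_def tr_edge2_def)

lemma tri_comp_simps [simp]:
  "tr_src (tri_comp I v u) = tr_src u" "tr_tgt (tri_comp I v u) = tr_tgt v"
  "tr_edge0 (tri_comp I v u) = sq_comp I (tr_edge0 v) (tr_edge0 u)"
  "tr_edge1 (tri_comp I v u) = sq_comp I (tr_edge1 v) (tr_edge1 u)"
  "tr_edge2 (tri_comp I v u) = sq_comp I (tr_edge2 v) (tr_edge2 u)"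
  "tr_0 (tri_comp I v u) = tr_0 v \<odot>\<^bsub>I\<^esub> tr_0 u" "tr_1 (tri_comp I v u) = tr_1 v \<odot>\<^bsub>I\<^esub> tr_1 u"
  "tr_2 (tri_comp I v u) = tr_2 v \<odot>\<^bsub>I\<^esub> tr_2 u"
  by (simp_all add: tri_comp_def tr_edge0_def tr_edge1_def tr_edge2_def sq_comp_def)

context sigma_two_category
begin

sublocale S2: two_category "Sigma2 I \<Sigma>"
  by (rule two_category_Sigma2)

lemmas sq_comp_laws =
  S2.comp1_unit[simplified] S2.comp1_right_assoc[simplified]

lemma tri_objs_iff: "t \<in> tri_objs I \<Sigma> \<longleftrightarrow> tri_p0 t \<in> \<Sigma> \<and> tri_p1 t \<in> \<Sigma> \<and> tri_p2 t \<in> \<Sigma> \<and>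
    src1 I (tri_p1 t) = src1 I (tri_p0 t) \<and> src1 I (tri_p2 t) = tgt1 I (tri_p0 t) \<and>
    tgt1 I (tri_p1 t) = tgt1 I (tri_p2 t) \<and>
    tri_fill t \<in> inv_hom2 I (tri_p2 t \<odot> tri_p0 t) (tri_p1 t)"
  by (cases t) (auto simp: tri_objs_def)

lemma tri_objs_typing:
  assumes "t \<in> tri_objs I \<Sigma>"
  shows "tri_p0 t \<in> Arr I" "tri_p1 t \<in> Arr I" "tri_p2 t \<in> Arr I"
    "tri_fill t \<in> Cell I" "src2 I (tri_fill t) = tri_p2 t \<odot> tri_p0 t" "tgt2 I (tri_fill t) = tri_p1 t"
  using assms inv_hom2_typing sigma_arrD by (auto simp: tri_objs_iff)

text \<open>\<open>tri_id\<close> reads the vertices off the edges \<open>tri_p0\<close> and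
  \<open>tri_p1\<close>. The remaining squares are identity squares only when the edges really share
  their vertices, hence the premise on \<open>t\<close>.\<close>

lemma tri_id_simps [simp]:
  "tr_src (tri_id I t) = t" "tr_tgt (tri_id I t) = t"
  "tr_edge0 (tri_id I t) = sq_id I (tri_p0 t)"
  "t \<in> tri_objs I \<Sigma> \<Longrightarrow> tr_edge1 (tri_id I t) = sq_id I (tri_p1 t)"
  "t \<in> tri_objs I \<Sigma> \<Longrightarrow> tr_edge2 (tri_id I t) = sq_id I (tri_p2 t)"
  by (simp_all add: tri_id_def tr_edge0_def tr_edge1_def tr_edge2_def sq_id_def tri_objs_iff)

lemma tri_arrs_iff: "u \<in> tri_arrs I \<Sigma> \<longleftrightarrow> tr_src u \<in> tri_objs I \<Sigma> \<and> tr_tgt u \<in> tri_objs I \<Sigma> \<and>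
    tr_edge0 u \<in> sq_arrs I \<Sigma> \<and> tr_edge1 u \<in> sq_arrs I \<Sigma> \<and> tr_edge2 u \<in> sq_arrs I \<Sigma> \<and>
    tr_fill1 u \<bullet> (tri_fill (tr_tgt u) \<rhd> tr_0 u) =
      (tr_2 u \<lhd> tri_fill (tr_src u)) \<bullet> (tr_fill2 u \<rhd> tri_p0 (tr_src u)) \<bullet>
      (tri_p2 (tr_tgt u) \<lhd> tr_fill0 u)"
  by (simp add: tri_arrs_def)

lemma tri_arrs_typing:
  assumes "u \<in> tri_arrs I \<Sigma>"
  shows "tr_0 u \<in> Arr I" "tr_1 u \<in> Arr I" "tr_2 u \<in> Arr I"
    "src1 I (tr_0 u) = src1 I (tri_p0 (tr_src u))" "tgt1 I (tr_0 u) = src1 I (tri_p0 (tr_tgt u))"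
    "src1 I (tr_1 u) = tgt1 I (tri_p0 (tr_src u))" "tgt1 I (tr_1 u) = tgt1 I (tri_p0 (tr_tgt u))"
    "src1 I (tr_2 u) = tgt1 I (tri_p2 (tr_src u))" "tgt1 I (tr_2 u) = tgt1 I (tri_p2 (tr_tgt u))"
    "tr_fill0 u \<in> Cell I" "src2 I (tr_fill0 u) = tri_p0 (tr_tgt u) \<odot> tr_0 u"
    "tgt2 I (tr_fill0 u) = tr_1 u \<odot> tri_p0 (tr_src u)"
    "tr_fill1 u \<in> Cell I" "src2 I (tr_fill1 u) = tri_p1 (tr_tgt u) \<odot> tr_0 u"
    "tgt2 I (tr_fill1 u) = tr_2 u \<odot> tri_p1 (tr_src u)"
    "tr_fill2 u \<in> Cell I" "src2 I (tr_fill2 u) = tri_p2 (tr_tgt u) \<odot> tr_1 u"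
    "tgt2 I (tr_fill2 u) = tr_2 u \<odot> tri_p2 (tr_src u)"
  using assms sq_arrs_fill[of "tr_edge0 u"] sq_arrs_fill[of "tr_edge1 u"] sq_arrs_fill[of "tr_edge2 u"]
  by (auto simp: tri_arrs_iff sq_arrs_iff)

lemma tri_id_in:
  assumes "t \<in> tri_objs I \<Sigma>"
  shows "tri_id I t \<in> tri_arrs I \<Sigma>"
proof -
  have "tri_p0 t \<in> \<Sigma>" "tri_p1 t \<in> \<Sigma>" "tri_p2 t \<in> \<Sigma>"
    using assms by (auto simp: tri_objs_iff)
  moreover have "tr_fill1 (tri_id I t) \<bullet> (tri_fill t \<rhd> tr_0 (tri_id I t)) =
      (tr_2 (tri_id I t) \<lhd> tri_fill t) \<bullet> (tr_fill2 (tri_id I t) \<rhd> tri_p0 t) \<bullet>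
      (tri_p2 t \<lhd> tr_fill0 (tri_id I t))"
    using tri_objs_typing[OF assms] assms by (simp add: tri_id_def calc tri_objs_iff)
  ultimately show ?thesis
    using assms by (simp add: tri_arrs_iff sq_id_in)
qed

lemma tri_comp_in:
  assumes u: "u \<in> tri_arrs I \<Sigma>" and v: "v \<in> tri_arrs I \<Sigma>" and uv: "tr_src v = tr_tgt u"
  shows "tri_comp I v u \<in> tri_arrs I \<Sigma>"
proof -
  have o: "tr_src u \<in> tri_objs I \<Sigma>" "tr_tgt u \<in> tri_objs I \<Sigma>" "tr_tgt v \<in> tri_objs I \<Sigma>"
    using u v by (auto simp: tri_arrs_iff)
  note t = tri_arrs_typing[OF u] tri_arrs_typing[OF v] tri_objs_typing[OF o(1)] tri_objs_typing[OF o(2)]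
    tri_objs_typing[OF o(3)] o[unfolded tri_objs_iff]
  have "((tr_2 v \<lhd> tr_fill1 u) \<bullet> (tr_fill1 v \<rhd> tr_0 u)) \<bullet> (tri_fill (tr_tgt v) \<rhd> (tr_0 v \<odot> tr_0 u)) =
    ((tr_2 v \<odot> tr_2 u) \<lhd> tri_fill (tr_src u)) \<bullet>
    (((tr_2 v \<lhd> tr_fill2 u) \<bullet> (tr_fill2 v \<rhd> tr_1 u)) \<rhd> tri_p0 (tr_src u)) \<bullet>
    (tri_p2 (tr_tgt v) \<lhd> ((tr_1 v \<lhd> tr_fill0 u) \<bullet> (tr_fill0 v \<rhd> tr_0 u)))"
    \<comment> \<open>Named here are the edges that do not occur in the conclusion of the pasting
      law, in particular those of the middle triangle, together with its filler.\<close>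
    by (rule triangle_comp[where ?e1' = "tri_p1 (tr_tgt u)" and ?e0' = "tri_p0 (tr_tgt u)" and ?e2' = "tri_p2 (tr_tgt u)"
          and ?e1'' = "tri_p1 (tr_tgt v)" and ?e0'' = "tri_p0 (tr_tgt v)" and \<tau>' = "tri_fill (tr_tgt u)"
          and ?e1.0 = "tri_p1 (tr_src u)" and ?e2.0 = "tri_p2 (tr_src u)"])
      (use t u v uv in \<open>simp_all add: hom2_iff tri_arrs_iff\<close>)
  then have "tr_fill1 (tri_comp I v u) \<bullet> (tri_fill (tr_tgt v) \<rhd> (tr_0 v \<odot> tr_0 u)) =
    ((tr_2 v \<odot> tr_2 u) \<lhd> tri_fill (tr_src u)) \<bullet>
    (tr_fill2 (tri_comp I v u) \<rhd> tri_p0 (tr_src u)) \<bullet>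
    (tri_p2 (tr_tgt v) \<lhd> tr_fill0 (tri_comp I v u))"
    by (simp add: tri_comp_def sq_comp_def)
  then show ?thesis
    using u v uv by (simp add: tri_arrs_iff sq_comp_in)
qed

lemma tri_cells_iff: "l \<in> tri_cells I \<Sigma> \<longleftrightarrow> trc_src l \<in> tri_arrs I \<Sigma> \<and> trc_tgt l \<in> tri_arrs I \<Sigma> \<and>
    tr_src (trc_tgt l) = tr_src (trc_src l) \<and> tr_tgt (trc_tgt l) = tr_tgt (trc_src l) \<and>
    trc_edge0 l \<in> sq_cells I \<Sigma> \<and> trc_edge1 l \<in> sq_cells I \<Sigma> \<and> trc_edge2 l \<in> sq_cells I \<Sigma>"
  by (auto simp: tri_cells_def)

lemma tri_cells_typing:
  assumes "l \<in> tri_cells I \<Sigma>"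
  shows "trc_0 l \<in> Cell I" "src2 I (trc_0 l) = tr_0 (trc_src l)" "tgt2 I (trc_0 l) = tr_0 (trc_tgt l)"
    "trc_1 l \<in> Cell I" "src2 I (trc_1 l) = tr_1 (trc_src l)" "tgt2 I (trc_1 l) = tr_1 (trc_tgt l)"
    "trc_2 l \<in> Cell I" "src2 I (trc_2 l) = tr_2 (trc_src l)" "tgt2 I (trc_2 l) = tr_2 (trc_tgt l)"
  using assms by (auto simp: tri_cells_iff sq_cells_iff)

lemma trc_edge_id2:
  "trc_edge0 (Tri2 u u (id2 I (tr_0 u)) (id2 I (tr_1 u)) (id2 I (tr_2 u))) = id2 (Sigma2 I \<Sigma>) (tr_edge0 u)"
  "trc_edge1 (Tri2 u u (id2 I (tr_0 u)) (id2 I (tr_1 u)) (id2 I (tr_2 u))) = id2 (Sigma2 I \<Sigma>) (tr_edge1 u)"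
  "trc_edge2 (Tri2 u u (id2 I (tr_0 u)) (id2 I (tr_1 u)) (id2 I (tr_2 u))) = id2 (Sigma2 I \<Sigma>) (tr_edge2 u)"
  by (simp_all add: trc_edge0_def trc_edge1_def trc_edge2_def)

text \<open>Passing to an edge commutes with vertical composition, as it does with horizontal
  composition below. Membership in \<open>tri_cells\<close> is a condition on edges, so closure is
  inherited from \<open>Sigma2\<close>.\<close>

lemma trc_edge_vcomp:
  "trc_edge0 (vcomp (Sigma3 I \<Sigma>) m l) = vcomp (Sigma2 I \<Sigma>) (trc_edge0 m) (trc_edge0 l)"
  "trc_edge1 (vcomp (Sigma3 I \<Sigma>) m l) = vcomp (Sigma2 I \<Sigma>) (trc_edge1 m) (trc_edge1 l)"
  "trc_edge2 (vcomp (Sigma3 I \<Sigma>) m l) = vcomp (Sigma2 I \<Sigma>) (trc_edge2 m) (trc_edge2 l)"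
  by (simp_all add: trc_edge0_def trc_edge1_def trc_edge2_def)

lemma trc_edge_hcomp:
  "trc_edge0 (hcomp (Sigma3 I \<Sigma>) m l) = hcomp (Sigma2 I \<Sigma>) (trc_edge0 m) (trc_edge0 l)"
  "trc_edge1 (hcomp (Sigma3 I \<Sigma>) m l) = hcomp (Sigma2 I \<Sigma>) (trc_edge1 m) (trc_edge1 l)"
  "trc_edge2 (hcomp (Sigma3 I \<Sigma>) m l) = hcomp (Sigma2 I \<Sigma>) (trc_edge2 m) (trc_edge2 l)"
  by (simp_all add: trc_edge0_def trc_edge1_def trc_edge2_def)

text \<open>The triangle condition constrains 1-cells only. Closure of 2-cells is therefore checked
  edge by edge in \<open>Sigma2\<close>, and their equations are those of I at the three
  vertices.\<close>

lemma two_category_Sigma3: "two_category (Sigma3 I \<Sigma>)"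
proof
  fix u assume "u \<in> Arr (Sigma3 I \<Sigma>)"
  then have u: "u \<in> tri_arrs I \<Sigma>" by simp
  then show "src1 (Sigma3 I \<Sigma>) u \<in> Obj (Sigma3 I \<Sigma>)" "tgt1 (Sigma3 I \<Sigma>) u \<in> Obj (Sigma3 I \<Sigma>)"
    by (simp_all add: tri_arrs_iff)
  show "id2 (Sigma3 I \<Sigma>) u \<in> hom2 (Sigma3 I \<Sigma>) u u"
    using u S2.id2_typing(1)[of "tr_edge0 u"] S2.id2_typing(1)[of "tr_edge1 u"] S2.id2_typing(1)[of "tr_edge2 u"]
    by (simp add: hom2_def tri_cells_iff trc_edge_id2 tri_arrs_iff)
next
  fix \<alpha> assume "\<alpha> \<in> Cell (Sigma3 I \<Sigma>)"
  then show "src2 (Sigma3 I \<Sigma>) \<alpha> \<in> Arr (Sigma3 I \<Sigma>)" "tgt2 (Sigma3 I \<Sigma>) \<alpha> \<in> Arr (Sigma3 I \<Sigma>)"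
    "src1 (Sigma3 I \<Sigma>) (src2 (Sigma3 I \<Sigma>) \<alpha>) = src1 (Sigma3 I \<Sigma>) (tgt2 (Sigma3 I \<Sigma>) \<alpha>)"
    "tgt1 (Sigma3 I \<Sigma>) (src2 (Sigma3 I \<Sigma>) \<alpha>) = tgt1 (Sigma3 I \<Sigma>) (tgt2 (Sigma3 I \<Sigma>) \<alpha>)"
    by (auto simp: tri_cells_iff)
next
  fix x assume "x \<in> Obj (Sigma3 I \<Sigma>)"
  then show "id1 (Sigma3 I \<Sigma>) x \<in> hom1 (Sigma3 I \<Sigma>) x x"
    by (simp add: hom1_def tri_id_in)
next
  fix f x y g z assume "f \<in> hom1 (Sigma3 I \<Sigma>) x y" "g \<in> hom1 (Sigma3 I \<Sigma>) y z"
  then have a: "f \<in> tri_arrs I \<Sigma>" "g \<in> tri_arrs I \<Sigma>" and e: "tr_src f = x" "tr_tgt f = y" "tr_src g = y" "tr_tgt g = z"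
    by (auto simp: hom1_def)
  then show "comp1 (Sigma3 I \<Sigma>) g f \<in> hom1 (Sigma3 I \<Sigma>) x z"
    by (simp add: hom1_def tri_comp_in)
  show "hcomp (Sigma3 I \<Sigma>) (id2 (Sigma3 I \<Sigma>) g) (id2 (Sigma3 I \<Sigma>) f) = id2 (Sigma3 I \<Sigma>) (comp1 (Sigma3 I \<Sigma>) g f)"
    using e tri_arrs_typing[OF a(1)] tri_arrs_typing[OF a(2)] by (simp add: hcomp_id2')
next
  fix f x y assume "f \<in> hom1 (Sigma3 I \<Sigma>) x y"
  then have f: "f \<in> tri_arrs I \<Sigma>" and "tr_src f = x" "tr_tgt f = y" by (auto simp: hom1_def)
  then show "comp1 (Sigma3 I \<Sigma>) (id1 (Sigma3 I \<Sigma>) y) f = f"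
    "comp1 (Sigma3 I \<Sigma>) f (id1 (Sigma3 I \<Sigma>) x) = f"
    by (auto intro!: tri1_eqI simp: tri_arrs_iff sq_comp_laws)
next
  fix f w x g y h z
  assume "f \<in> hom1 (Sigma3 I \<Sigma>) w x" "g \<in> hom1 (Sigma3 I \<Sigma>) x y" "h \<in> hom1 (Sigma3 I \<Sigma>) y z"
  then show "comp1 (Sigma3 I \<Sigma>) h (comp1 (Sigma3 I \<Sigma>) g f) = comp1 (Sigma3 I \<Sigma>) (comp1 (Sigma3 I \<Sigma>) h g) f"
    by (auto intro!: tri1_eqI simp: hom1_def tri_arrs_iff sq_comp_laws)
next
  fix \<alpha> f g assume "\<alpha> \<in> hom2 (Sigma3 I \<Sigma>) f g"
  then show "vcomp (Sigma3 I \<Sigma>) (id2 (Sigma3 I \<Sigma>) g) \<alpha> = \<alpha>" "vcomp (Sigma3 I \<Sigma>) \<alpha> (id2 (Sigma3 I \<Sigma>) f) = \<alpha>"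
    using tri_cells_typing[of \<alpha>] by (auto simp: hom2_def calc intro!: tri2.expand)
next
  fix \<alpha> f g \<beta> h assume "\<alpha> \<in> hom2 (Sigma3 I \<Sigma>) f g" "\<beta> \<in> hom2 (Sigma3 I \<Sigma>) g h"
  then have c: "\<alpha> \<in> tri_cells I \<Sigma>" "\<beta> \<in> tri_cells I \<Sigma>"
    and e: "trc_src \<alpha> = f" "trc_tgt \<alpha> = g" "trc_src \<beta> = g" "trc_tgt \<beta> = h"
    by (auto simp: hom2_def)
  show "vcomp (Sigma3 I \<Sigma>) \<beta> \<alpha> \<in> hom2 (Sigma3 I \<Sigma>) f h"
    using e c[unfolded tri_cells_iff] trc_edge_vcomp[of \<beta> \<alpha>]
      S2.vcomp_typing(1)[of "trc_edge0 \<beta>" "trc_edge0 \<alpha>"]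
      S2.vcomp_typing(1)[of "trc_edge1 \<beta>" "trc_edge1 \<alpha>"]
      S2.vcomp_typing(1)[of "trc_edge2 \<beta>" "trc_edge2 \<alpha>"]
    by (simp add: hom2_def tri_cells_iff)
next
  fix \<alpha> f g \<beta> h \<gamma> k
  assume "\<alpha> \<in> hom2 (Sigma3 I \<Sigma>) f g" "\<beta> \<in> hom2 (Sigma3 I \<Sigma>) g h" "\<gamma> \<in> hom2 (Sigma3 I \<Sigma>) h k"
  then show "vcomp (Sigma3 I \<Sigma>) \<gamma> (vcomp (Sigma3 I \<Sigma>) \<beta> \<alpha>) = vcomp (Sigma3 I \<Sigma>) (vcomp (Sigma3 I \<Sigma>) \<gamma> \<beta>) \<alpha>"
    using tri_cells_typing[of \<alpha>] tri_cells_typing[of \<beta>] tri_cells_typing[of \<gamma>]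
    by (auto simp: hom2_def calc)
next
  fix f x y g z \<alpha> f' \<beta> g'
  assume "f \<in> hom1 (Sigma3 I \<Sigma>) x y" "g \<in> hom1 (Sigma3 I \<Sigma>) y z"
    "\<alpha> \<in> hom2 (Sigma3 I \<Sigma>) f f'" "\<beta> \<in> hom2 (Sigma3 I \<Sigma>) g g'"
  then have c: "\<alpha> \<in> tri_cells I \<Sigma>" "\<beta> \<in> tri_cells I \<Sigma>"
    and e: "trc_src \<alpha> = f" "trc_tgt \<alpha> = f'" "trc_src \<beta> = g" "trc_tgt \<beta> = g'" "tr_src g = tr_tgt f"
    by (auto simp: hom1_def hom2_def)
  show "hcomp (Sigma3 I \<Sigma>) \<beta> \<alpha> \<in> hom2 (Sigma3 I \<Sigma>) (comp1 (Sigma3 I \<Sigma>) g f) (comp1 (Sigma3 I \<Sigma>) g' f')"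
    using e c[unfolded tri_cells_iff] trc_edge_hcomp[of \<beta> \<alpha>]
      S2.hcomp_typing(1)[of "trc_edge0 \<beta>" "trc_edge0 \<alpha>"]
      S2.hcomp_typing(1)[of "trc_edge1 \<beta>" "trc_edge1 \<alpha>"]
      S2.hcomp_typing(1)[of "trc_edge2 \<beta>" "trc_edge2 \<alpha>"]
    by (simp add: hom2_def tri_cells_iff tri_comp_in)
next
  fix f x y \<alpha> g assume "f \<in> hom1 (Sigma3 I \<Sigma>) x y" "\<alpha> \<in> hom2 (Sigma3 I \<Sigma>) f g"
  then have c: "\<alpha> \<in> tri_cells I \<Sigma>" and e: "trc_src \<alpha> = f" "trc_tgt \<alpha> = g" "tr_src f = x" "tr_tgt f = y"
    by (auto simp: hom1_def hom2_def)
  note t = c[unfolded tri_cells_iff] e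
  have a: "f \<in> tri_arrs I \<Sigma>" "g \<in> tri_arrs I \<Sigma>" and o: "x \<in> tri_objs I \<Sigma>" "y \<in> tri_objs I \<Sigma>"
    using t by (auto simp: tri_arrs_iff)
  note o' = o[unfolded tri_objs_iff]
  have "tri_comp I (tri_id I y) u = u" "tri_comp I u (tri_id I x) = u"
    if "u \<in> tri_arrs I \<Sigma>" "tr_src u = x" "tr_tgt u = y" for u
    using that by (auto intro!: tri1_eqI simp: tri_arrs_iff sq_comp_laws)
  then show "hcomp (Sigma3 I \<Sigma>) (id2 (Sigma3 I \<Sigma>) (id1 (Sigma3 I \<Sigma>) y)) \<alpha> = \<alpha>"
    "hcomp (Sigma3 I \<Sigma>) \<alpha> (id2 (Sigma3 I \<Sigma>) (id1 (Sigma3 I \<Sigma>) x)) = \<alpha>"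
    using t o' tri_cells_typing[OF c] tri_arrs_typing[OF a(1)]
    by (auto intro!: tri2.expand simp: tri_id_def hcomp_unit)
next
  fix f w x g y h z \<alpha> f' \<beta> g' \<gamma> h'
  assume "f \<in> hom1 (Sigma3 I \<Sigma>) w x" "g \<in> hom1 (Sigma3 I \<Sigma>) x y" "h \<in> hom1 (Sigma3 I \<Sigma>) y z"
    "\<alpha> \<in> hom2 (Sigma3 I \<Sigma>) f f'" "\<beta> \<in> hom2 (Sigma3 I \<Sigma>) g g'" "\<gamma> \<in> hom2 (Sigma3 I \<Sigma>) h h'"
  then have c: "\<alpha> \<in> tri_cells I \<Sigma>" "\<beta> \<in> tri_cells I \<Sigma>" "\<gamma> \<in> tri_cells I \<Sigma>"
    and e: "trc_src \<alpha> = f" "trc_tgt \<alpha> = f'" "trc_src \<beta> = g" "trc_tgt \<beta> = g'" "trc_src \<gamma> = h" "trc_tgt \<gamma> = h'"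
      "tr_src g = tr_tgt f" "tr_src h = tr_tgt g"
    by (auto simp: hom1_def hom2_def)
  note t = c[unfolded tri_cells_iff] e
  have a: "f \<in> tri_arrs I \<Sigma>" "g \<in> tri_arrs I \<Sigma>" "h \<in> tri_arrs I \<Sigma>"
    "f' \<in> tri_arrs I \<Sigma>" "g' \<in> tri_arrs I \<Sigma>" "h' \<in> tri_arrs I \<Sigma>" using t by auto
  note ty = tri_cells_typing[OF c(1)] tri_cells_typing[OF c(2)] tri_cells_typing[OF c(3)]
    tri_arrs_typing[OF a(1)] tri_arrs_typing[OF a(2)] tri_arrs_typing[OF a(3)]
  have "tri_comp I w (tri_comp I v u) = tri_comp I (tri_comp I w v) u"
    if "u \<in> tri_arrs I \<Sigma>" "v \<in> tri_arrs I \<Sigma>" "w \<in> tri_arrs I \<Sigma>" "tr_src v = tr_tgt u" "tr_src w = tr_tgt v" for u v w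
    using that by (auto intro!: tri1_eqI simp: tri_arrs_iff sq_comp_laws)
  then show "hcomp (Sigma3 I \<Sigma>) \<gamma> (hcomp (Sigma3 I \<Sigma>) \<beta> \<alpha>) = hcomp (Sigma3 I \<Sigma>) (hcomp (Sigma3 I \<Sigma>) \<gamma> \<beta>) \<alpha>"
    using t a ty by (simp add: hcomp_right_assoc)
next
  fix f x y k z \<alpha> g \<beta> h \<gamma> l \<delta> m
  assume "f \<in> hom1 (Sigma3 I \<Sigma>) x y" "k \<in> hom1 (Sigma3 I \<Sigma>) y z"
    "\<alpha> \<in> hom2 (Sigma3 I \<Sigma>) f g" "\<beta> \<in> hom2 (Sigma3 I \<Sigma>) g h"
    "\<gamma> \<in> hom2 (Sigma3 I \<Sigma>) k l" "\<delta> \<in> hom2 (Sigma3 I \<Sigma>) l m"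
  then show "hcomp (Sigma3 I \<Sigma>) (vcomp (Sigma3 I \<Sigma>) \<delta> \<gamma>) (vcomp (Sigma3 I \<Sigma>) \<beta> \<alpha>) =
      vcomp (Sigma3 I \<Sigma>) (hcomp (Sigma3 I \<Sigma>) \<delta> \<beta>) (hcomp (Sigma3 I \<Sigma>) \<gamma> \<alpha>)"
    using tri_cells_typing[of \<alpha>] tri_cells_typing[of \<beta>] tri_cells_typing[of \<gamma>] tri_cells_typing[of \<delta>]
      tri_arrs_typing[of f] tri_arrs_typing[of k]
    by (auto simp: hom1_def hom2_def middle_four)
qed

sublocale S3: two_category "Sigma3 I \<Sigma>"
  by (rule two_category_Sigma3)

section \<open>2-functors between the indexing 2-categories and I\<close>

definition Cod :: "('j, ('j, 'k) sq1, ('j, 'k) sq2, 'i, 'j, 'k) twofun" where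
  "Cod = \<lparr>F0 = tgt1 I, F1 = sq_cod, F2 = sqc_cod\<rparr>"

definition P2 :: "(('j, 'k) tri, ('j, 'k) tri1, ('j, 'k) tri2, 'j, ('j, 'k) sq1, ('j, 'k) sq2) twofun" where
  "P2 = \<lparr>F0 = tri_p2, F1 = tr_edge2, F2 = trc_edge2\<rparr>"

text \<open>The 2-functor sending an object to its identity 1-cell. Its squares can be filled with
  identity 2-cells because composing \<open>d\<close> with an identity on either side gives
  \<open>d\<close> itself.\<close>

definition IdSq :: "('i, 'j, 'k, 'j, ('j, 'k) sq1, ('j, 'k) sq2) twofun" where
  "IdSq = \<lparr>F0 = id1 I, F1 = (\<lambda>d. Sq1 (id1 I (src1 I d)) (id1 I (tgt1 I d)) d d (id2 I d)),
    F2 = (\<lambda>\<sigma>. Sq2 (Sq1 (id1 I (src1 I (src2 I \<sigma>))) (id1 I (tgt1 I (src2 I \<sigma>))) (src2 I \<sigma>) (src2 I \<sigma>) (id2 I (src2 I \<sigma>)))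
      (Sq1 (id1 I (src1 I (tgt2 I \<sigma>))) (id1 I (tgt1 I (tgt2 I \<sigma>))) (tgt2 I \<sigma>) (tgt2 I \<sigma>) (id2 I (tgt2 I \<sigma>))) \<sigma> \<sigma>)\<rparr>"

lemma two_functor_Dom: "two_functor (Sigma2 I \<Sigma>) I (Dom I)"
  by unfold_locales (auto simp: Dom_def hom1_def hom2_def sq_arrs_iff sq_cells_iff src1_in sigma_arrD)

lemma two_functor_Cod: "two_functor (Sigma2 I \<Sigma>) I Cod"
  by unfold_locales (auto simp: Cod_def hom1_def hom2_def sq_arrs_iff sq_cells_iff tgt1_in sigma_arrD)

lemma two_functor_P0: "two_functor (Sigma3 I \<Sigma>) (Sigma2 I \<Sigma>) P0"
  by unfold_locales (auto simp: P0_def hom1_def hom2_def tri_objs_iff tri_arrs_iff tri_cells_iff trc_edge0_def)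

lemma two_functor_P1: "two_functor (Sigma3 I \<Sigma>) (Sigma2 I \<Sigma>) P1"
  by unfold_locales (auto simp: P1_def hom1_def hom2_def tri_objs_iff tri_arrs_iff tri_cells_iff trc_edge1_def)

lemma two_functor_P2: "two_functor (Sigma3 I \<Sigma>) (Sigma2 I \<Sigma>) P2"
  by unfold_locales (auto simp: P2_def hom1_def hom2_def tri_objs_iff tri_arrs_iff tri_cells_iff trc_edge2_def)

lemma two_functor_IdSq:
  assumes "\<And>x. x \<in> Obj I \<Longrightarrow> id1 I x \<in> \<Sigma>"
  shows "two_functor I (Sigma2 I \<Sigma>) IdSq"
  by unfold_locales
    (auto simp: IdSq_def hom1_def hom2_def sq_arrs_iff sq_cells_iff assms sq_id_def sq_comp_def
      calc inv_hom2_id)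

end

lemma two_functor_comp:
  assumes "two_functor J K D" "two_functor K L E"
  shows "two_functor J L (E \<circ>\<^sub>2 D)"
proof -
  interpret D: two_functor J K D by fact
  interpret E: two_functor K L E by fact
  show ?thesis
  proof
    fix f assume f: "f \<in> Arr J"
    then have "F1 D f \<in> Arr K"
      using D.F1_in[of f "src1 J f" "tgt1 J f"] by (auto simp: hom1_def)
    then show "F2 (E \<circ>\<^sub>2 D) (id2 J f) = id2 L (F1 (E \<circ>\<^sub>2 D) f)"
      using f by (simp add: comp_twofun_def D.F2_id E.F2_id)
  next
    fix f x y g z \<alpha> f' \<beta> g'
    assume h: "f \<in> hom1 J x y" "g \<in> hom1 J y z" "\<alpha> \<in> hom2 J f f'" "\<beta> \<in> hom2 J g g'"
    then show "F2 (E \<circ>\<^sub>2 D) (\<beta> \<star>\<^bsub>J\<^esub> \<alpha>) = F2 (E \<circ>\<^sub>2 D) \<beta> \<star>\<^bsub>L\<^esub> F2 (E \<circ>\<^sub>2 D) \<alpha>"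
      by (simp add: comp_twofun_def D.F2_hcomp[OF h] E.F2_hcomp[OF D.F1_in D.F1_in D.F2_in D.F2_in, OF h])
  qed (auto simp: comp_twofun_def D.F0_in E.F0_in D.F1_id E.F1_id intro: D.F1_in E.F1_in D.F2_in E.F2_in
      D.F1_comp[THEN arg_cong, THEN trans] E.F1_comp D.F2_vcomp[THEN arg_cong, THEN trans] E.F2_vcomp)
qed

section \<open>Equivalences of categories\<close>

lemma (in category) ciso_right_cancel:
  assumes e: "ciso A e" "e \<in> chom A x y" and "f \<in> chom A y z" "g \<in> chom A y z"
    and "ccomp A f e = ccomp A g e"
  shows "f = g"
proof -
  obtain e' where e': "e' \<in> chom A y x" "ccomp A e e' = cid A y"
    using e by (auto simp: ciso_def chom_def)
  have "f = ccomp A (ccomp A f e) e'"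
    using assms e' by (metis assoc id_right)
  also have "\<dots> = g"
    using assms e' by (metis assoc id_right)
  finally show ?thesis .
qed

lemma (in category) ciso_left_cancel:
  assumes e: "ciso A e" "e \<in> chom A y z" and "f \<in> chom A x y" "g \<in> chom A x y"
    and "ccomp A e f = ccomp A e g"
  shows "f = g"
proof -
  obtain e' where e': "e' \<in> chom A z y" "ccomp A e' e = cid A y"
    using e by (auto simp: ciso_def chom_def)
  have "f = ccomp A e' (ccomp A e f)"
    using assms e' by (metis assoc id_left)
  also have "\<dots> = g"
    using assms e' by (metis assoc id_left)
  finally show ?thesis .
qed

text \<open>By naturality both \<open>f\<close> and \<open>g\<close>, followed by
  \<open>\<eta> y\<close>, equal \<open>\<eta> x\<close> followed by the common image under G after
  F, and \<open>\<eta> y\<close> cancels on the left.\<close>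

lemma faithful_if_natural_iso:
  assumes "category A" "natural_iso A A id_funct (comp_funct G F) \<eta>"
    and f: "f \<in> chom A x y" and g: "g \<in> chom A x y" and "fa F f = fa F g"
  shows "f = g"
proof -
  interpret category A by fact
  have y: "y \<in> cobj A" using f cod_in by (auto simp: chom_def)
  have "ccomp A (\<eta> y) f = ccomp A (\<eta> y) g"
    using assms by (simp add: natural_iso_def comp_funct_def id_funct_def) metis
  then show ?thesis
    using assms(2) y f g by (auto simp: natural_iso_def id_funct_def intro: ciso_left_cancel)
qed

lemma equivalence_faithful:
  assumes "equivalence A B F" "f \<in> chom A x y" "g \<in> chom A x y" "fa F f = fa F g"
  shows "f = g"
  using assms faithful_if_natural_iso is_functor.axioms(1) unfolding equivalence_def by metis

text \<open>The unit yields a candidate \<open>f\<close> whose image under G after F is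
  \<open>fa G g\<close>; the counit shows that G is faithful, so the image of \<open>f\<close> under
  F is \<open>g\<close>.\<close>

lemma equivalence_full:
  assumes "equivalence A B F" "x \<in> cobj A" "y \<in> cobj A" "g \<in> chom B (fo F x) (fo F y)"
  obtains f where "f \<in> chom A x y" "fa F f = g"
proof -
  obtain G \<eta> \<epsilon> where F: "is_functor A B F" and G: "is_functor B A G"
    and \<eta>: "natural_iso A A id_funct (comp_funct G F) \<eta>"
    and \<epsilon>: "natural_iso B B (comp_funct F G) id_funct \<epsilon>"
    using assms(1) by (auto simp: equivalence_def)
  interpret F: is_functor A B F by fact
  interpret G: is_functor B A G by fact
  have \<eta>x: "\<eta> x \<in> chom A x (fo G (fo F x))" "ciso A (\<eta> x)"
    and \<eta>y: "\<eta> y \<in> chom A y (fo G (fo F y))" "ciso A (\<eta> y)"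
    using \<eta> assms by (auto simp: natural_iso_def id_funct_def comp_funct_def)
  obtain i where i: "i \<in> chom A (fo G (fo F y)) y" "ccomp A (\<eta> y) i = cid A (fo G (fo F y))"
    using \<eta>y by (auto simp: ciso_def chom_def)
  have Gg: "fa G g \<in> chom A (fo G (fo F x)) (fo G (fo F y))"
    using G.arr assms by auto
  \<comment> \<open>\<open>fa G g\<close> transported along the unit; \<open>i\<close> is the
    inverse of \<open>\<eta> y\<close>.\<close>
  define f where "f = ccomp A i (ccomp A (fa G g) (\<eta> x))"
  have f: "f \<in> chom A x y"
    unfolding f_def using F.A.comp_in \<eta>x Gg i by metis
  have "ccomp A (fa G (fa F f)) (\<eta> x) = ccomp A (\<eta> y) f"
    using \<eta> f by (simp add: natural_iso_def id_funct_def comp_funct_def)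
  also have "\<dots> = ccomp A (ccomp A (\<eta> y) i) (ccomp A (fa G g) (\<eta> x))"
    unfolding f_def using F.A.assoc F.A.comp_in \<eta>x \<eta>y Gg i by metis
  also have "\<dots> = ccomp A (fa G g) (\<eta> x)"
    using i F.A.id_left F.A.comp_in \<eta>x Gg by metis
  finally have "fa G (fa F f) = fa G g"
    using F.A.ciso_right_cancel[OF \<eta>x(2,1)] G.arr F.arr f Gg by metis
  \<comment> \<open>Faithfulness of G. The counit ends at the identity, opposite to the
    transformation in \<open>faithful_if_natural_iso\<close>, so the argument is carried out again
    with cancellation on the right.\<close>
  moreover have "fa F f = g" if "fa G (fa F f) = fa G g"
  proof -
    have "ccomp B (\<epsilon> (fo F y)) (fa F (fa G (fa F f))) = ccomp B (fa F f) (\<epsilon> (fo F x))"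
      "ccomp B (\<epsilon> (fo F y)) (fa F (fa G g)) = ccomp B g (\<epsilon> (fo F x))"
      using \<epsilon> F.arr[OF f] assms(4) by (auto simp: natural_iso_def id_funct_def comp_funct_def)
    then have "ccomp B (fa F f) (\<epsilon> (fo F x)) = ccomp B g (\<epsilon> (fo F x))"
      using that by simp
    moreover have "\<epsilon> (fo F x) \<in> chom B (fo F (fo G (fo F x))) (fo F x)" "ciso B (\<epsilon> (fo F x))"
      using \<epsilon> F.obj[OF assms(2)] by (auto simp: natural_iso_def id_funct_def comp_funct_def)
    ultimately show ?thesis
      using F.B.ciso_right_cancel F.arr[OF f] assms(4) by metis
  qed
  ultimately show ?thesis
    using that f by simp
qed

text \<open>Fullness lifts the inverse of the image, and faithfulness lifts the two equations that
  make it an inverse.\<close>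

lemma equivalence_reflects_ciso:
  assumes e: "equivalence A B F" and f: "f \<in> chom A x y" and iso: "ciso B (fa F f)"
  shows "ciso A f"
proof -
  interpret is_functor A B F using e by (simp add: equivalence_def)
  have xy: "x \<in> cobj A" "y \<in> cobj A" using f A.dom_in A.cod_in by (auto simp: chom_def)
  obtain g where "g \<in> chom B (fo F y) (fo F x)"
    and inv: "ccomp B g (fa F f) = cid B (fo F x)" "ccomp B (fa F f) g = cid B (fo F y)"
    using iso arr[OF f] by (auto simp: ciso_def chom_def)
  then obtain h where h: "h \<in> chom A y x" "fa F h = g"
    using equivalence_full[OF e xy(2,1)] by metis
  have "fa F (ccomp A h f) = fa F (cid A x)" "fa F (ccomp A f h) = fa F (cid A y)"
    using comp[OF f h(1)] comp[OF h(1) f] h inv id xy by auto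
  then have "ccomp A h f = cid A x" "ccomp A f h = cid A y"
    using equivalence_faithful[OF e] A.comp_in A.id_in f h xy by metis+
  then show ?thesis
    using f h by (auto simp: ciso_def chom_def)
qed

lemma equivalence_essentially_surjective:
  assumes "equivalence A B F" "b \<in> cobj B"
  obtains a e where "a \<in> cobj A" "e \<in> chom B (fo F a) b" "ciso B e"
proof -
  obtain G \<epsilon> where "is_functor B A G" "natural_iso B B (comp_funct F G) id_funct \<epsilon>"
    using assms(1) by (auto simp: equivalence_def)
  then show ?thesis
    using that[of "fo G b" "\<epsilon> b"] is_functor.obj[of B A G b] assms(2)
    by (auto simp: natural_iso_def id_funct_def comp_funct_def)
qed

section \<open>Invertible modifications of oplax cocones\<close>

text \<open>The invertible arrows of \<open>Cocones\<close>, stripped of extensionality and of the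
  requirement that both ends be cocones. Components can then be plain abstractions, and the diagram
  enters only through its action on 1-cells.\<close>

definition iso_modif :: "('i, 'j, 'k) twocat \<Rightarrow> ('o, 'a, 'c) twocat \<Rightarrow>
    ('i, 'j, 'k, 'o, 'a, 'c) twofun \<Rightarrow> ('i, 'j, 'a, 'c) cocone \<Rightarrow> ('i, 'j, 'a, 'c) cocone \<Rightarrow>
    ('i \<Rightarrow> 'c) \<Rightarrow> bool" where
  "iso_modif J C D k k' m \<longleftrightarrow>
    (\<forall>x \<in> Obj J. m x \<in> inv_hom2 C (leg k x) (leg k' x)) \<and>
    (\<forall>d \<in> Arr J. m (src1 J d) \<bullet>\<^bsub>C\<^esub> trans k d = trans k' d \<bullet>\<^bsub>C\<^esub> (m (tgt1 J d) \<rhd>\<^bsub>C\<^esub> F1 D d))"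

lemma iso_modif_cong:
  assumes "iso_modif J C D k k' m" "\<And>d. d \<in> Arr J \<Longrightarrow> F1 D d = F1 D' d"
  shows "iso_modif J C D' k k' m"
  using assms by (simp add: iso_modif_def)

text \<open>Quantifying over 1-cells instead of hom-sets lets the simplifier apply the laws without
  first guessing the end objects.\<close>

lemma oplax_cocone_iff: "oplax_cocone J C D B q \<longleftrightarrow>
    leg q \<in> extensional (Obj J) \<and> trans q \<in> extensional (Arr J) \<and>
    (\<forall>x \<in> Obj J. leg q x \<in> hom1 C (F0 D x) B) \<and>
    (\<forall>d \<in> Arr J. trans q d \<in> hom2 C (leg q (tgt1 J d) \<odot>\<^bsub>C\<^esub> F1 D d) (leg q (src1 J d))) \<and>
    (\<forall>x \<in> Obj J. trans q (id1 J x) = id2 C (leg q x)) \<and>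
    (\<forall>d \<in> Arr J. \<forall>e \<in> Arr J. src1 J e = tgt1 J d \<longrightarrow>
      trans q (e \<odot>\<^bsub>J\<^esub> d) = trans q d \<bullet>\<^bsub>C\<^esub> (trans q e \<rhd>\<^bsub>C\<^esub> F1 D d)) \<and>
    (\<forall>\<sigma> \<in> Cell J. src2 J \<sigma> \<in> Arr J \<longrightarrow>
      trans q (tgt2 J \<sigma>) \<bullet>\<^bsub>C\<^esub> (leg q (tgt1 J (src2 J \<sigma>)) \<lhd>\<^bsub>C\<^esub> F2 D \<sigma>) = trans q (src2 J \<sigma>))"
  unfolding oplax_cocone_def hom1_def[of J] hom2_def[of J] by auto

text \<open>Diagrams such as \<open>D1 \<circ>\<^sub>2 P1\<close> and \<open>D2\<close> below are
  total functions that are only known to agree on the cells of the index. Cocones do not see the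
  difference.\<close>

lemma oplax_cocone_cong:
  assumes "oplax_cocone J C D B q" "\<And>x. x \<in> Obj J \<Longrightarrow> F0 D x = F0 D' x"
    "\<And>d. d \<in> Arr J \<Longrightarrow> F1 D d = F1 D' d" "\<And>\<sigma>. \<sigma> \<in> Cell J \<Longrightarrow> F2 D \<sigma> = F2 D' \<sigma>"
  shows "oplax_cocone J C D' B q"
  using assms by (simp add: oplax_cocone_iff)

lemma cocone_eqI:
  fixes k k' :: "('i, 'j, 'a, 'c) cocone"
  assumes "leg k \<in> extensional X" "leg k' \<in> extensional X" "\<And>x. x \<in> X \<Longrightarrow> leg k x = leg k' x"
    and "trans k \<in> extensional Y" "trans k' \<in> extensional Y" "\<And>d. d \<in> Y \<Longrightarrow> trans k d = trans k' d"
  shows "k = k'"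
  using extensionalityI[OF assms(1-3)] extensionalityI[OF assms(4-6)] by simp

lemma postcomp_simps [simp]:
  "x \<in> Obj J \<Longrightarrow> leg (postcomp J C q h) x = h \<odot>\<^bsub>C\<^esub> leg q x"
  "d \<in> Arr J \<Longrightarrow> trans (postcomp J C q h) d = h \<lhd>\<^bsub>C\<^esub> trans q d"
  "leg (postcomp J C q h) \<in> extensional (Obj J)" "trans (postcomp J C q h) \<in> extensional (Arr J)"
  by (simp_all add: postcomp_def)

lemma restrict_cocone_simps [simp]:
  "x \<in> Obj J \<Longrightarrow> leg (restrict_cocone J G q) x = leg q (F0 G x)"
  "d \<in> Arr J \<Longrightarrow> trans (restrict_cocone J G q) d = trans q (F1 G d)"
  "leg (restrict_cocone J G q) \<in> extensional (Obj J)"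
  "trans (restrict_cocone J G q) \<in> extensional (Arr J)"
  by (simp_all add: restrict_cocone_def)

context two_functor
begin

lemma F_typing:
  "x \<in> Obj J \<Longrightarrow> F0 D x \<in> Obj C"
  "d \<in> Arr J \<Longrightarrow> F1 D d \<in> Arr C" "d \<in> Arr J \<Longrightarrow> src1 C (F1 D d) = F0 D (src1 J d)"
  "d \<in> Arr J \<Longrightarrow> tgt1 C (F1 D d) = F0 D (tgt1 J d)"
  "\<sigma> \<in> Cell J \<Longrightarrow> F2 D \<sigma> \<in> Cell C" "\<sigma> \<in> Cell J \<Longrightarrow> src2 C (F2 D \<sigma>) = F1 D (src2 J \<sigma>)"
  "\<sigma> \<in> Cell J \<Longrightarrow> tgt2 C (F2 D \<sigma>) = F1 D (tgt2 J \<sigma>)"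
  using F0_in F1_in[of d "src1 J d" "tgt1 J d"] F2_in[of \<sigma> "src2 J \<sigma>" "tgt2 J \<sigma>"]
  by (auto simp: hom1_def hom2_def)

lemma F1_comp': "d \<in> Arr J \<Longrightarrow> e \<in> Arr J \<Longrightarrow> src1 J e = tgt1 J d \<Longrightarrow>
    F1 D (e \<odot>\<^bsub>J\<^esub> d) = F1 D e \<odot>\<^bsub>C\<^esub> F1 D d"
  using F1_comp[of d "src1 J d" "tgt1 J d" e "tgt1 J e"] by (auto simp: hom1_def)

lemma F2_vcomp': "\<alpha> \<in> Cell J \<Longrightarrow> \<beta> \<in> Cell J \<Longrightarrow> src2 J \<beta> = tgt2 J \<alpha> \<Longrightarrow>
    F2 D (\<beta> \<bullet>\<^bsub>J\<^esub> \<alpha>) = F2 D \<beta> \<bullet>\<^bsub>C\<^esub> F2 D \<alpha>"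
  using F2_vcomp[of \<alpha> "src2 J \<alpha>" "tgt2 J \<alpha>" \<beta> "tgt2 J \<beta>"] by (auto simp: hom2_def)

lemma F2_whisker:
  assumes "f \<in> Arr J" "\<alpha> \<in> Cell J"
  shows "src1 J f = tgt1 J (src2 J \<alpha>) \<Longrightarrow> F2 D (f \<lhd>\<^bsub>J\<^esub> \<alpha>) = F1 D f \<lhd>\<^bsub>C\<^esub> F2 D \<alpha>"
    "src1 J (src2 J \<alpha>) = tgt1 J f \<Longrightarrow> F2 D (\<alpha> \<rhd>\<^bsub>J\<^esub> f) = F2 D \<alpha> \<rhd>\<^bsub>C\<^esub> F1 D f"
  using assms F2_hcomp[of "src2 J \<alpha>" "src1 J (src2 J \<alpha>)" "tgt1 J (src2 J \<alpha>)" f "tgt1 J f" \<alpha> "tgt2 J \<alpha>" "id2 J f" f]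
    F2_hcomp[of f "src1 J f" "tgt1 J f" "src2 J \<alpha>" "tgt1 J (src2 J \<alpha>)" "id2 J f" f \<alpha> "tgt2 J \<alpha>"]
  by (auto simp: lwhisk_def rwhisk_def J.hom1_iff J.hom2_iff J.typing F2_id)

lemma F2_inv_hom2:
  assumes "\<alpha> \<in> inv_hom2 J f g"
  shows "F2 D \<alpha> \<in> inv_hom2 C (F1 D f) (F1 D g)"
proof -
  obtain \<beta> where \<beta>: "\<alpha> \<in> hom2 J f g" "\<beta> \<in> hom2 J g f" "\<beta> \<bullet>\<^bsub>J\<^esub> \<alpha> = id2 J f" "\<alpha> \<bullet>\<^bsub>J\<^esub> \<beta> = id2 J g"
    using assms by (auto simp: J.inv_hom2_iff)
  then have "f \<in> Arr J" "g \<in> Arr J" by (auto simp: J.hom2_iff J.typing)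
  then have "F2 D \<beta> \<bullet>\<^bsub>C\<^esub> F2 D \<alpha> = id2 C (F1 D f)" "F2 D \<alpha> \<bullet>\<^bsub>C\<^esub> F2 D \<beta> = id2 C (F1 D g)"
    using \<beta> F2_vcomp F2_id by metis+
  then show ?thesis
    using \<beta> F2_in by (auto simp: C.inv_hom2_iff)
qed

lemma cocone_typing:
  assumes "oplax_cocone J C D B k"
  shows "x \<in> Obj J \<Longrightarrow> leg k x \<in> Arr C" "x \<in> Obj J \<Longrightarrow> src1 C (leg k x) = F0 D x"
    "x \<in> Obj J \<Longrightarrow> tgt1 C (leg k x) = B"
    "d \<in> Arr J \<Longrightarrow> trans k d \<in> Cell C"
    "d \<in> Arr J \<Longrightarrow> src2 C (trans k d) = leg k (tgt1 J d) \<odot>\<^bsub>C\<^esub> F1 D d"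
    "d \<in> Arr J \<Longrightarrow> tgt2 C (trans k d) = leg k (src1 J d)"
  using assms by (auto simp: oplax_cocone_iff hom1_def hom2_def)

lemma iso_modif_typing:
  assumes "iso_modif J C D k k' m" "x \<in> Obj J"
  shows "m x \<in> Cell C" "src2 C (m x) = leg k x" "tgt2 C (m x) = leg k' x"
  using assms C.inv_hom2_typing by (auto simp: iso_modif_def)

lemmas cotype = F_typing cocone_typing iso_modif_typing

text \<open>Pointwise inverses are automatically compatible with the transitions: compose the law
  for \<open>m\<close> with them on both sides.\<close>

lemma iso_modif_inverse:
  assumes k: "oplax_cocone J C D B k" and k': "oplax_cocone J C D B k'"
    and m: "iso_modif J C D k k' m"
  obtains n where "iso_modif J C D k' k n"
    "\<And>x. x \<in> Obj J \<Longrightarrow> n x \<bullet>\<^bsub>C\<^esub> m x = id2 C (leg k x)"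
    "\<And>x. x \<in> Obj J \<Longrightarrow> m x \<bullet>\<^bsub>C\<^esub> n x = id2 C (leg k' x)"
proof -
  have "\<forall>x \<in> Obj J. \<exists>\<beta>. \<beta> \<in> hom2 C (leg k' x) (leg k x) \<and>
      \<beta> \<bullet>\<^bsub>C\<^esub> m x = id2 C (leg k x) \<and> m x \<bullet>\<^bsub>C\<^esub> \<beta> = id2 C (leg k' x)"
    using m by (auto simp: iso_modif_def C.inv_hom2_iff)
  then obtain n where n: "\<And>x. x \<in> Obj J \<Longrightarrow> n x \<in> hom2 C (leg k' x) (leg k x)"
    "\<And>x. x \<in> Obj J \<Longrightarrow> n x \<bullet>\<^bsub>C\<^esub> m x = id2 C (leg k x)"
    "\<And>x. x \<in> Obj J \<Longrightarrow> m x \<bullet>\<^bsub>C\<^esub> n x = id2 C (leg k' x)"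
    by metis
  have "n (src1 J d) \<bullet>\<^bsub>C\<^esub> trans k' d = trans k d \<bullet>\<^bsub>C\<^esub> (n (tgt1 J d) \<rhd>\<^bsub>C\<^esub> F1 D d)"
    if d: "d \<in> Arr J" for d
  proof -
    define x y where "x = src1 J d" and "y = tgt1 J d"
    have o: "x \<in> Obj J" "y \<in> Obj J" using d J.typing by (auto simp: x_def y_def)
    note t = cotype(1-7) cocone_typing[OF k] cocone_typing[OF k'] iso_modif_typing[OF m]
      n(1)[unfolded C.hom2_iff]
    have law: "m x \<bullet>\<^bsub>C\<^esub> trans k d = trans k' d \<bullet>\<^bsub>C\<^esub> (m y \<rhd>\<^bsub>C\<^esub> F1 D d)"
      using m d by (simp add: iso_modif_def x_def y_def)
    \<comment> \<open>The composite of \<open>n y\<close> with \<open>m y\<close> is an identity;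
      inserting it makes the law for \<open>m\<close> applicable.\<close>
    have "n x \<bullet>\<^bsub>C\<^esub> trans k' d = n x \<bullet>\<^bsub>C\<^esub> trans k' d \<bullet>\<^bsub>C\<^esub> ((m y \<bullet>\<^bsub>C\<^esub> n y) \<rhd>\<^bsub>C\<^esub> F1 D d)"
      using o d n(3) by (simp add: C.calc t flip: x_def y_def)
    also have "\<dots> = n x \<bullet>\<^bsub>C\<^esub> (trans k' d \<bullet>\<^bsub>C\<^esub> (m y \<rhd>\<^bsub>C\<^esub> F1 D d)) \<bullet>\<^bsub>C\<^esub> (n y \<rhd>\<^bsub>C\<^esub> F1 D d)"
      using o d by (simp add: C.calc t flip: x_def y_def)
    also have "\<dots> = (n x \<bullet>\<^bsub>C\<^esub> m x) \<bullet>\<^bsub>C\<^esub> trans k d \<bullet>\<^bsub>C\<^esub> (n y \<rhd>\<^bsub>C\<^esub> F1 D d)"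
      unfolding law[symmetric] using o d by (simp add: C.calc t flip: x_def y_def)
    also have "\<dots> = trans k d \<bullet>\<^bsub>C\<^esub> (n y \<rhd>\<^bsub>C\<^esub> F1 D d)"
      using o d n(2) by (simp add: C.calc t flip: x_def y_def)
    finally show ?thesis by (simp add: x_def y_def)
  qed
  then have "iso_modif J C D k' k n"
    using n m by (fastforce simp: iso_modif_def C.inv_hom2_iff)
  with n show ?thesis using that by blast
qed

lemma iso_modif_comp:
  assumes k: "oplax_cocone J C D B k" and k': "oplax_cocone J C D B k'" and k'': "oplax_cocone J C D B k''"
    and m: "iso_modif J C D k k' m" and n: "iso_modif J C D k' k'' n"
  shows "iso_modif J C D k k'' (\<lambda>x. n x \<bullet>\<^bsub>C\<^esub> m x)"
proof -
  have "(n (src1 J d) \<bullet>\<^bsub>C\<^esub> m (src1 J d)) \<bullet>\<^bsub>C\<^esub> trans k d =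
      trans k'' d \<bullet>\<^bsub>C\<^esub> ((n (tgt1 J d) \<bullet>\<^bsub>C\<^esub> m (tgt1 J d)) \<rhd>\<^bsub>C\<^esub> F1 D d)" if d: "d \<in> Arr J" for d
  proof -
    define x y where "x = src1 J d" and "y = tgt1 J d"
    have o: "x \<in> Obj J" "y \<in> Obj J" using d J.typing by (auto simp: x_def y_def)
    note t = cotype(1-7) cocone_typing[OF k] cocone_typing[OF k'] cocone_typing[OF k'']
      iso_modif_typing[OF m] iso_modif_typing[OF n]
    have lm: "m x \<bullet>\<^bsub>C\<^esub> trans k d = trans k' d \<bullet>\<^bsub>C\<^esub> (m y \<rhd>\<^bsub>C\<^esub> F1 D d)"
      and ln: "n x \<bullet>\<^bsub>C\<^esub> trans k' d = trans k'' d \<bullet>\<^bsub>C\<^esub> (n y \<rhd>\<^bsub>C\<^esub> F1 D d)"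
      using m n d by (simp_all add: iso_modif_def x_def y_def)
    have "(n x \<bullet>\<^bsub>C\<^esub> m x) \<bullet>\<^bsub>C\<^esub> trans k d = n x \<bullet>\<^bsub>C\<^esub> (m x \<bullet>\<^bsub>C\<^esub> trans k d)"
      using o d by (simp add: C.calc t flip: x_def y_def)
    also have "\<dots> = (n x \<bullet>\<^bsub>C\<^esub> trans k' d) \<bullet>\<^bsub>C\<^esub> (m y \<rhd>\<^bsub>C\<^esub> F1 D d)"
      unfolding lm using o d by (simp add: C.calc t flip: x_def y_def)
    also have "\<dots> = trans k'' d \<bullet>\<^bsub>C\<^esub> ((n y \<bullet>\<^bsub>C\<^esub> m y) \<rhd>\<^bsub>C\<^esub> F1 D d)"
      unfolding ln using o d by (simp add: C.calc t flip: x_def y_def)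
    finally show ?thesis by (simp add: x_def y_def)
  qed
  then show ?thesis
    using m n by (auto simp: iso_modif_def intro: C.inv_hom2_vcomp)
qed

text \<open>Together with \<open>ciso_if_iso_modif\<close> this is the passage between arrows of
  \<open>Cocones\<close> and pointwise data. The converse has to restrict the components, because
  arrows of \<open>Cocones\<close> are extensional.\<close>

lemma iso_modif_if_ciso:
  assumes "ciso (Cocones J C D B) (Modif k k' m)"
  shows "oplax_cocone J C D B k" "oplax_cocone J C D B k'" "iso_modif J C D k k' m"
proof -
  obtain n where m: "Modif k k' m \<in> modifications J C D B" and n: "Modif k' k n \<in> modifications J C D B"
    and inv: "(\<lambda>x\<in>Obj J. n x \<bullet>\<^bsub>C\<^esub> m x) = (\<lambda>x\<in>Obj J. id2 C (leg k x))"
      "(\<lambda>x\<in>Obj J. m x \<bullet>\<^bsub>C\<^esub> n x) = (\<lambda>x\<in>Obj J. id2 C (leg k' x))"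
  proof -
    obtain g where g: "Modif k k' m \<in> modifications J C D B" "g \<in> modifications J C D B" "mod_src g = k'" "mod_tgt g = k"
      "(\<lambda>x\<in>Obj J. mod_comp g x \<bullet>\<^bsub>C\<^esub> m x) = (\<lambda>x\<in>Obj J. id2 C (leg k x))"
      "(\<lambda>x\<in>Obj J. m x \<bullet>\<^bsub>C\<^esub> mod_comp g x) = (\<lambda>x\<in>Obj J. id2 C (leg k' x))"
      using assms by (auto simp: ciso_def chom_def Cocones_def)
    then show ?thesis using that[of "mod_comp g"] by (cases g) auto
  qed
  show "oplax_cocone J C D B k" "oplax_cocone J C D B k'"
    using m by (auto simp: modifications_def)
  have "m x \<in> inv_hom2 C (leg k x) (leg k' x)" if "x \<in> Obj J" for x
    using fun_cong[OF inv(1), of x] fun_cong[OF inv(2), of x] m n that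
    by (auto simp: C.inv_hom2_iff modifications_def)
  moreover have "m (src1 J d) \<bullet>\<^bsub>C\<^esub> trans k d = trans k' d \<bullet>\<^bsub>C\<^esub> (m (tgt1 J d) \<rhd>\<^bsub>C\<^esub> F1 D d)"
    if "d \<in> Arr J" for d
    using m that by (auto simp: modifications_def hom1_def[of J])
  ultimately show "iso_modif J C D k k' m"
    by (simp add: iso_modif_def)
qed

lemma ciso_if_iso_modif:
  assumes k: "oplax_cocone J C D B k" and k': "oplax_cocone J C D B k'"
    and m: "iso_modif J C D k k' m"
  shows "ciso (Cocones J C D B) (Modif k k' (restrict m (Obj J)))"
proof -
  obtain n where n: "iso_modif J C D k' k n"
    "\<And>x. x \<in> Obj J \<Longrightarrow> n x \<bullet>\<^bsub>C\<^esub> m x = id2 C (leg k x)"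
    "\<And>x. x \<in> Obj J \<Longrightarrow> m x \<bullet>\<^bsub>C\<^esub> n x = id2 C (leg k' x)"
    using iso_modif_inverse[OF assms] by metis
  have "Modif h h' (restrict l (Obj J)) \<in> modifications J C D B"
    if "oplax_cocone J C D B h" "oplax_cocone J C D B h'" "iso_modif J C D h h' l" for h h' l
    using that by (auto simp: modifications_def iso_modif_def C.inv_hom2_iff hom1_def[of J] J.typing)
  from this[OF k k' m] this[OF k' k n(1)] show ?thesis
    using n by (auto simp: ciso_def chom_def Cocones_def fun_eq_iff
        intro!: exI[of _ "Modif k' k (restrict n (Obj J))"])
qed

text \<open>An equivalence is full and reflects isomorphisms; reading the image of the lifted cell
  component by component gives the equation on the legs.\<close>

lemma bicolimit_lift_cell:
  assumes q: "oplax_bicolimit J C D L q" and hk: "h \<in> hom1 C L B" "k \<in> hom1 C L B"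
    and m: "iso_modif J C D (postcomp J C q h) (postcomp J C q k) m"
  obtains \<theta> where "\<theta> \<in> inv_hom2 C h k" "\<And>x. x \<in> Obj J \<Longrightarrow> \<theta> \<rhd>\<^bsub>C\<^esub> leg q x = m x"
proof -
  have "B \<in> Obj C" using hk by (auto simp: hom1_def C.typing)
  then have eq: "equivalence (Hom C L B) (Cocones J C D B) (postcomp_funct J C q)"
    using q by (simp add: oplax_bicolimit_def)
  then interpret is_functor "Hom C L B" "Cocones J C D B" "postcomp_funct J C q"
    by (simp add: equivalence_def)
  have o: "h \<in> cobj (Hom C L B)" "k \<in> cobj (Hom C L B)"
    using hk by (auto simp: Hom_def)
  define M where "M = Modif (postcomp J C q h) (postcomp J C q k) (restrict m (Obj J))"
  have M: "ciso (Cocones J C D B) M"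
    \<comment> \<open>That both postcomposites are cocones is read off from the action of the
      functor on objects.\<close>
    unfolding M_def using obj[OF o(1)] obj[OF o(2)] m
    by (intro ciso_if_iso_modif) (auto simp: Cocones_def postcomp_funct_def)
  then have "M \<in> chom (Cocones J C D B) (fo (postcomp_funct J C q) h) (fo (postcomp_funct J C q) k)"
    by (auto simp: ciso_def chom_def Cocones_def postcomp_funct_def M_def)
  then obtain \<theta> where \<theta>: "\<theta> \<in> chom (Hom C L B) h k" "fa (postcomp_funct J C q) \<theta> = M"
    using equivalence_full[OF eq o] by metis
  with M have "ciso (Hom C L B) \<theta>"
    using equivalence_reflects_ciso[OF eq] by metis
  then have "\<theta> \<in> inv_hom2 C h k"
    using \<theta>(1) hk by (auto simp: ciso_def chom_def Hom_def C.inv_hom2_iff C.hom2_iff)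
  moreover have "\<theta> \<rhd>\<^bsub>C\<^esub> leg q x = m x" if "x \<in> Obj J" for x
    using \<theta>(2) that by (auto simp: M_def postcomp_funct_def dest!: fun_cong[of _ _ x])
  ultimately show ?thesis using that by blast
qed

text \<open>Essential surjectivity: the object found is the 1-cell, and the isomorphism that comes
  with it is the witness \<open>m\<close>.\<close>

lemma bicolimit_induced:
  assumes q: "oplax_bicolimit J C D L q" and B: "B \<in> Obj C" and k: "oplax_cocone J C D B k"
  shows "\<exists>h m. induced J C D L q B k h m"
proof -
  have eq: "equivalence (Hom C L B) (Cocones J C D B) (postcomp_funct J C q)"
    using q B by (simp add: oplax_bicolimit_def)
  obtain h e where "h \<in> cobj (Hom C L B)"
    "e \<in> chom (Cocones J C D B) (fo (postcomp_funct J C q) h) k" "ciso (Cocones J C D B) e"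
    using equivalence_essentially_surjective[OF eq, of k] k by (auto simp: Cocones_def)
  then show ?thesis
    by (cases e) (auto simp: induced_def Hom_def chom_def Cocones_def postcomp_funct_def)
qed

lemma inducedD:
  assumes "induced J C D L q B k h m"
  shows "h \<in> hom1 C L B" "oplax_cocone J C D B (postcomp J C q h)" "oplax_cocone J C D B k"
    "iso_modif J C D (postcomp J C q h) k m"
  using assms iso_modif_if_ciso by (auto simp: induced_def)

lemma oplax_cocone_postcomp:
  assumes q: "oplax_cocone J C D B q" and h: "h \<in> hom1 C B B'"
  shows "oplax_cocone J C D B' (postcomp J C q h)"
proof -
  note t = J.typing C.typing F_typing cocone_typing[OF q] h[unfolded C.hom1_iff]
  have "h \<lhd>\<^bsub>C\<^esub> trans q (e \<odot>\<^bsub>J\<^esub> d) = (h \<lhd>\<^bsub>C\<^esub> trans q d) \<bullet>\<^bsub>C\<^esub> ((h \<lhd>\<^bsub>C\<^esub> trans q e) \<rhd>\<^bsub>C\<^esub> F1 D d)"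
    if "d \<in> Arr J" "e \<in> Arr J" "src1 J e = tgt1 J d" for d e
  proof -
    have "trans q (e \<odot>\<^bsub>J\<^esub> d) = trans q d \<bullet>\<^bsub>C\<^esub> (trans q e \<rhd>\<^bsub>C\<^esub> F1 D d)"
      using q that by (simp add: oplax_cocone_iff)
    then show ?thesis
      using that by (simp add: t C.whisker_vcomp C.whisker_whisker)
  qed
  moreover have "(h \<lhd>\<^bsub>C\<^esub> trans q (tgt2 J \<sigma>)) \<bullet>\<^bsub>C\<^esub> ((h \<odot>\<^bsub>C\<^esub> leg q (tgt1 J (src2 J \<sigma>))) \<lhd>\<^bsub>C\<^esub> F2 D \<sigma>) =
      h \<lhd>\<^bsub>C\<^esub> trans q (src2 J \<sigma>)" if "\<sigma> \<in> Cell J" for \<sigma>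
  proof -
    have "trans q (src2 J \<sigma>) = trans q (tgt2 J \<sigma>) \<bullet>\<^bsub>C\<^esub> (leg q (tgt1 J (src2 J \<sigma>)) \<lhd>\<^bsub>C\<^esub> F2 D \<sigma>)"
      using q that by (simp add: oplax_cocone_iff J.typing)
    then show ?thesis
      using that by (simp add: t C.whisker_vcomp C.whisker_whisker)
  qed
  moreover have "trans q (id1 J x) = id2 C (leg q x)" if "x \<in> Obj J" for x
    using q that by (simp add: oplax_cocone_iff)
  ultimately show ?thesis
    by (simp add: oplax_cocone_iff t C.hom1_iff C.hom2_iff C.whisker_id C.comp1_right_assoc)
qed

lemma iso_modif_postcomp:
  assumes k: "oplax_cocone J C D B k" and k': "oplax_cocone J C D B k'" and h: "h \<in> hom1 C B B'"
    and m: "iso_modif J C D k k' m"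
  shows "iso_modif J C D (postcomp J C k h) (postcomp J C k' h) (\<lambda>x. h \<lhd>\<^bsub>C\<^esub> m x)"
proof -
  note t = J.typing C.typing cotype(1-7) cocone_typing[OF k] cocone_typing[OF k'] iso_modif_typing[OF m]
    h[unfolded C.hom1_iff]
  have "(h \<lhd>\<^bsub>C\<^esub> m (src1 J d)) \<bullet>\<^bsub>C\<^esub> (h \<lhd>\<^bsub>C\<^esub> trans k d) =
      (h \<lhd>\<^bsub>C\<^esub> trans k' d) \<bullet>\<^bsub>C\<^esub> ((h \<lhd>\<^bsub>C\<^esub> m (tgt1 J d)) \<rhd>\<^bsub>C\<^esub> F1 D d)" if "d \<in> Arr J" for d
  proof -
    have "h \<lhd>\<^bsub>C\<^esub> (m (src1 J d) \<bullet>\<^bsub>C\<^esub> trans k d) = h \<lhd>\<^bsub>C\<^esub> (trans k' d \<bullet>\<^bsub>C\<^esub> (m (tgt1 J d) \<rhd>\<^bsub>C\<^esub> F1 D d))"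
      using m that by (simp add: iso_modif_def)
    then show ?thesis
      using that by (simp add: C.whisker_vcomp C.whisker_whisker t)
  qed
  then show ?thesis
    using m t by (auto simp: iso_modif_def intro!: C.inv_hom2_whisker)
qed

end

section \<open>Laws of postcomposition and of restriction along a 2-functor\<close>

lemma postcomp_postcomp:
  assumes "two_functor J C D" "oplax_cocone J C D A q" "h \<in> hom1 C A B" "k \<in> hom1 C B B'"
  shows "postcomp J C (postcomp J C q h) k = postcomp J C q (k \<odot>\<^bsub>C\<^esub> h)"
proof -
  interpret two_functor J C D by fact
  show ?thesis
    by (rule cocone_eqI[where X = "Obj J" and Y = "Arr J"])
      (use assms(3,4) cocone_typing[OF assms(2)] in
        \<open>auto simp: C.hom1_iff C.comp1_right_assoc C.whisker_whisker C.typing J.typing F_typing\<close>)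
qed

lemma postcomp_id1:
  assumes "two_functor J C D" "oplax_cocone J C D A q"
  shows "postcomp J C q (id1 C A) = q"
proof -
  interpret two_functor J C D by fact
  show ?thesis
    by (rule cocone_eqI[where X = "Obj J" and Y = "Arr J"])
      (use assms(2) cocone_typing[OF assms(2)] in
        \<open>auto simp: C.comp1_unit C.whisker_unit C.typing J.typing F_typing oplax_cocone_iff\<close>)
qed

lemma postcomp_restrict_cocone:
  assumes "two_functor J' J G"
  shows "postcomp J' C (restrict_cocone J' G q) h = restrict_cocone J' G (postcomp J C q h)"
proof -
  interpret two_functor J' J G by fact
  show ?thesis
    by (rule cocone_eqI[where X = "Obj J'" and Y = "Arr J'"]) (auto simp: F_typing)
qed

lemma oplax_cocone_restrict:
  assumes "two_functor J' J G" "two_functor J C D" "oplax_cocone J C D B q"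
  shows "oplax_cocone J' C (D \<circ>\<^sub>2 G) B (restrict_cocone J' G q)"
proof -
  interpret G: two_functor J' J G by fact
  interpret two_functor J C D by fact
  note q = assms(3)[unfolded oplax_cocone_iff]
  have "trans q (F1 G d) \<in> hom2 C (leg q (F0 G (tgt1 J' d)) \<odot>\<^bsub>C\<^esub> F1 D (F1 G d)) (leg q (F0 G (src1 J' d)))"
    if "d \<in> Arr J'" for d
    using cocone_typing(4-6)[OF assms(3), of "F1 G d"] that by (simp add: C.hom2_iff G.F_typing)
  moreover have "trans q (F1 G (e \<odot>\<^bsub>J'\<^esub> d)) = trans q (F1 G d) \<bullet>\<^bsub>C\<^esub> (trans q (F1 G e) \<rhd>\<^bsub>C\<^esub> F1 D (F1 G d))"
    if "d \<in> Arr J'" "e \<in> Arr J'" "src1 J' e = tgt1 J' d" for d e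
    using q that by (simp add: G.F_typing G.F1_comp')
  moreover have "trans q (F1 G (tgt2 J' \<sigma>)) \<bullet>\<^bsub>C\<^esub> (leg q (F0 G (tgt1 J' (src2 J' \<sigma>))) \<lhd>\<^bsub>C\<^esub> F2 D (F2 G \<sigma>)) =
      trans q (F1 G (src2 J' \<sigma>))" if "\<sigma> \<in> Cell J'" for \<sigma>
  proof -
    have "F2 G \<sigma> \<in> Cell J" "src2 J (F2 G \<sigma>) \<in> Arr J"
      using that G.F_typing G.J.typing by auto
    then have "trans q (tgt2 J (F2 G \<sigma>)) \<bullet>\<^bsub>C\<^esub> (leg q (tgt1 J (src2 J (F2 G \<sigma>))) \<lhd>\<^bsub>C\<^esub> F2 D (F2 G \<sigma>)) =
      trans q (src2 J (F2 G \<sigma>))"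
      using q by blast
    then show ?thesis
      using that by (simp add: G.F_typing G.J.typing)
  qed
  moreover have "trans q (F1 G (id1 J' x)) = id2 C (leg q (F0 G x))" if "x \<in> Obj J'" for x
    using q that by (simp add: G.F_typing G.F1_id)
  ultimately show ?thesis
    using q by (simp add: oplax_cocone_iff comp_twofun_def G.F_typing G.J.typing)
qed

lemma iso_modif_restrict:
  assumes "two_functor J' J G" "iso_modif J C D k k' m"
  shows "iso_modif J' C (D \<circ>\<^sub>2 G) (restrict_cocone J' G k) (restrict_cocone J' G k') (\<lambda>x. m (F0 G x))"
proof -
  interpret G: two_functor J' J G by fact
  have "m (F0 G (src1 J' d)) \<bullet>\<^bsub>C\<^esub> trans k (F1 G d) =
      trans k' (F1 G d) \<bullet>\<^bsub>C\<^esub> (m (F0 G (tgt1 J' d)) \<rhd>\<^bsub>C\<^esub> F1 D (F1 G d))" if "d \<in> Arr J'" for d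
  proof -
    have "m (src1 J (F1 G d)) \<bullet>\<^bsub>C\<^esub> trans k (F1 G d) =
        trans k' (F1 G d) \<bullet>\<^bsub>C\<^esub> (m (tgt1 J (F1 G d)) \<rhd>\<^bsub>C\<^esub> F1 D (F1 G d))"
      using assms(2) G.F_typing(2)[OF that] unfolding iso_modif_def by blast
    then show ?thesis
      using that by (simp add: G.F_typing)
  qed
  then show ?thesis
    using assms(2) by (simp add: iso_modif_def comp_twofun_def G.F_typing G.J.typing)
qed

section \<open>Whiskering a cocone by an oplax transformation\<close>

text \<open>The structure cell points from \<open>a\<close> after D to E after \<open>a\<close>.
  This direction lets it be followed by a transition of an oplax cocone on E, so that whiskering
  yields an oplax cocone on D.\<close>

definition oplax_trans :: "('i, 'j, 'k) twocat \<Rightarrow> ('o, 'a, 'c) twocat \<Rightarrow>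
    ('i, 'j, 'k, 'o, 'a, 'c) twofun \<Rightarrow> ('i, 'j, 'k, 'o, 'a, 'c) twofun \<Rightarrow>
    ('i \<Rightarrow> 'a) \<Rightarrow> ('j \<Rightarrow> 'c) \<Rightarrow> bool" where
  "oplax_trans J C D E a b \<longleftrightarrow>
    (\<forall>x \<in> Obj J. a x \<in> hom1 C (F0 D x) (F0 E x)) \<and>
    (\<forall>d \<in> Arr J. b d \<in> hom2 C (a (tgt1 J d) \<odot>\<^bsub>C\<^esub> F1 D d) (F1 E d \<odot>\<^bsub>C\<^esub> a (src1 J d))) \<and>
    (\<forall>x \<in> Obj J. b (id1 J x) = id2 C (a x)) \<and>
    (\<forall>d \<in> Arr J. \<forall>e \<in> Arr J. src1 J e = tgt1 J d \<longrightarrow>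
      b (e \<odot>\<^bsub>J\<^esub> d) = (F1 E e \<lhd>\<^bsub>C\<^esub> b d) \<bullet>\<^bsub>C\<^esub> (b e \<rhd>\<^bsub>C\<^esub> F1 D d)) \<and>
    (\<forall>\<sigma> \<in> Cell J. b (tgt2 J \<sigma>) \<bullet>\<^bsub>C\<^esub> (a (tgt1 J (src2 J \<sigma>)) \<lhd>\<^bsub>C\<^esub> F2 D \<sigma>) =
      (F2 E \<sigma> \<rhd>\<^bsub>C\<^esub> a (src1 J (src2 J \<sigma>))) \<bullet>\<^bsub>C\<^esub> b (src2 J \<sigma>))"

definition whisk_cocone :: "('i, 'j, 'k) twocat \<Rightarrow> ('o, 'a, 'c) twocat \<Rightarrow>
    ('i \<Rightarrow> 'a) \<Rightarrow> ('j \<Rightarrow> 'c) \<Rightarrow> ('i, 'j, 'a, 'c) cocone \<Rightarrow> ('i, 'j, 'a, 'c) cocone" where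
  "whisk_cocone J C a b q = \<lparr>leg = (\<lambda>x\<in>Obj J. leg q x \<odot>\<^bsub>C\<^esub> a x),
    trans = (\<lambda>d\<in>Arr J. (trans q d \<rhd>\<^bsub>C\<^esub> a (src1 J d)) \<bullet>\<^bsub>C\<^esub> (leg q (tgt1 J d) \<lhd>\<^bsub>C\<^esub> b d))\<rparr>"

lemma whisk_cocone_simps [simp]:
  "x \<in> Obj J \<Longrightarrow> leg (whisk_cocone J C a b q) x = leg q x \<odot>\<^bsub>C\<^esub> a x"
  "d \<in> Arr J \<Longrightarrow> trans (whisk_cocone J C a b q) d =
    (trans q d \<rhd>\<^bsub>C\<^esub> a (src1 J d)) \<bullet>\<^bsub>C\<^esub> (leg q (tgt1 J d) \<lhd>\<^bsub>C\<^esub> b d)"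
  "leg (whisk_cocone J C a b q) \<in> extensional (Obj J)"
  "trans (whisk_cocone J C a b q) \<in> extensional (Arr J)"
  by (simp_all add: whisk_cocone_def)

lemma oplax_trans_cong:
  assumes "oplax_trans J C D E a b" "\<And>x. x \<in> Obj J \<Longrightarrow> F0 E x = F0 E' x"
    "\<And>d. d \<in> Arr J \<Longrightarrow> F1 E d = F1 E' d" "\<And>\<sigma>. \<sigma> \<in> Cell J \<Longrightarrow> F2 E \<sigma> = F2 E' \<sigma>"
  shows "oplax_trans J C D E' a b"
  using assms by (simp add: oplax_trans_def)

text \<open>Applied to \<open>P0\<close> and the transformation with components \<open>F1 F\<close>,
  this gives the transformation by which \<open>p2_cocone\<close> is whiskered.\<close>

lemma oplax_trans_restrict:
  assumes "two_functor J' J G" "oplax_trans J C D E a b"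
  shows "oplax_trans J' C (D \<circ>\<^sub>2 G) (E \<circ>\<^sub>2 G) (\<lambda>x. a (F0 G x)) (\<lambda>d. b (F1 G d))"
proof -
  interpret G: two_functor J' J G by fact
  note ab = assms(2)[unfolded oplax_trans_def]
  have "b (F1 G d) \<in> hom2 C (a (F0 G (tgt1 J' d)) \<odot>\<^bsub>C\<^esub> F1 D (F1 G d)) (F1 E (F1 G d) \<odot>\<^bsub>C\<^esub> a (F0 G (src1 J' d)))"
    if "d \<in> Arr J'" for d
  proof -
    have "b (F1 G d) \<in> hom2 C (a (tgt1 J (F1 G d)) \<odot>\<^bsub>C\<^esub> F1 D (F1 G d)) (F1 E (F1 G d) \<odot>\<^bsub>C\<^esub> a (src1 J (F1 G d)))"
      using ab G.F_typing(2)[OF that] by blast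
    then show ?thesis using that by (simp add: G.F_typing)
  qed
  moreover have "b (F1 G (tgt2 J' \<sigma>)) \<bullet>\<^bsub>C\<^esub> (a (F0 G (tgt1 J' (src2 J' \<sigma>))) \<lhd>\<^bsub>C\<^esub> F2 D (F2 G \<sigma>)) =
      (F2 E (F2 G \<sigma>) \<rhd>\<^bsub>C\<^esub> a (F0 G (src1 J' (src2 J' \<sigma>)))) \<bullet>\<^bsub>C\<^esub> b (F1 G (src2 J' \<sigma>))"
    if "\<sigma> \<in> Cell J'" for \<sigma>
  proof -
    have "b (tgt2 J (F2 G \<sigma>)) \<bullet>\<^bsub>C\<^esub> (a (tgt1 J (src2 J (F2 G \<sigma>))) \<lhd>\<^bsub>C\<^esub> F2 D (F2 G \<sigma>)) =
        (F2 E (F2 G \<sigma>) \<rhd>\<^bsub>C\<^esub> a (src1 J (src2 J (F2 G \<sigma>)))) \<bullet>\<^bsub>C\<^esub> b (src2 J (F2 G \<sigma>))"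
      using ab G.F_typing(5)[OF that] by blast
    then show ?thesis using that by (simp add: G.F_typing G.J.typing)
  qed
  moreover have "b (F1 G (id1 J' x)) = id2 C (a (F0 G x))" if "x \<in> Obj J'" for x
    using ab that by (simp add: G.F_typing G.F1_id)
  moreover have "b (F1 G (e \<odot>\<^bsub>J'\<^esub> d)) =
      (F1 E (F1 G e) \<lhd>\<^bsub>C\<^esub> b (F1 G d)) \<bullet>\<^bsub>C\<^esub> (b (F1 G e) \<rhd>\<^bsub>C\<^esub> F1 D (F1 G d))"
    if "d \<in> Arr J'" "e \<in> Arr J'" "src1 J' e = tgt1 J' d" for d e
    using ab that by (simp add: G.F_typing G.F1_comp')
  ultimately show ?thesis
    using ab by (simp add: oplax_trans_def comp_twofun_def G.F_typing)
qed

locale oplax_transformation = D: two_functor J C D + E: two_functor J C E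
  for J :: "('i, 'j, 'k) twocat" and C :: "('o, 'a, 'c) twocat" and D E +
  fixes a :: "'i \<Rightarrow> 'a" and b :: "'j \<Rightarrow> 'c"
  assumes trans: "oplax_trans J C D E a b"
begin

lemma trans_typing:
  "x \<in> Obj J \<Longrightarrow> a x \<in> Arr C" "x \<in> Obj J \<Longrightarrow> src1 C (a x) = F0 D x" "x \<in> Obj J \<Longrightarrow> tgt1 C (a x) = F0 E x"
  "d \<in> Arr J \<Longrightarrow> b d \<in> Cell C" "d \<in> Arr J \<Longrightarrow> src2 C (b d) = a (tgt1 J d) \<odot>\<^bsub>C\<^esub> F1 D d"
  "d \<in> Arr J \<Longrightarrow> tgt2 C (b d) = F1 E d \<odot>\<^bsub>C\<^esub> a (src1 J d)"
  using trans by (auto simp: oplax_trans_def D.C.hom1_iff D.C.hom2_iff)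

text \<open>The composition law needs one interchange, between a transition of \<open>q\<close> and
  a structure cell. The other laws are those of \<open>q\<close> and of the transformation,
  whiskered.\<close>

lemma oplax_cocone_whisk:
  assumes q: "oplax_cocone J C E B q"
  shows "oplax_cocone J C D B (whisk_cocone J C a b q)"
proof -
  note t = D.J.typing D.F_typing E.F_typing E.cocone_typing[OF q] trans_typing
  have "trans (whisk_cocone J C a b q) (e \<odot>\<^bsub>J\<^esub> d) = trans (whisk_cocone J C a b q) d \<bullet>\<^bsub>C\<^esub>
      (trans (whisk_cocone J C a b q) e \<rhd>\<^bsub>C\<^esub> F1 D d)"
    if de: "d \<in> Arr J" "e \<in> Arr J" "src1 J e = tgt1 J d" for d e
  proof -
    define x y z where "x = src1 J d" and "y = tgt1 J d" and "z = tgt1 J e"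
    have o: "x \<in> Obj J" "y \<in> Obj J" "z \<in> Obj J" "src1 J d = x" "tgt1 J d = y" "src1 J e = y" "tgt1 J e = z"
      using de D.J.typing by (auto simp: x_def y_def z_def)
    have "trans (whisk_cocone J C a b q) (e \<odot>\<^bsub>J\<^esub> d) =
      ((trans q d \<bullet>\<^bsub>C\<^esub> (trans q e \<rhd>\<^bsub>C\<^esub> F1 E d)) \<rhd>\<^bsub>C\<^esub> a x) \<bullet>\<^bsub>C\<^esub>
      (leg q z \<lhd>\<^bsub>C\<^esub> ((F1 E e \<lhd>\<^bsub>C\<^esub> b d) \<bullet>\<^bsub>C\<^esub> (b e \<rhd>\<^bsub>C\<^esub> F1 D d)))"
      using q trans de o by (simp add: oplax_cocone_iff oplax_trans_def D.J.typing)
    also have "\<dots> = (trans q d \<rhd>\<^bsub>C\<^esub> a x) \<bullet>\<^bsub>C\<^esub> (trans q e \<rhd>\<^bsub>C\<^esub> F1 E d \<odot>\<^bsub>C\<^esub> a x) \<bullet>\<^bsub>C\<^esub>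
      ((leg q z \<odot>\<^bsub>C\<^esub> F1 E e) \<lhd>\<^bsub>C\<^esub> b d) \<bullet>\<^bsub>C\<^esub> (leg q z \<lhd>\<^bsub>C\<^esub> (b e \<rhd>\<^bsub>C\<^esub> F1 D d))"
      using de o by (simp add: D.C.calc t)
    \<comment> \<open>The transition at \<open>e\<close> and the structure cell at \<open>d\<close>
      act on different factors; interchanging them separates the cells that belong to
      \<open>d\<close> from those that belong to \<open>e\<close>.\<close>
    also have "(trans q e \<rhd>\<^bsub>C\<^esub> F1 E d \<odot>\<^bsub>C\<^esub> a x) \<bullet>\<^bsub>C\<^esub>
      ((leg q z \<odot>\<^bsub>C\<^esub> F1 E e) \<lhd>\<^bsub>C\<^esub> b d) \<bullet>\<^bsub>C\<^esub> (leg q z \<lhd>\<^bsub>C\<^esub> (b e \<rhd>\<^bsub>C\<^esub> F1 D d)) =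
      (leg q y \<lhd>\<^bsub>C\<^esub> b d) \<bullet>\<^bsub>C\<^esub> (trans q e \<rhd>\<^bsub>C\<^esub> a y \<odot>\<^bsub>C\<^esub> F1 D d) \<bullet>\<^bsub>C\<^esub> (leg q z \<lhd>\<^bsub>C\<^esub> (b e \<rhd>\<^bsub>C\<^esub> F1 D d))"
      by (rule D.C.vcomp_subst) (use de o in \<open>simp_all add: D.C.exchange D.C.calc t\<close>)
    also have "(trans q d \<rhd>\<^bsub>C\<^esub> a x) \<bullet>\<^bsub>C\<^esub> \<dots> = trans (whisk_cocone J C a b q) d \<bullet>\<^bsub>C\<^esub>
      (trans (whisk_cocone J C a b q) e \<rhd>\<^bsub>C\<^esub> F1 D d)"
      using de o by (simp add: D.C.calc t)
    finally show ?thesis .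
  qed
  moreover have "trans (whisk_cocone J C a b q) (tgt2 J \<sigma>) \<bullet>\<^bsub>C\<^esub>
      (leg (whisk_cocone J C a b q) (tgt1 J (src2 J \<sigma>)) \<lhd>\<^bsub>C\<^esub> F2 D \<sigma>) = trans (whisk_cocone J C a b q) (src2 J \<sigma>)"
    if \<sigma>: "\<sigma> \<in> Cell J" for \<sigma>
  proof -
    define d d' x y where "d = src2 J \<sigma>" and "d' = tgt2 J \<sigma>" and "x = src1 J d" and "y = tgt1 J d"
    have o: "src2 J \<sigma> = d" "tgt2 J \<sigma> = d'" "d \<in> Arr J" "d' \<in> Arr J" "x \<in> Obj J" "y \<in> Obj J"
      "src1 J d = x" "tgt1 J d = y" "src1 J d' = x" "tgt1 J d' = y"
      using \<sigma> D.J.typing by (auto simp: d_def d'_def x_def y_def)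
    have "trans (whisk_cocone J C a b q) d' \<bullet>\<^bsub>C\<^esub> (leg (whisk_cocone J C a b q) y \<lhd>\<^bsub>C\<^esub> F2 D \<sigma>) =
      (trans q d' \<rhd>\<^bsub>C\<^esub> a x) \<bullet>\<^bsub>C\<^esub> (leg q y \<lhd>\<^bsub>C\<^esub> (b d' \<bullet>\<^bsub>C\<^esub> (a y \<lhd>\<^bsub>C\<^esub> F2 D \<sigma>)))"
      using \<sigma> o by (simp add: D.C.calc t)
    also have "b d' \<bullet>\<^bsub>C\<^esub> (a y \<lhd>\<^bsub>C\<^esub> F2 D \<sigma>) = (F2 E \<sigma> \<rhd>\<^bsub>C\<^esub> a x) \<bullet>\<^bsub>C\<^esub> b d"
      using trans \<sigma> o by (force simp: oplax_trans_def)
    also have "(trans q d' \<rhd>\<^bsub>C\<^esub> a x) \<bullet>\<^bsub>C\<^esub> (leg q y \<lhd>\<^bsub>C\<^esub> \<dots>) =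
      ((trans q d' \<bullet>\<^bsub>C\<^esub> (leg q y \<lhd>\<^bsub>C\<^esub> F2 E \<sigma>)) \<rhd>\<^bsub>C\<^esub> a x) \<bullet>\<^bsub>C\<^esub> (leg q y \<lhd>\<^bsub>C\<^esub> b d)"
      using \<sigma> o by (simp add: D.C.calc t)
    also have "trans q d' \<bullet>\<^bsub>C\<^esub> (leg q y \<lhd>\<^bsub>C\<^esub> F2 E \<sigma>) = trans q d"
      using q \<sigma> o by (force simp: oplax_cocone_iff)
    finally show ?thesis using \<sigma> o by simp
  qed
  moreover have "trans (whisk_cocone J C a b q) (id1 J x) = id2 C (leg q x \<odot>\<^bsub>C\<^esub> a x)" if "x \<in> Obj J" for x
    using q trans that by (simp add: oplax_cocone_iff oplax_trans_def D.J.typing t D.C.calc)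
  ultimately show ?thesis
    by (simp add: oplax_cocone_iff D.C.hom1_iff D.C.hom2_iff D.C.calc t)
qed

lemma iso_modif_whisk:
  assumes k: "oplax_cocone J C E B k" and k': "oplax_cocone J C E B k'" and m: "iso_modif J C E k k' m"
  shows "iso_modif J C D (whisk_cocone J C a b k) (whisk_cocone J C a b k') (\<lambda>x. m x \<rhd>\<^bsub>C\<^esub> a x)"
proof -
  note t = D.J.typing D.F_typing E.F_typing E.cocone_typing[OF k] E.cocone_typing[OF k']
    E.iso_modif_typing[OF m] trans_typing
  have "(m (src1 J d) \<rhd>\<^bsub>C\<^esub> a (src1 J d)) \<bullet>\<^bsub>C\<^esub> trans (whisk_cocone J C a b k) d =
      trans (whisk_cocone J C a b k') d \<bullet>\<^bsub>C\<^esub> ((m (tgt1 J d) \<rhd>\<^bsub>C\<^esub> a (tgt1 J d)) \<rhd>\<^bsub>C\<^esub> F1 D d)"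
    if d: "d \<in> Arr J" for d
  proof -
    define x y where "x = src1 J d" and "y = tgt1 J d"
    have o: "x \<in> Obj J" "y \<in> Obj J" "src1 J d = x" "tgt1 J d = y"
      using d D.J.typing by (auto simp: x_def y_def)
    have "(m x \<rhd>\<^bsub>C\<^esub> a x) \<bullet>\<^bsub>C\<^esub> trans (whisk_cocone J C a b k) d =
      ((m x \<bullet>\<^bsub>C\<^esub> trans k d) \<rhd>\<^bsub>C\<^esub> a x) \<bullet>\<^bsub>C\<^esub> (leg k y \<lhd>\<^bsub>C\<^esub> b d)"
      using d o by (simp add: D.C.calc t)
    also have "m x \<bullet>\<^bsub>C\<^esub> trans k d = trans k' d \<bullet>\<^bsub>C\<^esub> (m y \<rhd>\<^bsub>C\<^esub> F1 E d)"
      using m d o by (force simp: iso_modif_def)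
    also have "(\<dots> \<rhd>\<^bsub>C\<^esub> a x) \<bullet>\<^bsub>C\<^esub> (leg k y \<lhd>\<^bsub>C\<^esub> b d) =
      (trans k' d \<rhd>\<^bsub>C\<^esub> a x) \<bullet>\<^bsub>C\<^esub> (m y \<rhd>\<^bsub>C\<^esub> F1 E d \<odot>\<^bsub>C\<^esub> a x) \<bullet>\<^bsub>C\<^esub> (leg k y \<lhd>\<^bsub>C\<^esub> b d)"
      using d o by (simp add: D.C.calc t)
    \<comment> \<open>The component \<open>m y\<close> acts on the legs and \<open>b d\<close> on
      the diagram, so they interchange.\<close>
    also have "(m y \<rhd>\<^bsub>C\<^esub> F1 E d \<odot>\<^bsub>C\<^esub> a x) \<bullet>\<^bsub>C\<^esub> (leg k y \<lhd>\<^bsub>C\<^esub> b d) =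
      (leg k' y \<lhd>\<^bsub>C\<^esub> b d) \<bullet>\<^bsub>C\<^esub> (m y \<rhd>\<^bsub>C\<^esub> a y \<odot>\<^bsub>C\<^esub> F1 D d)"
      by (rule D.C.exchange) (use d o in \<open>simp_all add: D.C.calc t\<close>)
    also have "(trans k' d \<rhd>\<^bsub>C\<^esub> a x) \<bullet>\<^bsub>C\<^esub> \<dots> =
      trans (whisk_cocone J C a b k') d \<bullet>\<^bsub>C\<^esub> ((m y \<rhd>\<^bsub>C\<^esub> a y) \<rhd>\<^bsub>C\<^esub> F1 D d)"
      using d o by (simp add: D.C.calc t)
    finally show ?thesis by (simp add: x_def y_def)
  qed
  then show ?thesis
    using m t by (auto simp: iso_modif_def intro!: D.C.inv_hom2_whisker)
qed

lemma postcomp_whisk_cocone: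
  assumes q: "oplax_cocone J C E B q" and h: "h \<in> hom1 C B B'"
  shows "postcomp J C (whisk_cocone J C a b q) h = whisk_cocone J C a b (postcomp J C q h)"
  by (rule cocone_eqI[where X = "Obj J" and Y = "Arr J"])
    (use h in \<open>auto simp: D.C.hom1_iff D.C.calc D.J.typing D.F_typing E.F_typing E.cocone_typing[OF q] trans_typing\<close>)

end

section \<open>2-cells lifted from two comparisons with a common cocone\<close>

context two_functor
begin

text \<open>Whisker the witness \<pi> with \<open>d\<close> and continue with \<delta>. The
  composites on both sides of the equations in the theorem arise in this way.\<close>

lemma iso_modif_induced_comp:
  assumes h: "induced J C D L s M c h \<pi>" and s: "oplax_cocone J C D L s" and d: "d \<in> hom1 C M B"
    and c': "oplax_cocone J C D B c'" and \<delta>: "iso_modif J C D (postcomp J C c d) c' \<delta>"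
  shows "iso_modif J C D (postcomp J C s (d \<odot>\<^bsub>C\<^esub> h)) c' (\<lambda>x. \<delta> x \<bullet>\<^bsub>C\<^esub> (d \<lhd>\<^bsub>C\<^esub> \<pi> x))"
proof -
  note ind = inducedD[OF h]
  have "iso_modif J C D (postcomp J C (postcomp J C s h) d) (postcomp J C c d) (\<lambda>x. d \<lhd>\<^bsub>C\<^esub> \<pi> x)"
    by (rule iso_modif_postcomp[OF ind(2,3) d ind(4)])
  from iso_modif_comp[OF oplax_cocone_postcomp[OF ind(2) d] oplax_cocone_postcomp[OF ind(3) d] c' this \<delta>]
  show ?thesis
    by (simp only: postcomp_postcomp[OF two_functor_axioms s ind(1) d])
qed

text \<open>The cell is lifted from \<open>m\<close> followed by the inverse of \<open>n\<close>;
  the equation is then multiplied by \<open>n\<close>, so that no inverse appears in it.\<close>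

lemma bicolimit_lift_cospan:
  assumes s: "oplax_bicolimit J C D L s" and hk: "h \<in> hom1 C L B" "k \<in> hom1 C L B"
    and c: "oplax_cocone J C D B c"
    and m: "iso_modif J C D (postcomp J C s h) c m" and n: "iso_modif J C D (postcomp J C s k) c n"
  obtains \<theta> where "\<theta> \<in> inv_hom2 C h k" "\<And>x. x \<in> Obj J \<Longrightarrow> n x \<bullet>\<^bsub>C\<^esub> (\<theta> \<rhd>\<^bsub>C\<^esub> leg s x) = m x"
proof -
  have s': "oplax_cocone J C D L s" using s by (simp add: oplax_bicolimit_def)
  note o = oplax_cocone_postcomp[OF s' hk(1)] oplax_cocone_postcomp[OF s' hk(2)]
  obtain n' where n': "iso_modif J C D c (postcomp J C s k) n'"
    and inv: "\<And>x. x \<in> Obj J \<Longrightarrow> n x \<bullet>\<^bsub>C\<^esub> n' x = id2 C (leg c x)"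
    by (rule iso_modif_inverse[OF o(2) c n], rule that)
  obtain \<theta> where \<theta>: "\<theta> \<in> inv_hom2 C h k" "\<And>x. x \<in> Obj J \<Longrightarrow> \<theta> \<rhd>\<^bsub>C\<^esub> leg s x = n' x \<bullet>\<^bsub>C\<^esub> m x"
    by (rule bicolimit_lift_cell[OF s hk iso_modif_comp[OF o(1) c o(2) m n']], rule that)
  have "n x \<bullet>\<^bsub>C\<^esub> (n' x \<bullet>\<^bsub>C\<^esub> m x) = m x" if x: "x \<in> Obj J" for x
  proof -
    have "n x \<bullet>\<^bsub>C\<^esub> (n' x \<bullet>\<^bsub>C\<^esub> m x) = (n x \<bullet>\<^bsub>C\<^esub> n' x) \<bullet>\<^bsub>C\<^esub> m x"
      using x by (simp add: C.vcomp_right_assoc iso_modif_typing[OF m] iso_modif_typing[OF n] iso_modif_typing[OF n'])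
    then show ?thesis
      using x by (simp add: inv C.vcomp_unit iso_modif_typing[OF m])
  qed
  then show ?thesis using that[OF \<theta>(1)] \<theta>(2) by simp
qed

end

section \<open>The codescent object\<close>

locale sigma_diagram = sigma_two_category I \<Sigma> + F: two_functor I C F
  for I :: "('i, 'j, 'k) twocat" (structure) and \<Sigma> :: "'j set"
    and C :: "('o, 'a, 'c) twocat" and F :: "('i, 'j, 'k, 'o, 'a, 'c) twofun" +
  assumes sigma_id1: "x \<in> Obj I \<Longrightarrow> id1 I x \<in> \<Sigma>"
begin

abbreviation "D1 \<equiv> F \<circ>\<^sub>2 Dom I"
abbreviation "D2 \<equiv> F \<circ>\<^sub>2 Dom I \<circ>\<^sub>2 P0"

sublocale D1: two_functor "Sigma2 I \<Sigma>" C D1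
  by (rule two_functor_comp[OF two_functor_Dom F.two_functor_axioms])

sublocale D2: two_functor "Sigma3 I \<Sigma>" C D2
  by (rule two_functor_comp[OF two_functor_P0 D1.two_functor_axioms])

lemma IdSq_functor: "two_functor I (Sigma2 I \<Sigma>) IdSq"
  by (rule two_functor_IdSq[OF sigma_id1])

text \<open>The composition law is F applied to the filler in \<open>sq_comp\<close>, and the law
  for 2-cells is F applied to the compatibility condition of \<open>sq_cells\<close>. This is the
  transformation behind both \<open>cod_cocone\<close> and \<open>p2_cocone\<close>.\<close>

lemma oplax_trans_cod:
  "oplax_trans (Sigma2 I \<Sigma>) C D1 (F \<circ>\<^sub>2 Cod) (F1 F) (\<lambda>u. F2 F (sq_fill u))"
proof -
  have "F2 F (sq_fill (sq_comp I v u)) =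
      (F1 F (sq_cod v) \<lhd>\<^bsub>C\<^esub> F2 F (sq_fill u)) \<bullet>\<^bsub>C\<^esub> (F2 F (sq_fill v) \<rhd>\<^bsub>C\<^esub> F1 F (sq_dom u))"
    if "u \<in> sq_arrs I \<Sigma>" "v \<in> sq_arrs I \<Sigma>" "sq_src v = sq_tgt u" for u v
  proof -
    note t = that[unfolded sq_arrs_iff] that(1,2)[THEN sq_arrs_src_arr] that(1,2)[THEN sq_arrs_fill(1)]
      that(1,2)[THEN sq_arrs_fill(2)] that(1,2)[THEN sq_arrs_fill(3)]
    have "F2 F (sq_fill (sq_comp I v u)) =
        F2 F (sq_cod v \<lhd> sq_fill u) \<bullet>\<^bsub>C\<^esub> F2 F (sq_fill v \<rhd> sq_dom u)"
      unfolding sq_comp_def sq1.sel by (rule F.F2_vcomp') (use t in \<open>simp_all add: calc\<close>)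
    then show ?thesis
      using t by (simp add: F.F2_whisker typing)
  qed
  moreover have "F2 F (sq_fill (sqc_tgt l)) \<bullet>\<^bsub>C\<^esub> (F1 F (sq_tgt (sqc_src l)) \<lhd>\<^bsub>C\<^esub> F2 F (sqc_dom l)) =
      (F2 F (sqc_cod l) \<rhd>\<^bsub>C\<^esub> F1 F (sq_src (sqc_src l))) \<bullet>\<^bsub>C\<^esub> F2 F (sq_fill (sqc_src l))"
    if "l \<in> sq_cells I \<Sigma>" for l
  proof -
    note c = that[unfolded sq_cells_iff]
    have a: "sqc_src l \<in> sq_arrs I \<Sigma>" "sqc_tgt l \<in> sq_arrs I \<Sigma>" using c by auto
    note t = c a[unfolded sq_arrs_iff] a[THEN sq_arrs_src_arr] a[THEN sq_arrs_fill(1)]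
      a[THEN sq_arrs_fill(2)] a[THEN sq_arrs_fill(3)]
    have "F2 F ((sqc_cod l \<rhd> sq_src (sqc_src l)) \<bullet> sq_fill (sqc_src l)) =
        F2 F (sqc_cod l \<rhd> sq_src (sqc_src l)) \<bullet>\<^bsub>C\<^esub> F2 F (sq_fill (sqc_src l))"
      "F2 F (sq_fill (sqc_tgt l) \<bullet> (sq_tgt (sqc_src l) \<lhd> sqc_dom l)) =
        F2 F (sq_fill (sqc_tgt l)) \<bullet>\<^bsub>C\<^esub> F2 F (sq_tgt (sqc_src l) \<lhd> sqc_dom l)"
      by (rule F.F2_vcomp'; use t in \<open>simp add: calc\<close>)+
    then show ?thesis
      using t by (simp add: F.F2_whisker)
  qed
  moreover have "F2 F (sq_fill u) \<in> hom2 C (F1 F (sq_tgt u) \<odot>\<^bsub>C\<^esub> F1 F (sq_dom u))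
      (F1 F (sq_cod u) \<odot>\<^bsub>C\<^esub> F1 F (sq_src u))" if "u \<in> sq_arrs I \<Sigma>" for u
    using that[unfolded sq_arrs_iff] sq_arrs_src_arr[OF that] sq_arrs_fill[OF that]
    by (simp add: F.C.hom2_iff F.F_typing F.F1_comp')
  ultimately show ?thesis
    by (simp add: oplax_trans_def comp_twofun_def Dom_def Cod_def F.C.hom1_iff
        F.F_typing sigma_arrD F.F2_id)
qed

text \<open>With this and the next two equations, the explicitly given cocones become instances of
  restriction and whiskering, and inherit the general results on cocones, modifications and
  postcomposition.\<close>

lemma cod_cocone_eq: "cod_cocone C I \<Sigma> F q = whisk_cocone (Sigma2 I \<Sigma>) C (F1 F) (\<lambda>u. F2 F (sq_fill u))
    (restrict_cocone (Sigma2 I \<Sigma>) Cod q)"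
  by (rule cocone_eqI[where X = \<Sigma> and Y = "sq_arrs I \<Sigma>"])
    (auto simp: cod_cocone_def restrict_cocone_def whisk_cocone_def Cod_def sq_arrs_iff)

lemma p2_cocone_eq: "p2_cocone C I \<Sigma> F r = whisk_cocone (Sigma3 I \<Sigma>) C (\<lambda>t. F1 F (tri_p0 t))
    (\<lambda>u. F2 F (tr_fill0 u)) (restrict_cocone (Sigma3 I \<Sigma>) P2 r)"
  by (rule cocone_eqI[where X = "tri_objs I \<Sigma>" and Y = "tri_arrs I \<Sigma>"])
    (auto simp: p2_cocone_def restrict_cocone_def whisk_cocone_def P2_def tri_arrs_iff)

lemma id_cocone_eq: "id_cocone I r = restrict_cocone I IdSq r"
  by (simp add: id_cocone_def restrict_cocone_def IdSq_def)

sublocale cod: oplax_transformation "Sigma2 I \<Sigma>" C D1 "F \<circ>\<^sub>2 Cod" "F1 F" "\<lambda>u. F2 F (sq_fill u)"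
  using D1.two_functor_axioms two_functor_comp[OF two_functor_Cod F.two_functor_axioms] oplax_trans_cod
  by (simp add: oplax_transformation_def oplax_transformation_axioms_def)

sublocale p2: oplax_transformation "Sigma3 I \<Sigma>" C D2 "D1 \<circ>\<^sub>2 P2" "\<lambda>t. F1 F (tri_p0 t)" "\<lambda>u. F2 F (tr_fill0 u)"
proof -
  have "oplax_trans (Sigma3 I \<Sigma>) C D2 (F \<circ>\<^sub>2 Cod \<circ>\<^sub>2 P0) (\<lambda>t. F1 F (tri_p0 t)) (\<lambda>u. F2 F (tr_fill0 u))"
    using oplax_trans_restrict[OF two_functor_P0 oplax_trans_cod] by (simp add: P0_def)
  \<comment> \<open>Restriction along \<open>P0\<close> gives a transformation ending in F cod p_0,
    which is F dom p_2 because edge p_0 of a triangle ends where edge p_2 begins.\<close>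
  then have "oplax_trans (Sigma3 I \<Sigma>) C D2 (D1 \<circ>\<^sub>2 P2) (\<lambda>t. F1 F (tri_p0 t)) (\<lambda>u. F2 F (tr_fill0 u))"
    by (rule oplax_trans_cong)
      (auto simp: comp_twofun_def P0_def P2_def Cod_def Dom_def tri_objs_iff)
  then show "oplax_transformation (Sigma3 I \<Sigma>) C D2 (D1 \<circ>\<^sub>2 P2) (\<lambda>t. F1 F (tri_p0 t)) (\<lambda>u. F2 F (tr_fill0 u))"
    using D2.two_functor_axioms two_functor_comp[OF two_functor_P2 D1.two_functor_axioms]
    by (simp add: oplax_transformation_def oplax_transformation_axioms_def)
qed

section \<open>Transport of cocones and modifications along the indexing 2-functors\<close>

lemma oplax_cocone_dom: "oplax_cocone I C F B q \<Longrightarrow> oplax_cocone (Sigma2 I \<Sigma>) C D1 B (dom_cocone I \<Sigma> q)"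
  unfolding dom_cocone_def by (rule oplax_cocone_restrict[OF two_functor_Dom F.two_functor_axioms])

lemma oplax_cocone_cod: "oplax_cocone I C F B q \<Longrightarrow> oplax_cocone (Sigma2 I \<Sigma>) C D1 B (cod_cocone C I \<Sigma> F q)"
  unfolding cod_cocone_eq
  by (intro cod.oplax_cocone_whisk oplax_cocone_restrict[OF two_functor_Cod F.two_functor_axioms])

text \<open>The domain side of the identity square on \<open>d\<close> is \<open>d\<close>, so
  \<open>D1 \<circ>\<^sub>2 IdSq\<close> agrees with F on the cells of I.\<close>

lemma oplax_cocone_id:
  assumes "oplax_cocone (Sigma2 I \<Sigma>) C D1 B r"
  shows "oplax_cocone I C F B (restrict_cocone I IdSq r)"
  by (rule oplax_cocone_cong[OF oplax_cocone_restrict[OF IdSq_functor D1.two_functor_axioms assms]])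
    (auto simp: comp_twofun_def Dom_def IdSq_def typing)

lemma oplax_cocone_p0: "oplax_cocone (Sigma2 I \<Sigma>) C D1 B r \<Longrightarrow>
    oplax_cocone (Sigma3 I \<Sigma>) C D2 B (restrict_cocone (Sigma3 I \<Sigma>) P0 r)"
  by (rule oplax_cocone_restrict[OF two_functor_P0 D1.two_functor_axioms])

lemma oplax_cocone_p1:
  assumes "oplax_cocone (Sigma2 I \<Sigma>) C D1 B r"
  shows "oplax_cocone (Sigma3 I \<Sigma>) C D2 B (restrict_cocone (Sigma3 I \<Sigma>) P1 r)"
  by (rule oplax_cocone_cong[OF oplax_cocone_restrict[OF two_functor_P1 D1.two_functor_axioms assms]])
    (auto simp: comp_twofun_def Dom_def P0_def P1_def tri_objs_iff)

lemma oplax_cocone_p2: "oplax_cocone (Sigma2 I \<Sigma>) C D1 B r \<Longrightarrow>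
    oplax_cocone (Sigma3 I \<Sigma>) C (D1 \<circ>\<^sub>2 P2) B (restrict_cocone (Sigma3 I \<Sigma>) P2 r)"
  by (rule oplax_cocone_restrict[OF two_functor_P2 D1.two_functor_axioms])

lemma iso_modif_id:
  assumes "iso_modif (Sigma2 I \<Sigma>) C D1 k k' m"
  shows "iso_modif I C F (restrict_cocone I IdSq k) (restrict_cocone I IdSq k') (\<lambda>x. m (id1 I x))"
  using iso_modif_cong[OF iso_modif_restrict[OF IdSq_functor assms], of F]
  by (simp add: comp_twofun_def Dom_def IdSq_def)

lemma iso_modif_p0:
  assumes "iso_modif (Sigma2 I \<Sigma>) C D1 k k' m"
  shows "iso_modif (Sigma3 I \<Sigma>) C D2 (restrict_cocone (Sigma3 I \<Sigma>) P0 k)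
    (restrict_cocone (Sigma3 I \<Sigma>) P0 k') (\<lambda>\<phi>. m (tri_p0 \<phi>))"
  using iso_modif_restrict[OF two_functor_P0 assms] by (simp add: P0_def)

lemma iso_modif_p1:
  assumes "iso_modif (Sigma2 I \<Sigma>) C D1 k k' m"
  shows "iso_modif (Sigma3 I \<Sigma>) C D2 (restrict_cocone (Sigma3 I \<Sigma>) P1 k)
    (restrict_cocone (Sigma3 I \<Sigma>) P1 k') (\<lambda>\<phi>. m (tri_p1 \<phi>))"
  using iso_modif_cong[OF iso_modif_restrict[OF two_functor_P1 assms], of D2]
  by (simp add: comp_twofun_def Dom_def P0_def P1_def)

lemma iso_modif_p2:
  assumes "oplax_cocone (Sigma2 I \<Sigma>) C D1 B k" "oplax_cocone (Sigma2 I \<Sigma>) C D1 B k'"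
    "iso_modif (Sigma2 I \<Sigma>) C D1 k k' m"
  shows "iso_modif (Sigma3 I \<Sigma>) C D2 (p2_cocone C I \<Sigma> F k) (p2_cocone C I \<Sigma> F k')
    (\<lambda>\<phi>. m (tri_p2 \<phi>) \<rhd>\<^bsub>C\<^esub> F1 F (tri_p0 \<phi>))"
  using p2.iso_modif_whisk[OF oplax_cocone_p2[OF assms(1)] oplax_cocone_p2[OF assms(2)]
      iso_modif_restrict[OF two_functor_P2 assms(3)]]
  by (simp add: p2_cocone_eq P2_def)

section \<open>Coincidences between the inducing cocones\<close>

lemma restrict_dom_cocone_id:
  assumes "oplax_cocone I C F B q"
  shows "restrict_cocone I IdSq (dom_cocone I \<Sigma> q) = q"
  by (rule cocone_eqI[where X = "Obj I" and Y = "Arr I"])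
    (use assms two_functor.F_typing[OF IdSq_functor] in
      \<open>auto simp: dom_cocone_def oplax_cocone_iff IdSq_def Dom_def typing\<close>)

text \<open>The extra factor in each leg is F of an identity 1-cell, hence an identity, and the
  filler of an identity square is an identity 2-cell. Both vanish by strictness.\<close>

lemma restrict_cod_cocone_id:
  assumes "oplax_cocone I C F B q"
  shows "restrict_cocone I IdSq (cod_cocone C I \<Sigma> F q) = q"
  by (rule cocone_eqI[where X = "Obj I" and Y = "Arr I"])
    (use assms two_functor.F_typing[OF IdSq_functor] F.cocone_typing[OF assms] in
      \<open>auto simp: cod_cocone_eq oplax_cocone_iff IdSq_def Cod_def typing F.C.calc F.F1_id F.F2_id F.F_typing\<close>)

text \<open>Edges p_0 and p_1 start at the same vertex, where a 1-cell of triangles has the single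
  component \<open>tr_0\<close>. This is the source of \<theta>01.\<close>

lemma restrict_dom_cocone_p1:
  "restrict_cocone (Sigma3 I \<Sigma>) P1 (dom_cocone I \<Sigma> q) = restrict_cocone (Sigma3 I \<Sigma>) P0 (dom_cocone I \<Sigma> q)"
  by (rule cocone_eqI[where X = "tri_objs I \<Sigma>" and Y = "tri_arrs I \<Sigma>"])
    (auto simp: restrict_cocone_def dom_cocone_def P0_def P1_def Dom_def tri_objs_iff tri_arrs_iff)

text \<open>Both legs are \<open>q\<close> at the middle vertex, which is the end of p_0 and the
  start of p_2, composed with F of p_0. This is the source of \<theta>02.\<close>

lemma p2_dom_cocone:
  "p2_cocone C I \<Sigma> F (dom_cocone I \<Sigma> q) = restrict_cocone (Sigma3 I \<Sigma>) P0 (cod_cocone C I \<Sigma> F q)"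
  by (rule cocone_eqI[where X = "tri_objs I \<Sigma>" and Y = "tri_arrs I \<Sigma>"])
    (auto simp: restrict_cocone_def dom_cocone_def p2_cocone_def cod_cocone_def P0_def Dom_def
      tri_objs_iff tri_arrs_iff)

text \<open>The legs at a triangle are \<open>q\<close> at the last vertex after F of the path p_2
  p_0 and after F of the edge p_1; the filler connects the two. Compatibility with a 1-cell is F
  applied to the triangle condition, once the transition of \<open>q\<close> has been slid past the
  image of the filler.\<close>

lemma iso_modif_fill:
  assumes q: "oplax_cocone I C F B q"
  shows "iso_modif (Sigma3 I \<Sigma>) C D2 (p2_cocone C I \<Sigma> F (cod_cocone C I \<Sigma> F q))
    (restrict_cocone (Sigma3 I \<Sigma>) P1 (cod_cocone C I \<Sigma> F q))
    (\<lambda>\<phi>. leg q (tgt1 I (tri_p2 \<phi>)) \<lhd>\<^bsub>C\<^esub> F2 F (tri_fill \<phi>))"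
    (is "iso_modif _ _ _ ?k ?k' ?m")
proof -
  note F_t = F.F_typing F.cocone_typing[OF q]
  have "?m x \<in> inv_hom2 C (leg ?k x) (leg ?k' x)" if x: "x \<in> tri_objs I \<Sigma>" for x
  proof -
    note t = tri_objs_typing[OF x] x[unfolded tri_objs_iff]
    have "F2 F (tri_fill x) \<in> inv_hom2 C (F1 F (tri_p2 x \<odot> tri_p0 x)) (F1 F (tri_p1 x))"
      using t F.F2_inv_hom2 by blast
    then have "?m x \<in> inv_hom2 C (leg q (tgt1 I (tri_p2 x)) \<odot>\<^bsub>C\<^esub> F1 F (tri_p2 x \<odot> tri_p0 x))
        (leg q (tgt1 I (tri_p2 x)) \<odot>\<^bsub>C\<^esub> F1 F (tri_p1 x))"
      by (rule F.C.inv_hom2_whisker) (use t in \<open>simp_all add: F_t typing\<close>)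
    then show ?thesis
      using x t by (simp add: p2_cocone_def cod_cocone_def restrict_cocone_def P1_def F.F1_comp'
          F.C.comp1_right_assoc F_t typing)
  qed
  moreover have "?m (tr_src u) \<bullet>\<^bsub>C\<^esub> trans ?k u = trans ?k' u \<bullet>\<^bsub>C\<^esub> (?m (tr_tgt u) \<rhd>\<^bsub>C\<^esub> F1 D2 u)"
    if u: "u \<in> tri_arrs I \<Sigma>" for u
  proof -
    define x y where "x = tr_src u" and "y = tr_tgt u"
    have xy: "tr_src u = x" "tr_tgt u = y" by (simp_all add: x_def y_def)
    have o: "x \<in> tri_objs I \<Sigma>" "y \<in> tri_objs I \<Sigma>" using u xy by (auto simp: tri_arrs_iff)
    define lx ly where "lx = leg q (tgt1 I (tri_p2 x))" and "ly = leg q (tgt1 I (tri_p2 y))"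
    note t = tri_arrs_typing[OF u, unfolded xy] tri_objs_typing[OF o(1)] tri_objs_typing[OF o(2)] o[unfolded tri_objs_iff]
    have l: "lx \<in> Arr C" "src1 C lx = F0 F (tgt1 I (tri_p2 x))" "tgt1 C lx = B"
      "ly \<in> Arr C" "src1 C ly = F0 F (tgt1 I (tri_p2 y))" "tgt1 C ly = B"
      using t by (auto simp: lx_def ly_def F_t typing)
    have Q: "trans q (tr_2 u) \<in> Cell C" "src2 C (trans q (tr_2 u)) = ly \<odot>\<^bsub>C\<^esub> F1 F (tr_2 u)"
      "tgt2 C (trans q (tr_2 u)) = lx"
      using t by (auto simp: lx_def ly_def F_t typing)
    note ts = l Q F.F_typing typing F.C.calc F.F1_comp' t
    \<comment> \<open>The image under F of the condition that makes \<open>u\<close> a 1-cell of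
      \<open>Sigma3\<close>.\<close>
    have tri: "F2 F (tr_fill1 u) \<bullet>\<^bsub>C\<^esub> (F2 F (tri_fill y) \<rhd>\<^bsub>C\<^esub> F1 F (tr_0 u)) =
      (F1 F (tr_2 u) \<lhd>\<^bsub>C\<^esub> F2 F (tri_fill x)) \<bullet>\<^bsub>C\<^esub> (F2 F (tr_fill2 u) \<rhd>\<^bsub>C\<^esub> F1 F (tri_p0 x)) \<bullet>\<^bsub>C\<^esub>
      (F1 F (tri_p2 y) \<lhd>\<^bsub>C\<^esub> F2 F (tr_fill0 u))"
    proof -
      have "tr_fill1 u \<bullet> (tri_fill y \<rhd> tr_0 u) =
        (tr_2 u \<lhd> tri_fill x) \<bullet> (tr_fill2 u \<rhd> tri_p0 x) \<bullet> (tri_p2 y \<lhd> tr_fill0 u)"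
        using u by (simp add: tri_arrs_iff xy)
      then have "F2 F (tr_fill1 u \<bullet> (tri_fill y \<rhd> tr_0 u)) =
        F2 F ((tr_2 u \<lhd> tri_fill x) \<bullet> (tr_fill2 u \<rhd> tri_p0 x) \<bullet> (tri_p2 y \<lhd> tr_fill0 u))"
        by simp
      then show ?thesis
        using t by (simp add: F.F2_vcomp' F.F2_whisker typing comp1_right_assoc)
    qed
    have "?m x \<bullet>\<^bsub>C\<^esub> trans ?k u = (lx \<lhd>\<^bsub>C\<^esub> F2 F (tri_fill x)) \<bullet>\<^bsub>C\<^esub>
        (trans q (tr_2 u) \<rhd>\<^bsub>C\<^esub> F1 F (tri_p2 x) \<odot>\<^bsub>C\<^esub> F1 F (tri_p0 x)) \<bullet>\<^bsub>C\<^esub>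
        (ly \<lhd>\<^bsub>C\<^esub> (F2 F (tr_fill2 u) \<rhd>\<^bsub>C\<^esub> F1 F (tri_p0 x))) \<bullet>\<^bsub>C\<^esub>
        ((ly \<odot>\<^bsub>C\<^esub> F1 F (tri_p2 y)) \<lhd>\<^bsub>C\<^esub> F2 F (tr_fill0 u))"
      using u o u[unfolded tri_arrs_iff] by (simp add: p2_cocone_def cod_cocone_def xy ts flip: lx_def ly_def)
    \<comment> \<open>The transition at \<open>tr_2 u\<close> and the filler of \<open>x\<close> act
      on different factors; their interchange brings the filler next to the other cells of the
      triangle condition.\<close>
    also have "\<dots> = (trans q (tr_2 u) \<rhd>\<^bsub>C\<^esub> F1 F (tri_p1 x)) \<bullet>\<^bsub>C\<^esub> ((ly \<odot>\<^bsub>C\<^esub> F1 F (tr_2 u)) \<lhd>\<^bsub>C\<^esub> F2 F (tri_fill x)) \<bullet>\<^bsub>C\<^esub>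
        (ly \<lhd>\<^bsub>C\<^esub> (F2 F (tr_fill2 u) \<rhd>\<^bsub>C\<^esub> F1 F (tri_p0 x))) \<bullet>\<^bsub>C\<^esub>
        ((ly \<odot>\<^bsub>C\<^esub> F1 F (tri_p2 y)) \<lhd>\<^bsub>C\<^esub> F2 F (tr_fill0 u))"
      by (rule F.C.vcomp_subst, rule F.C.exchange[symmetric]) (simp_all add: ts)
    also have "\<dots> = (trans q (tr_2 u) \<rhd>\<^bsub>C\<^esub> F1 F (tri_p1 x)) \<bullet>\<^bsub>C\<^esub>
        (ly \<lhd>\<^bsub>C\<^esub> (F2 F (tr_fill1 u) \<bullet>\<^bsub>C\<^esub> (F2 F (tri_fill y) \<rhd>\<^bsub>C\<^esub> F1 F (tr_0 u))))"
      unfolding tri by (simp add: ts)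
    also have "\<dots> = trans ?k' u \<bullet>\<^bsub>C\<^esub> (?m y \<rhd>\<^bsub>C\<^esub> F1 D2 u)"
      using u o u[unfolded tri_arrs_iff]
      by (simp add: cod_cocone_def restrict_cocone_def P1_def P0_def Dom_def comp_twofun_def xy ts flip: lx_def ly_def)
    finally show ?thesis by (simp add: xy)
  qed
  ultimately show ?thesis
    by (simp add: iso_modif_def)
qed

end

text \<open>Each side of a face identity is compared with the same cocone \<open>c'\<close>, and the
  two comparisons form the cospan to be lifted. The brackets are then moved to the form of the
  equations in the theorem.\<close>

lemma (in two_functor) bicolimit_lift_face:
  assumes s: "oplax_bicolimit J C D L s" and c': "oplax_cocone J C D B c'"
    and h: "induced J C D L s M c h \<pi>" and d: "d \<in> hom1 C M B" and \<delta>: "iso_modif J C D (postcomp J C c d) c' \<delta>"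
    and k: "induced J C D L s N e k \<rho>" and d': "d' \<in> hom1 C N B" and \<epsilon>: "iso_modif J C D (postcomp J C e d') c' \<epsilon>"
  obtains \<theta> where "\<theta> \<in> inv_hom2 C (d \<odot>\<^bsub>C\<^esub> h) (d' \<odot>\<^bsub>C\<^esub> k)"
    "\<And>x. x \<in> Obj J \<Longrightarrow> \<epsilon> x \<bullet>\<^bsub>C\<^esub> (d' \<lhd>\<^bsub>C\<^esub> \<rho> x) \<bullet>\<^bsub>C\<^esub> (\<theta> \<rhd>\<^bsub>C\<^esub> leg s x) = \<delta> x \<bullet>\<^bsub>C\<^esub> (d \<lhd>\<^bsub>C\<^esub> \<pi> x)"
proof -
  have s': "oplax_cocone J C D L s" using s by (simp add: oplax_bicolimit_def)
  note ih = inducedD[OF h] and ik = inducedD[OF k]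
  have hom: "d \<odot>\<^bsub>C\<^esub> h \<in> hom1 C L B" "d' \<odot>\<^bsub>C\<^esub> k \<in> hom1 C L B"
    using C.comp1_in ih(1) ik(1) d d' by auto
  obtain \<theta> where \<theta>: "\<theta> \<in> inv_hom2 C (d \<odot>\<^bsub>C\<^esub> h) (d' \<odot>\<^bsub>C\<^esub> k)"
    "\<And>x. x \<in> Obj J \<Longrightarrow> (\<epsilon> x \<bullet>\<^bsub>C\<^esub> (d' \<lhd>\<^bsub>C\<^esub> \<rho> x)) \<bullet>\<^bsub>C\<^esub> (\<theta> \<rhd>\<^bsub>C\<^esub> leg s x) = \<delta> x \<bullet>\<^bsub>C\<^esub> (d \<lhd>\<^bsub>C\<^esub> \<pi> x)"
    by (rule bicolimit_lift_cospan[OF s hom c' iso_modif_induced_comp[OF h s' d c' \<delta>]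
          iso_modif_induced_comp[OF k s' d' c' \<epsilon>]], rule that)
  have "(\<epsilon> x \<bullet>\<^bsub>C\<^esub> (d' \<lhd>\<^bsub>C\<^esub> \<rho> x)) \<bullet>\<^bsub>C\<^esub> (\<theta> \<rhd>\<^bsub>C\<^esub> leg s x) =
      \<epsilon> x \<bullet>\<^bsub>C\<^esub> (d' \<lhd>\<^bsub>C\<^esub> \<rho> x) \<bullet>\<^bsub>C\<^esub> (\<theta> \<rhd>\<^bsub>C\<^esub> leg s x)" if x: "x \<in> Obj J" for x
    by (rule C.vcomp_right_assoc)
      (use x d'[unfolded C.hom1_iff] ik(1)[unfolded C.hom1_iff] in \<open>simp_all add: C.calc F_typing C.inv_hom2_typing[OF \<theta>(1)]
        cocone_typing[OF s'] cocone_typing[OF ik(3)] iso_modif_typing[OF \<epsilon>] iso_modif_typing[OF ik(4)] hom[unfolded C.hom1_iff]\<close>)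
  with \<theta> show ?thesis using that[OF \<theta>(1)] by simp
qed

context sigma_diagram
begin

lemma oplax_cocone_p2_cocone:
  "oplax_cocone (Sigma2 I \<Sigma>) C D1 B r \<Longrightarrow> oplax_cocone (Sigma3 I \<Sigma>) C D2 B (p2_cocone C I \<Sigma> F r)"
  unfolding p2_cocone_eq by (rule p2.oplax_cocone_whisk[OF oplax_cocone_p2])

lemma postcomp_p2_cocone:
  assumes "oplax_cocone (Sigma2 I \<Sigma>) C D1 B r" "h \<in> hom1 C B B'"
  shows "postcomp (Sigma3 I \<Sigma>) C (p2_cocone C I \<Sigma> F r) h = p2_cocone C I \<Sigma> F (postcomp (Sigma2 I \<Sigma>) C r h)"
  using p2.postcomp_whisk_cocone[OF oplax_cocone_p2[OF assms(1)] assms(2)]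
    postcomp_restrict_cocone[OF two_functor_P2, of C r h]
  by (simp add: p2_cocone_eq)

end

locale sigma_bicolimits = sigma_diagram I \<Sigma> C F
  for I :: "('i, 'j, 'k) twocat" (structure) and \<Sigma> :: "'j set"
    and C :: "('o, 'a, 'c) twocat" and F :: "('i, 'j, 'k, 'o, 'a, 'c) twofun" +
  fixes L0 L1 L2 q r s
  assumes q: "oplax_bicolimit I C F L0 q"
    and r: "oplax_bicolimit (Sigma2 I \<Sigma>) C D1 L1 r"
    and s: "oplax_bicolimit (Sigma3 I \<Sigma>) C D2 L2 s"
begin

lemma bicolimit_cocones:
  "oplax_cocone I C F L0 q" "oplax_cocone (Sigma2 I \<Sigma>) C D1 L1 r" "oplax_cocone (Sigma3 I \<Sigma>) C D2 L2 s"
  and bicolimit_objects: "L0 \<in> Obj C" "L1 \<in> Obj C" "L2 \<in> Obj C"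
  using q r s by (auto simp: oplax_bicolimit_def)

lemma induced_exist:
  "\<exists>d0 \<delta>0. induced (Sigma2 I \<Sigma>) C D1 L1 r L0 (dom_cocone I \<Sigma> q) d0 \<delta>0"
  "\<exists>d1 \<delta>1. induced (Sigma2 I \<Sigma>) C D1 L1 r L0 (cod_cocone C I \<Sigma> F q) d1 \<delta>1"
  "\<exists>i \<iota>. induced I C F L0 q L1 (id_cocone I r) i \<iota>"
  "\<exists>p0 \<pi>0. induced (Sigma3 I \<Sigma>) C D2 L2 s L1 (p0_cocone I \<Sigma> r) p0 \<pi>0"
  "\<exists>p1 \<pi>1. induced (Sigma3 I \<Sigma>) C D2 L2 s L1 (p1_cocone I \<Sigma> r) p1 \<pi>1"
  "\<exists>p2 \<pi>2. induced (Sigma3 I \<Sigma>) C D2 L2 s L1 (p2_cocone C I \<Sigma> F r) p2 \<pi>2"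
  unfolding id_cocone_eq p0_cocone_def p1_cocone_def
  by (intro F.bicolimit_induced[OF q] D1.bicolimit_induced[OF r] D2.bicolimit_induced[OF s]
      bicolimit_objects oplax_cocone_dom oplax_cocone_cod oplax_cocone_id oplax_cocone_p0
      oplax_cocone_p1 oplax_cocone_p2_cocone bicolimit_cocones)+

text \<open>Over identity squares the cocone that induces \<open>d\<close> becomes \<open>q\<close>,
  which is its own postcomposite with the identity. Comparing \<open>d\<close> after
  \<open>i\<close> with the identity is thus a modification between two postcomposites of
  \<open>q\<close>. The variable \<open>c\<close> covers both d_0 and d_1.\<close>

lemma unit_cell:
  assumes d: "induced (Sigma2 I \<Sigma>) C D1 L1 r L0 c d \<delta>" and c: "restrict_cocone I IdSq c = q"
    and i: "induced I C F L0 q L1 (id_cocone I r) i \<iota>"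
  obtains n where "n \<in> inv_hom2 C (d \<odot>\<^bsub>C\<^esub> i) (id1 C L0)"
    "\<forall>x \<in> Obj I. n \<rhd>\<^bsub>C\<^esub> leg q x = \<delta> (id1 I x) \<bullet>\<^bsub>C\<^esub> (d \<lhd>\<^bsub>C\<^esub> \<iota> x)"
proof -
  note id = D1.inducedD[OF d] and ii = F.inducedD[OF i]
  have "iso_modif I C F (postcomp I C (id_cocone I r) d) q (\<lambda>x. \<delta> (id1 I x))"
    using iso_modif_id[OF id(4)] c postcomp_restrict_cocone[OF IdSq_functor, of C r d]
    by (simp add: id_cocone_eq)
  from F.iso_modif_induced_comp[OF i bicolimit_cocones(1) id(1) bicolimit_cocones(1) this]
  have "iso_modif I C F (postcomp I C q (d \<odot>\<^bsub>C\<^esub> i)) (postcomp I C q (id1 C L0))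
      (\<lambda>x. \<delta> (id1 I x) \<bullet>\<^bsub>C\<^esub> (d \<lhd>\<^bsub>C\<^esub> \<iota> x))"
    by (simp only: postcomp_id1[OF F.two_functor_axioms bicolimit_cocones(1)])
  from F.bicolimit_lift_cell[OF q F.C.comp1_in[OF ii(1) id(1)] F.C.id1_in[OF bicolimit_objects(1)] this]
  obtain n where "n \<in> inv_hom2 C (d \<odot>\<^bsub>C\<^esub> i) (id1 C L0)"
    "\<And>x. x \<in> Obj I \<Longrightarrow> n \<rhd>\<^bsub>C\<^esub> leg q x = \<delta> (id1 I x) \<bullet>\<^bsub>C\<^esub> (d \<lhd>\<^bsub>C\<^esub> \<iota> x)"
    by metis
  then show ?thesis
    using that[of n] by simp
qed

text \<open>The common cocones sit at the three vertices of a triangle: \<open>q\<close> at the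
  first vertex for \<theta>01, \<open>q\<close> at the middle vertex after F of p_0 for \<theta>02,
  and \<open>q\<close> at the last vertex after F of p_1 for \<theta>12.\<close>

lemma face_cells:
  assumes d0: "induced (Sigma2 I \<Sigma>) C D1 L1 r L0 (dom_cocone I \<Sigma> q) d0 \<delta>0"
    and d1: "induced (Sigma2 I \<Sigma>) C D1 L1 r L0 (cod_cocone C I \<Sigma> F q) d1 \<delta>1"
    and p0: "induced (Sigma3 I \<Sigma>) C D2 L2 s L1 (p0_cocone I \<Sigma> r) p0 \<pi>0"
    and p1: "induced (Sigma3 I \<Sigma>) C D2 L2 s L1 (p1_cocone I \<Sigma> r) p1 \<pi>1"
    and p2: "induced (Sigma3 I \<Sigma>) C D2 L2 s L1 (p2_cocone C I \<Sigma> F r) p2 \<pi>2"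
  obtains \<theta>01 \<theta>02 \<theta>12 where
    "\<theta>01 \<in> inv_hom2 C (d0 \<odot>\<^bsub>C\<^esub> p0) (d0 \<odot>\<^bsub>C\<^esub> p1)"
    "\<theta>02 \<in> inv_hom2 C (d1 \<odot>\<^bsub>C\<^esub> p0) (d0 \<odot>\<^bsub>C\<^esub> p2)"
    "\<theta>12 \<in> inv_hom2 C (d1 \<odot>\<^bsub>C\<^esub> p1) (d1 \<odot>\<^bsub>C\<^esub> p2)"
    "\<forall>\<phi> \<in> Obj (Sigma3 I \<Sigma>). \<delta>0 (tri_p1 \<phi>) \<bullet>\<^bsub>C\<^esub> (d0 \<lhd>\<^bsub>C\<^esub> \<pi>1 \<phi>) \<bullet>\<^bsub>C\<^esub> (\<theta>01 \<rhd>\<^bsub>C\<^esub> leg s \<phi>) =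
      \<delta>0 (tri_p0 \<phi>) \<bullet>\<^bsub>C\<^esub> (d0 \<lhd>\<^bsub>C\<^esub> \<pi>0 \<phi>)"
    "\<forall>\<phi> \<in> Obj (Sigma3 I \<Sigma>). (\<delta>0 (tri_p2 \<phi>) \<rhd>\<^bsub>C\<^esub> F1 F (tri_p0 \<phi>)) \<bullet>\<^bsub>C\<^esub> (d0 \<lhd>\<^bsub>C\<^esub> \<pi>2 \<phi>) \<bullet>\<^bsub>C\<^esub>
      (\<theta>02 \<rhd>\<^bsub>C\<^esub> leg s \<phi>) = \<delta>1 (tri_p0 \<phi>) \<bullet>\<^bsub>C\<^esub> (d1 \<lhd>\<^bsub>C\<^esub> \<pi>0 \<phi>)"
    "\<forall>\<phi> \<in> Obj (Sigma3 I \<Sigma>). (leg q (tgt1 I (tri_p2 \<phi>)) \<lhd>\<^bsub>C\<^esub> F2 F (tri_fill \<phi>)) \<bullet>\<^bsub>C\<^esub>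
      (\<delta>1 (tri_p2 \<phi>) \<rhd>\<^bsub>C\<^esub> F1 F (tri_p0 \<phi>)) \<bullet>\<^bsub>C\<^esub> (d1 \<lhd>\<^bsub>C\<^esub> \<pi>2 \<phi>) \<bullet>\<^bsub>C\<^esub> (\<theta>12 \<rhd>\<^bsub>C\<^esub> leg s \<phi>) =
      \<delta>1 (tri_p1 \<phi>) \<bullet>\<^bsub>C\<^esub> (d1 \<lhd>\<^bsub>C\<^esub> \<pi>1 \<phi>)"
proof -
  note i0 = D1.inducedD[OF d0] and i1 = D1.inducedD[OF d1]
  note p0' = p0[unfolded p0_cocone_def] and p1' = p1[unfolded p1_cocone_def]
  note pr = postcomp_restrict_cocone[OF two_functor_P0, of C r] postcomp_restrict_cocone[OF two_functor_P1, of C r]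
    postcomp_p2_cocone[OF bicolimit_cocones(2)]
  let ?dom = "restrict_cocone (Sigma3 I \<Sigma>) P0 (dom_cocone I \<Sigma> q)"
    and ?mid = "restrict_cocone (Sigma3 I \<Sigma>) P0 (cod_cocone C I \<Sigma> F q)"
    and ?cod = "restrict_cocone (Sigma3 I \<Sigma>) P1 (cod_cocone C I \<Sigma> F q)"
  have c: "oplax_cocone (Sigma3 I \<Sigma>) C D2 L0 ?dom" "oplax_cocone (Sigma3 I \<Sigma>) C D2 L0 ?mid"
    "oplax_cocone (Sigma3 I \<Sigma>) C D2 L0 ?cod"
    by (intro oplax_cocone_p0 oplax_cocone_p1 i0(3) i1(3))+
  \<comment> \<open>In \<open>m00\<close> to \<open>m12\<close> the two digits name the composite
    that is compared with its common cocone: \<open>m02\<close> belongs to \<open>d0\<close> after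
    \<open>p2\<close>.\<close>
  have m00: "iso_modif (Sigma3 I \<Sigma>) C D2 (postcomp (Sigma3 I \<Sigma>) C (restrict_cocone (Sigma3 I \<Sigma>) P0 r) d0) ?dom
      (\<lambda>\<phi>. \<delta>0 (tri_p0 \<phi>))"
    using iso_modif_p0[OF i0(4)] by (simp only: pr)
  have m01: "iso_modif (Sigma3 I \<Sigma>) C D2 (postcomp (Sigma3 I \<Sigma>) C (restrict_cocone (Sigma3 I \<Sigma>) P1 r) d0) ?dom
      (\<lambda>\<phi>. \<delta>0 (tri_p1 \<phi>))"
    using iso_modif_p1[OF i0(4)] by (simp only: pr restrict_dom_cocone_p1)
  have m02: "iso_modif (Sigma3 I \<Sigma>) C D2 (postcomp (Sigma3 I \<Sigma>) C (p2_cocone C I \<Sigma> F r) d0) ?mid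
      (\<lambda>\<phi>. \<delta>0 (tri_p2 \<phi>) \<rhd>\<^bsub>C\<^esub> F1 F (tri_p0 \<phi>))"
    using iso_modif_p2[OF i0(2,3,4)] by (simp only: pr(3)[OF i0(1)] p2_dom_cocone)
  have m10: "iso_modif (Sigma3 I \<Sigma>) C D2 (postcomp (Sigma3 I \<Sigma>) C (restrict_cocone (Sigma3 I \<Sigma>) P0 r) d1) ?mid
      (\<lambda>\<phi>. \<delta>1 (tri_p0 \<phi>))"
    using iso_modif_p0[OF i1(4)] by (simp only: pr)
  have m11: "iso_modif (Sigma3 I \<Sigma>) C D2 (postcomp (Sigma3 I \<Sigma>) C (restrict_cocone (Sigma3 I \<Sigma>) P1 r) d1) ?cod
      (\<lambda>\<phi>. \<delta>1 (tri_p1 \<phi>))"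
    using iso_modif_p1[OF i1(4)] by (simp only: pr)
  note fill = iso_modif_fill[OF bicolimit_cocones(1)]
  \<comment> \<open>This comparison ends at the path p_2 p_0 instead of the edge p_1;
    \<open>fill\<close> supplies the remaining passage to \<open>?cod\<close>.\<close>
  have m12': "iso_modif (Sigma3 I \<Sigma>) C D2 (postcomp (Sigma3 I \<Sigma>) C (p2_cocone C I \<Sigma> F r) d1)
      (p2_cocone C I \<Sigma> F (cod_cocone C I \<Sigma> F q)) (\<lambda>\<phi>. \<delta>1 (tri_p2 \<phi>) \<rhd>\<^bsub>C\<^esub> F1 F (tri_p0 \<phi>))"
    using iso_modif_p2[OF i1(2,3,4)] by (simp only: pr(3)[OF i1(1)])
  have m12: "iso_modif (Sigma3 I \<Sigma>) C D2 (postcomp (Sigma3 I \<Sigma>) C (p2_cocone C I \<Sigma> F r) d1) ?cod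
      (\<lambda>\<phi>. (leg q (tgt1 I (tri_p2 \<phi>)) \<lhd>\<^bsub>C\<^esub> F2 F (tri_fill \<phi>)) \<bullet>\<^bsub>C\<^esub> (\<delta>1 (tri_p2 \<phi>) \<rhd>\<^bsub>C\<^esub> F1 F (tri_p0 \<phi>)))"
    by (rule D2.iso_modif_comp[OF _ _ c(3) m12' fill])
      (intro D2.oplax_cocone_postcomp[OF _ i1(1)] oplax_cocone_p2_cocone bicolimit_cocones i1(3))+
  obtain \<theta>01 where \<theta>01: "\<theta>01 \<in> inv_hom2 C (d0 \<odot>\<^bsub>C\<^esub> p0) (d0 \<odot>\<^bsub>C\<^esub> p1)"
    "\<And>\<phi>. \<phi> \<in> Obj (Sigma3 I \<Sigma>) \<Longrightarrow> \<delta>0 (tri_p1 \<phi>) \<bullet>\<^bsub>C\<^esub> (d0 \<lhd>\<^bsub>C\<^esub> \<pi>1 \<phi>) \<bullet>\<^bsub>C\<^esub> (\<theta>01 \<rhd>\<^bsub>C\<^esub> leg s \<phi>) =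
      \<delta>0 (tri_p0 \<phi>) \<bullet>\<^bsub>C\<^esub> (d0 \<lhd>\<^bsub>C\<^esub> \<pi>0 \<phi>)"
    by (rule D2.bicolimit_lift_face[OF s c(1) p0' i0(1) m00 p1' i0(1) m01], rule that)
  obtain \<theta>02 where \<theta>02: "\<theta>02 \<in> inv_hom2 C (d1 \<odot>\<^bsub>C\<^esub> p0) (d0 \<odot>\<^bsub>C\<^esub> p2)"
    "\<And>\<phi>. \<phi> \<in> Obj (Sigma3 I \<Sigma>) \<Longrightarrow> (\<delta>0 (tri_p2 \<phi>) \<rhd>\<^bsub>C\<^esub> F1 F (tri_p0 \<phi>)) \<bullet>\<^bsub>C\<^esub> (d0 \<lhd>\<^bsub>C\<^esub> \<pi>2 \<phi>) \<bullet>\<^bsub>C\<^esub>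
      (\<theta>02 \<rhd>\<^bsub>C\<^esub> leg s \<phi>) = \<delta>1 (tri_p0 \<phi>) \<bullet>\<^bsub>C\<^esub> (d1 \<lhd>\<^bsub>C\<^esub> \<pi>0 \<phi>)"
    by (rule D2.bicolimit_lift_face[OF s c(2) p0' i1(1) m10 p2 i0(1) m02], rule that)
  obtain \<theta>12 where \<theta>12: "\<theta>12 \<in> inv_hom2 C (d1 \<odot>\<^bsub>C\<^esub> p1) (d1 \<odot>\<^bsub>C\<^esub> p2)"
    "\<And>\<phi>. \<phi> \<in> Obj (Sigma3 I \<Sigma>) \<Longrightarrow>
      ((leg q (tgt1 I (tri_p2 \<phi>)) \<lhd>\<^bsub>C\<^esub> F2 F (tri_fill \<phi>)) \<bullet>\<^bsub>C\<^esub> (\<delta>1 (tri_p2 \<phi>) \<rhd>\<^bsub>C\<^esub> F1 F (tri_p0 \<phi>))) \<bullet>\<^bsub>C\<^esub>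
      (d1 \<lhd>\<^bsub>C\<^esub> \<pi>2 \<phi>) \<bullet>\<^bsub>C\<^esub> (\<theta>12 \<rhd>\<^bsub>C\<^esub> leg s \<phi>) = \<delta>1 (tri_p1 \<phi>) \<bullet>\<^bsub>C\<^esub> (d1 \<lhd>\<^bsub>C\<^esub> \<pi>1 \<phi>)"
    by (rule D2.bicolimit_lift_face[OF s c(3) p1' i1(1) m11 p2 i1(1) m12], rule that)
  \<comment> \<open>The comparison for \<open>d1\<close> after \<open>p2\<close> is itself a
    composite, so one more change of brackets leads to the stated form.\<close>
  have "((leg q (tgt1 I (tri_p2 \<phi>)) \<lhd>\<^bsub>C\<^esub> F2 F (tri_fill \<phi>)) \<bullet>\<^bsub>C\<^esub> (\<delta>1 (tri_p2 \<phi>) \<rhd>\<^bsub>C\<^esub> F1 F (tri_p0 \<phi>))) \<bullet>\<^bsub>C\<^esub>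
      (d1 \<lhd>\<^bsub>C\<^esub> \<pi>2 \<phi>) \<bullet>\<^bsub>C\<^esub> (\<theta>12 \<rhd>\<^bsub>C\<^esub> leg s \<phi>) =
      (leg q (tgt1 I (tri_p2 \<phi>)) \<lhd>\<^bsub>C\<^esub> F2 F (tri_fill \<phi>)) \<bullet>\<^bsub>C\<^esub> (\<delta>1 (tri_p2 \<phi>) \<rhd>\<^bsub>C\<^esub> F1 F (tri_p0 \<phi>)) \<bullet>\<^bsub>C\<^esub>
      (d1 \<lhd>\<^bsub>C\<^esub> \<pi>2 \<phi>) \<bullet>\<^bsub>C\<^esub> (\<theta>12 \<rhd>\<^bsub>C\<^esub> leg s \<phi>)" if \<phi>: "\<phi> \<in> Obj (Sigma3 I \<Sigma>)" for \<phi>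
  proof -
    note i2 = D2.inducedD[OF p2]
    note t = i1(1)[unfolded F.C.hom1_iff] i2(1)[unfolded F.C.hom1_iff] D2.cocone_typing(1-3)[OF bicolimit_cocones(3) \<phi>]
      D2.cocone_typing(1-3)[OF i2(3) \<phi>] D2.iso_modif_typing[OF i2(4) \<phi>] F.C.inv_hom2_typing[OF \<theta>12(1)]
      postcomp_simps(1)[OF \<phi>]
    \<comment> \<open>The objects, sources and targets of \<open>Sigma3 I \<Sigma>\<close> are kept
      folded here so that the typing facts, stated in terms of them, still match.\<close>
    have e: "(d1 \<lhd>\<^bsub>C\<^esub> \<pi>2 \<phi>) \<bullet>\<^bsub>C\<^esub> (\<theta>12 \<rhd>\<^bsub>C\<^esub> leg s \<phi>) \<in> Cell C"
      "tgt2 C ((d1 \<lhd>\<^bsub>C\<^esub> \<pi>2 \<phi>) \<bullet>\<^bsub>C\<^esub> (\<theta>12 \<rhd>\<^bsub>C\<^esub> leg s \<phi>)) = d1 \<odot>\<^bsub>C\<^esub> leg (p2_cocone C I \<Sigma> F r) \<phi>"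
      using D2.inducedD(1)[OF p1, unfolded F.C.hom1_iff] by (simp_all del: Sigma3_simps add: F.C.calc t)
    show ?thesis
      by (rule F.C.vcomp_right_assoc)
        (use e \<phi> in \<open>simp_all del: Sigma3_simps add: D2.iso_modif_typing[OF fill] D2.iso_modif_typing[OF m12']\<close>)
  qed
  with \<theta>12(2) have "\<And>\<phi>. \<phi> \<in> Obj (Sigma3 I \<Sigma>) \<Longrightarrow> (leg q (tgt1 I (tri_p2 \<phi>)) \<lhd>\<^bsub>C\<^esub> F2 F (tri_fill \<phi>)) \<bullet>\<^bsub>C\<^esub>
      (\<delta>1 (tri_p2 \<phi>) \<rhd>\<^bsub>C\<^esub> F1 F (tri_p0 \<phi>)) \<bullet>\<^bsub>C\<^esub> (d1 \<lhd>\<^bsub>C\<^esub> \<pi>2 \<phi>) \<bullet>\<^bsub>C\<^esub> (\<theta>12 \<rhd>\<^bsub>C\<^esub> leg s \<phi>) =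
      \<delta>1 (tri_p1 \<phi>) \<bullet>\<^bsub>C\<^esub> (d1 \<lhd>\<^bsub>C\<^esub> \<pi>1 \<phi>)"
    by (simp only:)
  then show ?thesis
    by (intro that[OF \<theta>01(1) \<theta>02(1) \<theta>12(1)] ballI \<theta>01(2) \<theta>02(2))
qed

end

theorem lemma1p15:
  fixes C :: "('o, 'a, 'c) twocat"
    and I :: "('i, 'j, 'k) twocat"
    and \<Sigma> :: "'j set"
    and F :: "('i, 'j, 'k, 'o, 'a, 'c) twofun"
  assumes "two_category C"
    and "has_oplax_bicolimits TYPE('i \<times> 'j \<times> 'k) C"
    and "has_oplax_bicolimits TYPE('j \<times> ('j, 'k) sq1 \<times> ('j, 'k) sq2) C"
    and "has_oplax_bicolimits TYPE(('j, 'k) tri \<times> ('j, 'k) tri1 \<times> ('j, 'k) tri2) C"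
    and "two_category I"
    and "\<Sigma> \<subseteq> Arr I"
    and "\<And>x. x \<in> Obj I \<Longrightarrow> id1 I x \<in> \<Sigma>"
    and "\<And>f g. f \<in> \<Sigma> \<Longrightarrow> g \<in> \<Sigma> \<Longrightarrow> src1 I g = tgt1 I f \<Longrightarrow> g \<odot>\<^bsub>I\<^esub> f \<in> \<Sigma>"
    and "two_functor I C F"
  shows
    "(\<exists>L0 q. oplax_bicolimit I C F L0 q) \<and>
     (\<exists>L1 r. oplax_bicolimit (Sigma2 I \<Sigma>) C (F \<circ>\<^sub>2 Dom I) L1 r) \<and>
     (\<exists>L2 s. oplax_bicolimit (Sigma3 I \<Sigma>) C (F \<circ>\<^sub>2 Dom I \<circ>\<^sub>2 P0) L2 s) \<and>
     (\<forall>L0 q L1 r L2 s.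
       oplax_bicolimit I C F L0 q \<longrightarrow>
       oplax_bicolimit (Sigma2 I \<Sigma>) C (F \<circ>\<^sub>2 Dom I) L1 r \<longrightarrow>
       oplax_bicolimit (Sigma3 I \<Sigma>) C (F \<circ>\<^sub>2 Dom I \<circ>\<^sub>2 P0) L2 s \<longrightarrow>
       (\<exists>d0 \<delta>0. induced (Sigma2 I \<Sigma>) C (F \<circ>\<^sub>2 Dom I) L1 r L0 (dom_cocone I \<Sigma> q) d0 \<delta>0) \<and>
       (\<exists>d1 \<delta>1. induced (Sigma2 I \<Sigma>) C (F \<circ>\<^sub>2 Dom I) L1 r L0 (cod_cocone C I \<Sigma> F q) d1 \<delta>1) \<and>
       (\<exists>i \<iota>. induced I C F L0 q L1 (id_cocone I r) i \<iota>) \<and>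
       (\<exists>p0 \<pi>0. induced (Sigma3 I \<Sigma>) C (F \<circ>\<^sub>2 Dom I \<circ>\<^sub>2 P0) L2 s L1 (p0_cocone I \<Sigma> r) p0 \<pi>0) \<and>
       (\<exists>p1 \<pi>1. induced (Sigma3 I \<Sigma>) C (F \<circ>\<^sub>2 Dom I \<circ>\<^sub>2 P0) L2 s L1 (p1_cocone I \<Sigma> r) p1 \<pi>1) \<and>
       (\<exists>p2 \<pi>2. induced (Sigma3 I \<Sigma>) C (F \<circ>\<^sub>2 Dom I \<circ>\<^sub>2 P0) L2 s L1 (p2_cocone C I \<Sigma> F r) p2 \<pi>2) \<and>
       (\<forall>d0 \<delta>0 d1 \<delta>1 i \<iota> p0 \<pi>0 p1 \<pi>1 p2 \<pi>2.
         induced (Sigma2 I \<Sigma>) C (F \<circ>\<^sub>2 Dom I) L1 r L0 (dom_cocone I \<Sigma> q) d0 \<delta>0 \<longrightarrow>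
         induced (Sigma2 I \<Sigma>) C (F \<circ>\<^sub>2 Dom I) L1 r L0 (cod_cocone C I \<Sigma> F q) d1 \<delta>1 \<longrightarrow>
         induced I C F L0 q L1 (id_cocone I r) i \<iota> \<longrightarrow>
         induced (Sigma3 I \<Sigma>) C (F \<circ>\<^sub>2 Dom I \<circ>\<^sub>2 P0) L2 s L1 (p0_cocone I \<Sigma> r) p0 \<pi>0 \<longrightarrow>
         induced (Sigma3 I \<Sigma>) C (F \<circ>\<^sub>2 Dom I \<circ>\<^sub>2 P0) L2 s L1 (p1_cocone I \<Sigma> r) p1 \<pi>1 \<longrightarrow>
         induced (Sigma3 I \<Sigma>) C (F \<circ>\<^sub>2 Dom I \<circ>\<^sub>2 P0) L2 s L1 (p2_cocone C I \<Sigma> F r) p2 \<pi>2 \<longrightarrow>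
         (\<exists>n0 n1 \<theta>01 \<theta>02 \<theta>12.
           codescent_object C
             \<lparr>cd_X0 = L0, cd_X1 = L1, cd_X2 = L2,
              cd_p0 = p0, cd_p1 = p1, cd_p2 = p2, cd_d0 = d0, cd_d1 = d1, cd_i = i,
              cd_n0 = n0, cd_n1 = n1, cd_\<theta>01 = \<theta>01, cd_\<theta>02 = \<theta>02, cd_\<theta>12 = \<theta>12\<rparr> \<and>
           (\<forall>x \<in> Obj I. n0 \<rhd>\<^bsub>C\<^esub> leg q x =
             \<delta>0 (id1 I x) \<bullet>\<^bsub>C\<^esub> (d0 \<lhd>\<^bsub>C\<^esub> \<iota> x)) \<and>
           (\<forall>x \<in> Obj I. n1 \<rhd>\<^bsub>C\<^esub> leg q x =
             \<delta>1 (id1 I x) \<bullet>\<^bsub>C\<^esub> (d1 \<lhd>\<^bsub>C\<^esub> \<iota> x)) \<and>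
           (\<forall>\<phi> \<in> Obj (Sigma3 I \<Sigma>).
             \<delta>0 (tri_p1 \<phi>) \<bullet>\<^bsub>C\<^esub> (d0 \<lhd>\<^bsub>C\<^esub> \<pi>1 \<phi>) \<bullet>\<^bsub>C\<^esub> (\<theta>01 \<rhd>\<^bsub>C\<^esub> leg s \<phi>) =
             \<delta>0 (tri_p0 \<phi>) \<bullet>\<^bsub>C\<^esub> (d0 \<lhd>\<^bsub>C\<^esub> \<pi>0 \<phi>)) \<and>
           (\<forall>\<phi> \<in> Obj (Sigma3 I \<Sigma>).
             (\<delta>0 (tri_p2 \<phi>) \<rhd>\<^bsub>C\<^esub> F1 F (tri_p0 \<phi>)) \<bullet>\<^bsub>C\<^esub> (d0 \<lhd>\<^bsub>C\<^esub> \<pi>2 \<phi>) \<bullet>\<^bsub>C\<^esub> (\<theta>02 \<rhd>\<^bsub>C\<^esub> leg s \<phi>) =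
             \<delta>1 (tri_p0 \<phi>) \<bullet>\<^bsub>C\<^esub> (d1 \<lhd>\<^bsub>C\<^esub> \<pi>0 \<phi>)) \<and>
           (\<forall>\<phi> \<in> Obj (Sigma3 I \<Sigma>).
             (leg q (tgt1 I (tri_p2 \<phi>)) \<lhd>\<^bsub>C\<^esub> F2 F (tri_fill \<phi>)) \<bullet>\<^bsub>C\<^esub>
             (\<delta>1 (tri_p2 \<phi>) \<rhd>\<^bsub>C\<^esub> F1 F (tri_p0 \<phi>)) \<bullet>\<^bsub>C\<^esub> (d1 \<lhd>\<^bsub>C\<^esub> \<pi>2 \<phi>) \<bullet>\<^bsub>C\<^esub> (\<theta>12 \<rhd>\<^bsub>C\<^esub> leg s \<phi>) =
             \<delta>1 (tri_p1 \<phi>) \<bullet>\<^bsub>C\<^esub> (d1 \<lhd>\<^bsub>C\<^esub> \<pi>1 \<phi>)))))"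
proof -
  interpret sigma_diagram I \<Sigma> C F
    by (intro sigma_diagram.intro sigma_two_category.intro sigma_two_category_axioms.intro
        sigma_diagram_axioms.intro assms(5,6,7,9))
  show ?thesis
  proof (intro conjI allI impI)
    show "\<exists>L0 q. oplax_bicolimit I C F L0 q"
      using assms(2,9) unfolding has_oplax_bicolimits_def by blast
    show "\<exists>L1 r. oplax_bicolimit (Sigma2 I \<Sigma>) C (F \<circ>\<^sub>2 Dom I) L1 r"
      using assms(3) D1.two_functor_axioms unfolding has_oplax_bicolimits_def by blast
    show "\<exists>L2 s. oplax_bicolimit (Sigma3 I \<Sigma>) C (F \<circ>\<^sub>2 Dom I \<circ>\<^sub>2 P0) L2 s"
      using assms(4) D2.two_functor_axioms unfolding has_oplax_bicolimits_def by blast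
  next
    fix L0 q L1 r L2 s
    assume bicolimits: "oplax_bicolimit I C F L0 q"
      "oplax_bicolimit (Sigma2 I \<Sigma>) C (F \<circ>\<^sub>2 Dom I) L1 r"
      "oplax_bicolimit (Sigma3 I \<Sigma>) C (F \<circ>\<^sub>2 Dom I \<circ>\<^sub>2 P0) L2 s"
    interpret sigma_bicolimits I \<Sigma> C F L0 L1 L2 q r s
      by unfold_locales (fact bicolimits)+
    show "\<exists>d0 \<delta>0. induced (Sigma2 I \<Sigma>) C (F \<circ>\<^sub>2 Dom I) L1 r L0 (dom_cocone I \<Sigma> q) d0 \<delta>0"
      "\<exists>d1 \<delta>1. induced (Sigma2 I \<Sigma>) C (F \<circ>\<^sub>2 Dom I) L1 r L0 (cod_cocone C I \<Sigma> F q) d1 \<delta>1"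
      "\<exists>i \<iota>. induced I C F L0 q L1 (id_cocone I r) i \<iota>"
      "\<exists>p0 \<pi>0. induced (Sigma3 I \<Sigma>) C (F \<circ>\<^sub>2 Dom I \<circ>\<^sub>2 P0) L2 s L1 (p0_cocone I \<Sigma> r) p0 \<pi>0"
      "\<exists>p1 \<pi>1. induced (Sigma3 I \<Sigma>) C (F \<circ>\<^sub>2 Dom I \<circ>\<^sub>2 P0) L2 s L1 (p1_cocone I \<Sigma> r) p1 \<pi>1"
      "\<exists>p2 \<pi>2. induced (Sigma3 I \<Sigma>) C (F \<circ>\<^sub>2 Dom I \<circ>\<^sub>2 P0) L2 s L1 (p2_cocone C I \<Sigma> F r) p2 \<pi>2"
      by (fact induced_exist)+
    fix d0 \<delta>0 d1 \<delta>1 i \<iota> p0 \<pi>0 p1 \<pi>1 p2 \<pi>2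
    assume ind:
      "induced (Sigma2 I \<Sigma>) C (F \<circ>\<^sub>2 Dom I) L1 r L0 (dom_cocone I \<Sigma> q) d0 \<delta>0"
      "induced (Sigma2 I \<Sigma>) C (F \<circ>\<^sub>2 Dom I) L1 r L0 (cod_cocone C I \<Sigma> F q) d1 \<delta>1"
      "induced I C F L0 q L1 (id_cocone I r) i \<iota>"
      "induced (Sigma3 I \<Sigma>) C (F \<circ>\<^sub>2 Dom I \<circ>\<^sub>2 P0) L2 s L1 (p0_cocone I \<Sigma> r) p0 \<pi>0"
      "induced (Sigma3 I \<Sigma>) C (F \<circ>\<^sub>2 Dom I \<circ>\<^sub>2 P0) L2 s L1 (p1_cocone I \<Sigma> r) p1 \<pi>1"
      "induced (Sigma3 I \<Sigma>) C (F \<circ>\<^sub>2 Dom I \<circ>\<^sub>2 P0) L2 s L1 (p2_cocone C I \<Sigma> F r) p2 \<pi>2"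
    obtain n0 where n0: "n0 \<in> inv_hom2 C (d0 \<odot>\<^bsub>C\<^esub> i) (id1 C L0)"
      "\<forall>x \<in> Obj I. n0 \<rhd>\<^bsub>C\<^esub> leg q x = \<delta>0 (id1 I x) \<bullet>\<^bsub>C\<^esub> (d0 \<lhd>\<^bsub>C\<^esub> \<iota> x)"
      by (rule unit_cell[OF ind(1) restrict_dom_cocone_id[OF bicolimit_cocones(1)] ind(3)], rule that)
    obtain n1 where n1: "n1 \<in> inv_hom2 C (d1 \<odot>\<^bsub>C\<^esub> i) (id1 C L0)"
      "\<forall>x \<in> Obj I. n1 \<rhd>\<^bsub>C\<^esub> leg q x = \<delta>1 (id1 I x) \<bullet>\<^bsub>C\<^esub> (d1 \<lhd>\<^bsub>C\<^esub> \<iota> x)"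
      by (rule unit_cell[OF ind(2) restrict_cod_cocone_id[OF bicolimit_cocones(1)] ind(3)], rule that)
    obtain \<theta>01 \<theta>02 \<theta>12 where \<theta>:
      "\<theta>01 \<in> inv_hom2 C (d0 \<odot>\<^bsub>C\<^esub> p0) (d0 \<odot>\<^bsub>C\<^esub> p1)"
      "\<theta>02 \<in> inv_hom2 C (d1 \<odot>\<^bsub>C\<^esub> p0) (d0 \<odot>\<^bsub>C\<^esub> p2)"
      "\<theta>12 \<in> inv_hom2 C (d1 \<odot>\<^bsub>C\<^esub> p1) (d1 \<odot>\<^bsub>C\<^esub> p2)"
      "\<forall>\<phi> \<in> Obj (Sigma3 I \<Sigma>). \<delta>0 (tri_p1 \<phi>) \<bullet>\<^bsub>C\<^esub> (d0 \<lhd>\<^bsub>C\<^esub> \<pi>1 \<phi>) \<bullet>\<^bsub>C\<^esub> (\<theta>01 \<rhd>\<^bsub>C\<^esub> leg s \<phi>) =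
        \<delta>0 (tri_p0 \<phi>) \<bullet>\<^bsub>C\<^esub> (d0 \<lhd>\<^bsub>C\<^esub> \<pi>0 \<phi>)"
      "\<forall>\<phi> \<in> Obj (Sigma3 I \<Sigma>). (\<delta>0 (tri_p2 \<phi>) \<rhd>\<^bsub>C\<^esub> F1 F (tri_p0 \<phi>)) \<bullet>\<^bsub>C\<^esub> (d0 \<lhd>\<^bsub>C\<^esub> \<pi>2 \<phi>) \<bullet>\<^bsub>C\<^esub>
        (\<theta>02 \<rhd>\<^bsub>C\<^esub> leg s \<phi>) = \<delta>1 (tri_p0 \<phi>) \<bullet>\<^bsub>C\<^esub> (d1 \<lhd>\<^bsub>C\<^esub> \<pi>0 \<phi>)"
      "\<forall>\<phi> \<in> Obj (Sigma3 I \<Sigma>). (leg q (tgt1 I (tri_p2 \<phi>)) \<lhd>\<^bsub>C\<^esub> F2 F (tri_fill \<phi>)) \<bullet>\<^bsub>C\<^esub>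
        (\<delta>1 (tri_p2 \<phi>) \<rhd>\<^bsub>C\<^esub> F1 F (tri_p0 \<phi>)) \<bullet>\<^bsub>C\<^esub> (d1 \<lhd>\<^bsub>C\<^esub> \<pi>2 \<phi>) \<bullet>\<^bsub>C\<^esub> (\<theta>12 \<rhd>\<^bsub>C\<^esub> leg s \<phi>) =
        \<delta>1 (tri_p1 \<phi>) \<bullet>\<^bsub>C\<^esub> (d1 \<lhd>\<^bsub>C\<^esub> \<pi>1 \<phi>)"
      by (rule face_cells[OF ind(1,2,4,5,6)], rule that)
    have codescent: "codescent_object C
        \<lparr>cd_X0 = L0, cd_X1 = L1, cd_X2 = L2,
         cd_p0 = p0, cd_p1 = p1, cd_p2 = p2, cd_d0 = d0, cd_d1 = d1, cd_i = i,
         cd_n0 = n0, cd_n1 = n1, cd_\<theta>01 = \<theta>01, cd_\<theta>02 = \<theta>02, cd_\<theta>12 = \<theta>12\<rparr>"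
      unfolding codescent_object_def codescent.simps
      by (intro conjI bicolimit_objects D1.inducedD(1)[OF ind(1)] D1.inducedD(1)[OF ind(2)]
          F.inducedD(1)[OF ind(3)] D2.inducedD(1)[OF ind(4)] D2.inducedD(1)[OF ind(5)]
          D2.inducedD(1)[OF ind(6)] n0(1) n1(1) \<theta>(1-3))
    show "\<exists>n0 n1 \<theta>01 \<theta>02 \<theta>12.
        codescent_object C
          \<lparr>cd_X0 = L0, cd_X1 = L1, cd_X2 = L2,
           cd_p0 = p0, cd_p1 = p1, cd_p2 = p2, cd_d0 = d0, cd_d1 = d1, cd_i = i,
           cd_n0 = n0, cd_n1 = n1, cd_\<theta>01 = \<theta>01, cd_\<theta>02 = \<theta>02, cd_\<theta>12 = \<theta>12\<rparr> \<and>
        (\<forall>x \<in> Obj I. n0 \<rhd>\<^bsub>C\<^esub> leg q x =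
          \<delta>0 (id1 I x) \<bullet>\<^bsub>C\<^esub> (d0 \<lhd>\<^bsub>C\<^esub> \<iota> x)) \<and>
        (\<forall>x \<in> Obj I. n1 \<rhd>\<^bsub>C\<^esub> leg q x =
          \<delta>1 (id1 I x) \<bullet>\<^bsub>C\<^esub> (d1 \<lhd>\<^bsub>C\<^esub> \<iota> x)) \<and>
        (\<forall>\<phi> \<in> Obj (Sigma3 I \<Sigma>).
          \<delta>0 (tri_p1 \<phi>) \<bullet>\<^bsub>C\<^esub> (d0 \<lhd>\<^bsub>C\<^esub> \<pi>1 \<phi>) \<bullet>\<^bsub>C\<^esub> (\<theta>01 \<rhd>\<^bsub>C\<^esub> leg s \<phi>) =
          \<delta>0 (tri_p0 \<phi>) \<bullet>\<^bsub>C\<^esub> (d0 \<lhd>\<^bsub>C\<^esub> \<pi>0 \<phi>)) \<and>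
        (\<forall>\<phi> \<in> Obj (Sigma3 I \<Sigma>).
          (\<delta>0 (tri_p2 \<phi>) \<rhd>\<^bsub>C\<^esub> F1 F (tri_p0 \<phi>)) \<bullet>\<^bsub>C\<^esub> (d0 \<lhd>\<^bsub>C\<^esub> \<pi>2 \<phi>) \<bullet>\<^bsub>C\<^esub> (\<theta>02 \<rhd>\<^bsub>C\<^esub> leg s \<phi>) =
          \<delta>1 (tri_p0 \<phi>) \<bullet>\<^bsub>C\<^esub> (d1 \<lhd>\<^bsub>C\<^esub> \<pi>0 \<phi>)) \<and>
        (\<forall>\<phi> \<in> Obj (Sigma3 I \<Sigma>).
          (leg q (tgt1 I (tri_p2 \<phi>)) \<lhd>\<^bsub>C\<^esub> F2 F (tri_fill \<phi>)) \<bullet>\<^bsub>C\<^esub>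
          (\<delta>1 (tri_p2 \<phi>) \<rhd>\<^bsub>C\<^esub> F1 F (tri_p0 \<phi>)) \<bullet>\<^bsub>C\<^esub> (d1 \<lhd>\<^bsub>C\<^esub> \<pi>2 \<phi>) \<bullet>\<^bsub>C\<^esub> (\<theta>12 \<rhd>\<^bsub>C\<^esub> leg s \<phi>) =
          \<delta>1 (tri_p1 \<phi>) \<bullet>\<^bsub>C\<^esub> (d1 \<lhd>\<^bsub>C\<^esub> \<pi>1 \<phi>))"
      by (rule exI[of _ n0], rule exI[of _ n1], rule exI[of _ \<theta>01], rule exI[of _ \<theta>02], rule exI[of _ \<theta>12])
        (intro conjI codescent n0(2) n1(2) \<theta>(4-6))
  qed
qed

end
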